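(* Let $C,C'>0$ and $\varepsilon\in(0,1)$ be constants. There exist constants $n_0,R,K$ depending only on $C,C',\varepsilon$ such that the following holds for all integers $n\ge n_0$. Let $w=(w_1,\dots,w_n)$ and $v=(v_1,\dots,v_n)$ be unit vectors in $\mathbb{R}^n$, let $\pi$ be a uniformly random permutation of $\{1,\dots,n\}$, and let $S_\pi=\sum_{i=1}^n w_iv_{\pi(i)}$. Assume that for some $L\in\mathbb{R}$ and some $0\le\delta\le1$, $$\rho:=\mathbb{P}\big(|S_\pi-L|\le\delta\big)\ge n^{-C}.$$ Then for any $\alpha\ge n^{-C'}$ and any $n'$ with $n^{\varepsilon}\le n'\le n$, setting $$m:=\Big\lceil\frac{1}{\alpha^2}\big(2\delta+3n\alpha\big)\Big\rceil,$$ there exists a proper symmetric GAP $Q\subset\mathbb{R}$ of rank $r_0\le R$ and size $|Q|\le K\,m\,\rho^{-1}(n')^{-r_0/2}$ such that for at least $(1-n'/n)n^4$ quadruples $(i,j,k,l)\in\{1,\dots,n\}^4$ the quantity $(w_i-w_j)(v_k-v_l)$ lies within distance at most $\alpha$ of a point of $Q$.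
   Context: A subset $P\subset\mathbb{R}$ is a generalized arithmetic progression (GAP) of rank $r$ if $P=\{g_0+m_1g_1+\dots+m_rg_r : m_i\in\mathbb{Z},\ N_i\le m_i\le N_i'\}$ for some reals $g_0,g_1,\dots,g_r$ and integers $N_i\le N_i'$. Its volume is $\prod_{i=1}^r(N_i'-N_i+1)$. It is proper if every element of $P$ has a unique representation in this form (equivalently $|P|$ equals the volume). It is symmetric if $g_0=0$ and $N_i=-N_i'$ for all $i$. The rank is a nonnegative integer; a symmetric GAP of rank $0$ is $\{0\}$. Unit vectors are with respect to the Euclidean norm. *)

theory Defs
  imports
    "HOL-Analysis.L2_Norm"
    "HOL-Combinatorics.Permutations"
    "HOL-Probability.Probability"
begin

text \<open>
  Vectors of \<open>\<real>\<^sup>n\<close> are functions \<open>nat \<Rightarrow> real\<close> of which only the coordinates \<open>1, \<dots>, n\<close> matter;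
  in this way the dimension \<open>n\<close> can be quantified after the constants.
\<close>

definition unit_vec :: "nat \<Rightarrow> (nat \<Rightarrow> real) \<Rightarrow> bool" where
  "unit_vec n w \<longleftrightarrow> L2_set w {1..n} = 1"

definition perm_sum :: "nat \<Rightarrow> (nat \<Rightarrow> real) \<Rightarrow> (nat \<Rightarrow> real) \<Rightarrow> (nat \<Rightarrow> nat) \<Rightarrow> real" where
  "perm_sum n w v \<pi> = (\<Sum>i=1..n. w i * v (\<pi> i))"

definition random_perm :: "nat \<Rightarrow> (nat \<Rightarrow> nat) pmf" where
  "random_perm n = pmf_of_set {\<pi>. \<pi> permutes {1..n}}"

text \<open>
  The data of a generalized arithmetic progression of rank \<open>r\<close> are \<open>g\<^sub>0\<close>, the generators
  \<open>g 1, \<dots>, g r\<close> and the integer bounds \<open>N i \<le> N' i\<close> for \<open>1 \<le> i \<le> r\<close>. Coefficient vectors are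
  extensional functions on \<open>{1..r}\<close>, so that distinct members of \<open>gap_coeffs\<close> are distinct
  representations.
\<close>

definition gap_coeffs :: "nat \<Rightarrow> (nat \<Rightarrow> int) \<Rightarrow> (nat \<Rightarrow> int) \<Rightarrow> (nat \<Rightarrow> int) set" where
  "gap_coeffs r N N' = (\<Pi>\<^sub>E i\<in>{1..r}. {N i..N' i})"

definition gap_point :: "nat \<Rightarrow> real \<Rightarrow> (nat \<Rightarrow> real) \<Rightarrow> (nat \<Rightarrow> int) \<Rightarrow> real" where
  "gap_point r g0 g m = g0 + (\<Sum>i=1..r. of_int (m i) * g i)"

definition gap_represents ::
  "nat \<Rightarrow> real \<Rightarrow> (nat \<Rightarrow> real) \<Rightarrow> (nat \<Rightarrow> int) \<Rightarrow> (nat \<Rightarrow> int) \<Rightarrow> real set \<Rightarrow> bool" where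
  "gap_represents r g0 g N N' P \<longleftrightarrow>
     (\<forall>i\<in>{1..r}. N i \<le> N' i) \<and> P = gap_point r g0 g ` gap_coeffs r N N'"

definition gap_proper ::
  "nat \<Rightarrow> real \<Rightarrow> (nat \<Rightarrow> real) \<Rightarrow> (nat \<Rightarrow> int) \<Rightarrow> (nat \<Rightarrow> int) \<Rightarrow> real set \<Rightarrow> bool" where
  "gap_proper r g0 g N N' P \<longleftrightarrow>
     (\<forall>x\<in>P. \<exists>!m. m \<in> gap_coeffs r N N' \<and> x = gap_point r g0 g m)"

definition gap_symmetric :: "nat \<Rightarrow> real \<Rightarrow> (nat \<Rightarrow> int) \<Rightarrow> (nat \<Rightarrow> int) \<Rightarrow> bool" where
  "gap_symmetric r g0 N N' \<longleftrightarrow> g0 = 0 \<and> (\<forall>i\<in>{1..r}. N i = - N' i)"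

text \<open>
  Rank, properness and symmetry belong to a presentation of the set; all three are required of
  the same presentation.
\<close>

definition proper_symmetric_gap :: "nat \<Rightarrow> real set \<Rightarrow> bool" where
  "proper_symmetric_gap r P \<longleftrightarrow>
     (\<exists>g0 g N N'. gap_represents r g0 g N N' P \<and> gap_proper r g0 g N N' P \<and>
                  gap_symmetric r g0 N N')"

end

theory Submission
  imports Defs "HOL-Real_Asymp.Real_Asymp"
begin

text \<open>
  Rounding \<open>w\<close> and \<open>v\<close> to multiples of \<open>\<alpha> / 8\<close> produces integers \<open>a\<^sub>i\<close>, \<open>b\<^sub>i\<close> and a value of
  \<open>\<Sum> a\<^sub>i b\<^bsub>\<pi>(i)\<^esub>\<close> that is attained with probability at least \<open>\<rho> / (65 m)\<close>.
  Write \<open>d\<^sub>q = (a\<^sub>i - a\<^sub>j) (b\<^sub>k - b\<^sub>l)\<close> for a quadruple \<open>q\<close>. Averaging over swaps inside pairs of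
  positions bounds the characteristic function at \<open>t\<close> by the expectation of \<open>exp (- X / 2)\<close>, where
  \<open>X\<close> sums \<open>sin\<^sup>2 (\<pi> t d\<^sub>q)\<close> over the quadruples selected by two random permutations;
  since a transposition changes \<open>X\<close> by at most \<open>2\<close>, the logarithmic derivative of its Laplace transform
  shows that this is at most \<open>exp (- c n \<psi>(t))\<close> with \<open>\<psi>\<close> the mean of \<open>sin\<^sup>2 (\<pi> t d\<^sub>q)\<close> over all quadruples.

  As in the work of Nguyen and Vu, a level set \<open>{n \<psi> \<le> \<ell>}\<close> with \<open>\<ell> = O(log n)\<close> is then large, and by duality the
  \<open>k\<close>-fold sumset of the set \<open>X\<close> of all but few of the \<open>d\<^sub>q\<close> is small for \<open>k\<^sup>2 = n' / (4 \<ell>)\<close>.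

  Finally, a set \<open>X\<close> whose \<open>k\<close>-fold sumset is polynomial in \<open>k\<close> lies in a proper symmetric GAP of the right size:
  the universal ambient group of \<open>X\<close> of order \<open>t\<close> has bounded rank for \<open>t\<close> a power of \<open>k\<close>, hence is
  the same lattice for two scales \<open>t < T\<close>. If boundedly many words of length about \<open>T\<close> failed to cover this
  lattice modulo a sublattice spanned by elements of \<open>X\<close>, some nontrivial
  character would be within \<open>1 / (2 t)\<close> of \<open>1\<close> on \<open>X\<close>, and its logarithm would be a new linear functional
  compatible with all relations of length \<open>t\<close>. So the words fill the lattice, and projecting
  along short vectors (of the kernel, or shortest ones) gives the progression.
\<close>

section \<open>Geometry of numbers\<close>

text \<open>The level \<open>m\<close> of the level set may be as large as a multiple of log n, and
  \<open>k\<close> of order sqrt (n' / m) then loses m^(d/2) against the wanted power of n'. The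
  loss is repaid by choosing the level with geometric weights: the level set exceeds what is needed
  by a factor exp (c m / 2), duality makes the \<open>k\<close>-fold sumset smaller by the same
  factor, and the exponential beats every power of \<open>m\<close>. A sumset bound of the form
  k^\<gamma> gives no bounded doubling at any fixed scale. What it does bound is the number of
  independent directions, and this number is what singles out two scales with the same group. The
  factor k^d between sumset and progression comes from comparing two dilates: all of
  \<open>X\<close> lies in a cube of bounded radius of the lattice, whereas a cube of radius of
  order k still takes its values in the \<open>k\<close>-fold sumset. A kernel vector that is short
  at the larger scale lowers the dimension, and with it the saving that is claimed.\<close>

definition cube :: "'i set \<Rightarrow> real \<Rightarrow> ('i \<Rightarrow> real) set" where
  "cube I s = {w. \<forall>i\<in>I. \<bar>w i\<bar> \<le> s}"

text \<open>A discrete subgroup that need not span. Its vectors are functions on the whole type that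
  vanish outside \<open>I\<close>, so a projection that kills a coordinate does not change the
  type.\<close>

definition lattice_on :: "'i set \<Rightarrow> ('i \<Rightarrow> real) set \<Rightarrow> bool" where
  "lattice_on I \<Lambda> \<longleftrightarrow> (\<lambda>i. 0) \<in> \<Lambda> \<and> (\<forall>u\<in>\<Lambda>. \<forall>w\<in>\<Lambda>. (\<lambda>i. u i - w i) \<in> \<Lambda>) \<and>
     (\<forall>w\<in>\<Lambda>. \<forall>i. i \<notin> I \<longrightarrow> w i = 0) \<and> (\<forall>s. finite (\<Lambda> \<inter> cube I s))"

definition icomb :: "nat \<Rightarrow> (nat \<Rightarrow> 'i \<Rightarrow> real) \<Rightarrow> (nat \<Rightarrow> int) \<Rightarrow> 'i \<Rightarrow> real" where
  "icomb d g m = (\<lambda>j. \<Sum>i=1..d. of_int (m i) * g i j)"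

text \<open>For \<open>l i0\<close> nonzero, the projection along \<open>l\<close> onto the
  hyperplane where the coordinate \<open>i0\<close> vanishes.\<close>

definition proj_along :: "'i \<Rightarrow> ('i \<Rightarrow> real) \<Rightarrow> ('i \<Rightarrow> real) \<Rightarrow> 'i \<Rightarrow> real" where
  "proj_along i0 l w = (\<lambda>j. w j - (w i0 / l i0) * l j)"

lemma cube_mono: "w \<in> cube I s \<Longrightarrow> s \<le> t \<Longrightarrow> w \<in> cube I t"
  unfolding cube_def by (blast intro: order_trans)

lemma lattice_on_zero: "lattice_on I \<Lambda> \<Longrightarrow> (\<lambda>i. 0) \<in> \<Lambda>"
  and lattice_on_diff: "lattice_on I \<Lambda> \<Longrightarrow> u \<in> \<Lambda> \<Longrightarrow> w \<in> \<Lambda> \<Longrightarrow> (\<lambda>i. u i - w i) \<in> \<Lambda>"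
  and lattice_on_support: "lattice_on I \<Lambda> \<Longrightarrow> w \<in> \<Lambda> \<Longrightarrow> i \<notin> I \<Longrightarrow> w i = 0"
  and lattice_on_finite: "lattice_on I \<Lambda> \<Longrightarrow> finite (\<Lambda> \<inter> cube I s)"
  unfolding lattice_on_def by blast+

lemma lattice_on_add:
  assumes "lattice_on I \<Lambda>" "u \<in> \<Lambda>" "w \<in> \<Lambda>"
  shows "(\<lambda>i. u i + w i) \<in> \<Lambda>"
  using lattice_on_diff[OF assms(1,2) lattice_on_diff[OF assms(1) lattice_on_zero[OF assms(1)] assms(3)]]
  by simp

lemma lattice_on_int_mult:
  assumes "lattice_on I \<Lambda>" "u \<in> \<Lambda>"
  shows "(\<lambda>i. of_int k * u i) \<in> \<Lambda>"
proof (induction k rule: int_induct[where k = 0])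
  case base
  then show ?case using lattice_on_zero[OF assms(1)] by simp
next
  case (step1 i)
  then show ?case using lattice_on_add[OF assms(1) step1(2) assms(2)] by (simp add: algebra_simps)
next
  case (step2 i)
  then show ?case using lattice_on_diff[OF assms(1) step2(2) assms(2)] by (simp add: algebra_simps)
qed

lemma icomb_in_lattice:
  assumes "lattice_on I \<Lambda>" "\<And>i. i \<in> {1..d} \<Longrightarrow> g i \<in> \<Lambda>"
  shows "icomb d g m \<in> \<Lambda>"
  using assms(2)
proof (induction d)
  case 0
  then show ?case using lattice_on_zero[OF assms(1)] by (simp add: icomb_def)
next
  case (Suc d)
  have "icomb (Suc d) g m = (\<lambda>j. icomb d g m j + of_int (m (Suc d)) * g (Suc d) j)"
    by (simp add: icomb_def)
  then show ?case
    using lattice_on_add[OF assms(1) Suc.IH lattice_on_int_mult[OF assms(1), of "g (Suc d)"]] Suc.prems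
    by simp
qed

lemma proj_along_diff:
  "proj_along i0 l (\<lambda>i. u i - w i) = (\<lambda>i. proj_along i0 l u i - proj_along i0 l w i)"
  by (auto simp: proj_along_def algebra_simps diff_divide_distrib)

lemma proj_along_icomb:
  "proj_along i0 l (icomb d g m) = icomb d (\<lambda>i. proj_along i0 l (g i)) m"
  by (auto simp: proj_along_def icomb_def algebra_simps sum_subtractf sum_distrib_left sum_divide_distrib)

text \<open>As \<open>i0\<close> is dominant in \<open>l\<close>, the multiple of \<open>l\<close>
  that is subtracted is nowhere larger than \<open>\<bar>w i0\<bar>\<close>; this keeps the loss to
  a factor 2.\<close>

lemma proj_along_cube:
  assumes "i0 \<in> I" "\<And>i. i \<in> I \<Longrightarrow> \<bar>l i\<bar> \<le> \<bar>l i0\<bar>" "l i0 \<noteq> 0" "w \<in> cube I s"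
  shows "proj_along i0 l w \<in> cube (I - {i0}) (2 * s)"
proof -
  have "\<bar>proj_along i0 l w i\<bar> \<le> 2 * s" if "i \<in> I" for i
  proof -
    have "\<bar>w i0 / l i0 * l i\<bar> = \<bar>w i0\<bar> * (\<bar>l i\<bar> / \<bar>l i0\<bar>)" by (simp add: abs_mult)
    also have "\<dots> \<le> \<bar>w i0\<bar> * 1"
      using assms(2)[OF that] assms(3) by (intro mult_left_mono) auto
    finally have "\<bar>w i0 / l i0 * l i\<bar> \<le> s" using assms(1,4) by (force simp: cube_def)
    moreover have "\<bar>w i\<bar> \<le> s" using assms(4) that by (simp add: cube_def)
    ultimately show ?thesis unfolding proj_along_def by linarith
  qed
  then show ?thesis by (simp add: cube_def)
qed

text \<open>Subtracting an integer multiple of \<open>l\<close> makes the \<open>i0\<close>-coordinate of a preimage small, and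
  then every other coordinate changes by at most \<open>\<bar>l i0\<bar> / 2\<close> since \<open>i0\<close> is dominant in \<open>l\<close>.\<close>
lemma proj_along_lift:
  assumes "lattice_on I \<Lambda>" "l \<in> \<Lambda>" "i0 \<in> I" "\<And>i. i \<in> I \<Longrightarrow> \<bar>l i\<bar> \<le> \<bar>l i0\<bar>" "l i0 \<noteq> 0"
    and "w' \<in> proj_along i0 l ` \<Lambda>"
  shows "\<exists>w\<in>\<Lambda>. proj_along i0 l w = w' \<and> \<bar>w i0\<bar> \<le> \<bar>l i0\<bar> / 2 \<and> (\<forall>j\<in>I. \<bar>w j\<bar> \<le> \<bar>w' j\<bar> + \<bar>l i0\<bar> / 2)"
proof -
  obtain u where u: "u \<in> \<Lambda>" "w' = proj_along i0 l u" using assms(6) by blast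
  define k where "k = round (u i0 / l i0)"
  define w where "w = (\<lambda>i. u i - of_int k * l i)"
  have w: "w \<in> \<Lambda>" unfolding w_def
    by (rule lattice_on_diff[OF assms(1) u(1) lattice_on_int_mult[OF assms(1,2)]])
  have p: "proj_along i0 l w = w'"
    using assms(5) by (auto simp: proj_along_def w_def u(2) field_simps)
  have q: "\<bar>w i0 / l i0\<bar> \<le> 1 / 2"
    using of_int_round_abs_le[of "u i0 / l i0"] assms(5)
    by (simp add: w_def k_def diff_divide_distrib abs_minus_commute)
  have r: "\<bar>w i0\<bar> \<le> \<bar>l i0\<bar> / 2"
    using q assms(5) by (simp add: abs_divide field_simps)
  have "\<bar>w j\<bar> \<le> \<bar>w' j\<bar> + \<bar>l i0\<bar> / 2" if "j \<in> I" for j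
  proof -
    have "w j = w' j + (w i0 / l i0) * l j" using p by (auto simp: proj_along_def)
    moreover have "\<bar>(w i0 / l i0) * l j\<bar> \<le> (1/2) * \<bar>l i0\<bar>"
      unfolding abs_mult by (rule mult_mono[OF q assms(4)[OF that]]) auto
    ultimately show ?thesis by linarith
  qed
  then show ?thesis using w p r by blast
qed

text \<open>Discreteness survives because a bounded point of the image lifts to a bounded point of
  \<open>\<Lambda>\<close>, and there are finitely many of these.\<close>

lemma lattice_on_proj:
  assumes "lattice_on I \<Lambda>" "l \<in> \<Lambda>" "i0 \<in> I" "\<And>i. i \<in> I \<Longrightarrow> \<bar>l i\<bar> \<le> \<bar>l i0\<bar>" "l i0 \<noteq> 0"
  shows "lattice_on (I - {i0}) (proj_along i0 l ` \<Lambda>)"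
  unfolding lattice_on_def
proof (intro conjI ballI allI impI)
  show "(\<lambda>i. 0) \<in> proj_along i0 l ` \<Lambda>"
    using imageI[OF lattice_on_zero[OF assms(1)], of "proj_along i0 l"] by (simp add: proj_along_def)
next
  fix u w assume "u \<in> proj_along i0 l ` \<Lambda>" "w \<in> proj_along i0 l ` \<Lambda>"
  then show "(\<lambda>i. u i - w i) \<in> proj_along i0 l ` \<Lambda>"
    using lattice_on_diff[OF assms(1)] by (auto simp: proj_along_diff[symmetric])
next
  fix w i assume "w \<in> proj_along i0 l ` \<Lambda>" "i \<notin> I - {i0}"
  then show "w i = 0"
    using lattice_on_support[OF assms(1) _, of _ i] lattice_on_support[OF assms(1,2), of i] assms(5)
    by (cases "i = i0") (auto simp: proj_along_def)
next
  fix s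
  \<comment> \<open>The coordinate \<open>i0\<close> of the lift is bounded by
    \<open>\<bar>l i0\<bar> / 2\<close> only, so the radius must not fall below this value when
    \<open>s\<close> is negative.\<close>
  have "proj_along i0 l ` \<Lambda> \<inter> cube (I - {i0}) s \<subseteq> proj_along i0 l ` (\<Lambda> \<inter> cube I (max s 0 + \<bar>l i0\<bar> / 2))"
  proof
    fix w' assume w': "w' \<in> proj_along i0 l ` \<Lambda> \<inter> cube (I - {i0}) s"
    then obtain w where w: "w \<in> \<Lambda>" "proj_along i0 l w = w'" "\<bar>w i0\<bar> \<le> \<bar>l i0\<bar> / 2"
      "\<forall>j\<in>I. \<bar>w j\<bar> \<le> \<bar>w' j\<bar> + \<bar>l i0\<bar> / 2"
      using proj_along_lift[OF assms] by blast
    have "\<bar>w j\<bar> \<le> max s 0 + \<bar>l i0\<bar> / 2" if "j \<in> I" for j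
    proof (cases "j = i0")
      case False
      then have "\<bar>w' j\<bar> \<le> s" using w' that by (simp add: cube_def)
      then show ?thesis using w(4) that by fastforce
    qed (use w(3) in auto)
    then show "w' \<in> proj_along i0 l ` (\<Lambda> \<inter> cube I (max s 0 + \<bar>l i0\<bar> / 2))"
      using w(1,2) by (auto simp: cube_def)
  qed
  then show "finite (proj_along i0 l ` \<Lambda> \<inter> cube (I - {i0}) s)"
    using finite_subset lattice_on_finite[OF assms(1)] by blast
qed

lemma lattice_on_shortest:
  assumes "finite I" "lattice_on I \<Lambda>" "u \<in> \<Lambda>" "u \<noteq> (\<lambda>i. 0)" "u \<in> cube I s"
  obtains l i0 where "l \<in> \<Lambda>" "i0 \<in> I" "\<And>i. i \<in> I \<Longrightarrow> \<bar>l i\<bar> \<le> \<bar>l i0\<bar>" "l i0 \<noteq> 0" "\<bar>l i0\<bar> \<le> s"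
    "\<And>w. w \<in> \<Lambda> \<Longrightarrow> (\<And>i. i \<in> I \<Longrightarrow> \<bar>w i\<bar> < \<bar>l i0\<bar>) \<Longrightarrow> w = (\<lambda>i. 0)"
proof -
  define nrm where "nrm w = Max ((\<lambda>i. \<bar>w i\<bar>) ` I)" for w :: "'a \<Rightarrow> real"
  obtain i where i: "i \<in> I" "u i \<noteq> 0" using assms lattice_on_support by fast
  then have ne: "I \<noteq> {}" by auto
  define S where "S = {w \<in> \<Lambda> \<inter> cube I s. w \<noteq> (\<lambda>i. 0)}"
  have S: "finite S" "S \<noteq> {}"
    using assms(3-5) finite_subset[OF _ lattice_on_finite[OF assms(2), of s], of S] by (auto simp: S_def)
  obtain l where l: "l \<in> S" "\<forall>w\<in>S. nrm l \<le> nrm w"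
    using ex_is_arg_min_if_finite[OF S, of nrm] by (auto simp: is_arg_min_def not_less)
  have "nrm l \<in> (\<lambda>i. \<bar>l i\<bar>) ` I" unfolding nrm_def using assms(1) ne by (intro Max_in) auto
  then obtain i0 where i0: "i0 \<in> I" "nrm l = \<bar>l i0\<bar>" by blast
  have dom: "\<bar>l i\<bar> \<le> \<bar>l i0\<bar>" if "i \<in> I" for i
    using assms(1) that unfolding i0(2)[symmetric] nrm_def by (intro Max_ge) auto
  have nz: "l i0 \<noteq> 0"
  proof
    assume "l i0 = 0"
    then have "l i = 0" for i
      using dom lattice_on_support[OF assms(2)] l(1) S_def by (cases "i \<in> I") force+
    then show False using l(1) by (auto simp: S_def)
  qed
  have ls: "\<bar>l i0\<bar> \<le> s" using l(1) i0 by (auto simp: S_def cube_def)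
  have "w = (\<lambda>i. 0)" if w: "w \<in> \<Lambda>" "\<And>i. i \<in> I \<Longrightarrow> \<bar>w i\<bar> < \<bar>l i0\<bar>" for w
  proof (rule ccontr)
    assume "w \<noteq> (\<lambda>i. 0)"
    then have "w \<in> S" using w ls by (auto simp: S_def cube_def intro: order_trans[OF less_imp_le])
    then have "nrm l \<le> nrm w" using l by blast
    moreover have "nrm w < \<bar>l i0\<bar>" unfolding nrm_def using assms(1) ne w(2) by (subst Max_less_iff) auto
    ultimately show False using i0 by simp
  qed
  then show ?thesis using that i0 dom nz ls l(1) S_def by blast
qed

section \<open>Bases adapted to a cube\<close>

lemma icomb_cube:
  assumes "\<And>i. i \<in> {1..d} \<Longrightarrow> \<bar>m i\<bar> \<le> N i" "\<And>i j. i \<in> {1..d} \<Longrightarrow> j \<in> I \<Longrightarrow> of_int (N i) * \<bar>g i j\<bar> \<le> s"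
  shows "icomb d g m \<in> cube I (real d * s)"
proof -
  have "\<bar>icomb d g m j\<bar> \<le> real d * s" if "j \<in> I" for j
  proof -
    have "\<bar>icomb d g m j\<bar> \<le> (\<Sum>i=1..d. \<bar>of_int (m i) * g i j\<bar>)"
      unfolding icomb_def by (rule sum_abs)
    also have "\<dots> \<le> (\<Sum>i=1..d. s)"
    proof (rule sum_mono)
      fix i assume i: "i \<in> {1..d}"
      have "\<bar>of_int (m i) * g i j\<bar> = of_int \<bar>m i\<bar> * \<bar>g i j\<bar>" by (simp add: abs_mult)
      also have "\<dots> \<le> of_int (N i) * \<bar>g i j\<bar>" using assms(1)[OF i] by (intro mult_right_mono) auto
      also have "\<dots> \<le> s" using assms(2)[OF i that] .
      finally show "\<bar>of_int (m i) * g i j\<bar> \<le> s" .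
    qed
    finally show ?thesis by simp
  qed
  then show ?thesis by (simp add: cube_def)
qed

text \<open>A discrete form of John's theorem: the box given by \<open>N\<close> covers the lattice
  points of the cube of radius \<open>s\<close>, while the bound \<open>b\<close> confines its
  combinations to a cube of radius \<open>d * b\<close>. The vectors need not generate
  \<open>\<Lambda>\<close>, since only those visible at scale \<open>s\<close> count.
  \<open>N i \<ge> 1\<close> ensures that dilating the box by k multiplies its volume by about k in
  every direction.\<close>

definition reduced_basis ::
  "'i set \<Rightarrow> ('i \<Rightarrow> real) set \<Rightarrow> real \<Rightarrow> real \<Rightarrow> nat \<Rightarrow> (nat \<Rightarrow> 'i \<Rightarrow> real) \<Rightarrow> (nat \<Rightarrow> int) \<Rightarrow> bool" where
  "reduced_basis I \<Lambda> s b d g N \<longleftrightarrow>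
     (\<forall>i\<in>{1..d}. g i \<in> \<Lambda> \<and> N i \<ge> 1 \<and> (\<forall>j\<in>I. of_int (N i) * \<bar>g i j\<bar> \<le> b)) \<and>
     (\<forall>m. icomb d g m = (\<lambda>j. 0) \<longrightarrow> (\<forall>i\<in>{1..d}. m i = 0)) \<and>
     (\<forall>w\<in>\<Lambda> \<inter> cube I s. \<exists>m. (\<forall>i\<in>{1..d}. \<bar>m i\<bar> \<le> N i) \<and> w = icomb d g m)"

lemma reduced_basisD:
  assumes "reduced_basis I \<Lambda> s b d g N"
  shows "\<And>i. i \<in> {1..d} \<Longrightarrow> g i \<in> \<Lambda>"
    and "\<And>i. i \<in> {1..d} \<Longrightarrow> N i \<ge> 1"
    and "\<And>i j. i \<in> {1..d} \<Longrightarrow> j \<in> I \<Longrightarrow> of_int (N i) * \<bar>g i j\<bar> \<le> b"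
    and "\<And>m. icomb d g m = (\<lambda>j. 0) \<Longrightarrow> \<forall>i\<in>{1..d}. m i = 0"
    and "\<And>w. w \<in> \<Lambda> \<inter> cube I s \<Longrightarrow> \<exists>m. (\<forall>i\<in>{1..d}. \<bar>m i\<bar> \<le> N i) \<and> w = icomb d g m"
  using assms unfolding reduced_basis_def by blast+

lemma reduced_basis_mono:
  assumes "reduced_basis I \<Lambda> s b d g N" "b \<le> b'"
  shows "reduced_basis I \<Lambda> s b' d g N"
  using assms unfolding reduced_basis_def by (meson order_trans)

text \<open>A basis of the projection along a shortest vector \<open>l\<close> is lifted and
  completed by \<open>l\<close>. Lifting perturbs coordinates by up to \<open>\<mu> / 2\<close>,
  which must stay harmless after multiplication by \<open>N i\<close>: the lift is a nonzero lattice
  vector, hence has a coordinate of size at least \<open>\<mu>\<close>; this is not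
  \<open>i0\<close>, so the projected vector has size at least \<open>\<mu> / 2\<close> there, and
  the bound on \<open>N i\<close> times that coordinate bounds \<open>N i * \<mu>\<close>.\<close>

lemma lattice_reduced_basis_step:
  fixes \<Lambda> :: "('i \<Rightarrow> real) set"
  assumes fin: "finite I" and L: "lattice_on I \<Lambda>" and s: "s > 0" and C: "C \<ge> 1"
    and l: "l \<in> \<Lambda>" "i0 \<in> I" "\<And>i. i \<in> I \<Longrightarrow> \<bar>l i\<bar> \<le> \<bar>l i0\<bar>" "l i0 \<noteq> 0" "\<bar>l i0\<bar> \<le> s"
    and short: "\<And>w. w \<in> \<Lambda> \<Longrightarrow> (\<And>i. i \<in> I \<Longrightarrow> \<bar>w i\<bar> < \<bar>l i0\<bar>) \<Longrightarrow> w = (\<lambda>i. 0)"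
    and rb: "reduced_basis (I - {i0}) (proj_along i0 l ` \<Lambda>) (2 * s) (C * (2 * s)) d g' N"
  shows "\<exists>g N. reduced_basis I \<Lambda> s (4 * C * real (d + 1) * s) (Suc d) g N"
proof -
  note g' = reduced_basisD(1)[OF rb] and N = reduced_basisD(2)[OF rb] and Ng = reduced_basisD(3)[OF rb]
    and indep = reduced_basisD(4)[OF rb] and cover = reduced_basisD(5)[OF rb]
  define \<mu> where "\<mu> = \<bar>l i0\<bar>"
  have mu: "0 < \<mu>" "\<mu> \<le> s" using l by (auto simp: \<mu>_def)
  have "\<exists>w\<in>\<Lambda>. proj_along i0 l w = g' i \<and> \<bar>w i0\<bar> \<le> \<mu> / 2 \<and> (\<forall>j\<in>I. \<bar>w j\<bar> \<le> \<bar>g' i j\<bar> + \<mu> / 2)"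
    if "i \<in> {1..d}" for i
    unfolding \<mu>_def using proj_along_lift[OF L l(1-4) g'[OF that]] .
  then obtain h where h: "\<And>i. i \<in> {1..d} \<Longrightarrow> h i \<in> \<Lambda>"
      "\<And>i. i \<in> {1..d} \<Longrightarrow> proj_along i0 l (h i) = g' i"
      "\<And>i. i \<in> {1..d} \<Longrightarrow> \<bar>h i i0\<bar> \<le> \<mu> / 2"
      "\<And>i j. i \<in> {1..d} \<Longrightarrow> j \<in> I \<Longrightarrow> \<bar>h i j\<bar> \<le> \<bar>g' i j\<bar> + \<mu> / 2"
    by metis
  define g where "g = h(Suc d := l)"
  define M where "M = \<lceil>(1 + 2 * real d * C) * s / \<mu>\<rceil>"
  define N2 where "N2 = N(Suc d := M)"
  have gi: "g i = h i" "N2 i = N i" if "i \<in> {1..d}" for i using that by (auto simp: g_def N2_def)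
  have gS: "g (Suc d) = l" "N2 (Suc d) = M" by (auto simp: g_def N2_def)
  have ic: "icomb (Suc d) g m = (\<lambda>j. icomb d h m j + of_int (m (Suc d)) * l j)" for m
  proof -
    have "(\<Sum>i=1..d. of_int (m i) * g i j) = (\<Sum>i=1..d. of_int (m i) * h i j)" for j
      by (rule sum.cong) (auto simp: gi)
    then show ?thesis by (auto simp: icomb_def gS)
  qed
  have pl: "proj_along i0 l (icomb d h m) = icomb d g' m" for m
  proof -
    have "icomb d (\<lambda>i. proj_along i0 l (h i)) m = icomb d g' m"
      unfolding icomb_def by (intro ext sum.cong) (auto simp: h(2))
    then show ?thesis by (simp add: proj_along_icomb)
  qed
  have big: "of_int (N i) * \<mu> \<le> 4 * C * s" if i: "i \<in> {1..d}" for i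
  proof -
    have "h i \<noteq> (\<lambda>j. 0)"
    proof
      assume "h i = (\<lambda>j. 0)"
      then have z: "g' i = (\<lambda>j. 0)" using h(2)[OF i] by (auto simp: proj_along_def)
      have "icomb d g' (\<lambda>k. if k = i then 1 else 0) = (\<lambda>j. 0)"
        unfolding icomb_def by (intro ext sum.neutral) (auto simp: z)
      from indep[OF this] i show False by force
    qed
    then obtain j where j: "j \<in> I" "\<mu> \<le> \<bar>h i j\<bar>"
      using short[OF h(1)[OF i]] unfolding \<mu>_def by (meson not_le)
    have "j \<noteq> i0" using j(2) h(3)[OF i] mu by auto
    moreover have "\<mu> / 2 \<le> \<bar>g' i j\<bar>" using h(4)[OF i j(1)] j(2) by linarith
    ultimately have "of_int (N i) * (\<mu> / 2) \<le> C * (2 * s)"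
      using Ng[OF i, of j] j(1) N[OF i]
      by (meson DiffI empty_iff insertE mult_left_mono of_int_0_le_iff order_trans zero_le_one)
    then show ?thesis by simp
  qed
  have big0: "of_int M * \<mu> \<le> (2 + 2 * real d * C) * s" and M: "M \<ge> 1"
    and Mge: "(1 + 2 * real d * C) * s \<le> of_int M * \<mu>"
  proof -
    have "of_int M \<le> (1 + 2 * real d * C) * s / \<mu> + 1" unfolding M_def by linarith
    then have "of_int M * \<mu> \<le> ((1 + 2 * real d * C) * s / \<mu> + 1) * \<mu>"
      using mu by (intro mult_right_mono) auto
    also have "\<dots> = (1 + 2 * real d * C) * s + \<mu>" using mu by (simp add: field_simps)
    finally show "of_int M * \<mu> \<le> (2 + 2 * real d * C) * s" using mu by (simp add: algebra_simps)
    have "(1 + 2 * real d * C) * s / \<mu> > 0" using mu s C by (simp add: add_pos_nonneg)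
    then show "M \<ge> 1" unfolding M_def by linarith
    have "(1 + 2 * real d * C) * s / \<mu> \<le> of_int M" unfolding M_def by linarith
    then show "(1 + 2 * real d * C) * s \<le> of_int M * \<mu>" using mu by (simp add: field_simps)
  qed
  have c1: "g i \<in> \<Lambda> \<and> N2 i \<ge> 1 \<and> (\<forall>j\<in>I. of_int (N2 i) * \<bar>g i j\<bar> \<le> (4 * C * real (d + 1)) * s)"
    if "i \<in> {1..Suc d}" for i
  proof (cases "i = Suc d")
    case True
    have "of_int M * \<bar>l j\<bar> \<le> (4 * C * real (d + 1)) * s" if "j \<in> I" for j
    proof -
      have "of_int M * \<bar>l j\<bar> \<le> of_int M * \<mu>"
        using l(3)[OF that] M by (intro mult_left_mono) (auto simp: \<mu>_def)
      also have "\<dots> \<le> (2 + 2 * real d * C) * s" by (rule big0)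
      also have "\<dots> \<le> (4 * C * real (d + 1)) * s"
      proof (rule mult_right_mono)
        have "4 * C * real (d + 1) = 2 * C + 2 * C + 2 * real d * C + 2 * real d * C"
          by (simp add: algebra_simps)
        moreover have "0 \<le> 2 * real d * C" using C by simp
        ultimately show "2 + 2 * real d * C \<le> 4 * C * real (d + 1)" using C by linarith
      qed (use s in auto)
      finally show ?thesis .
    qed
    then show ?thesis using True gS l M by auto
  next
    case False
    then have i: "i \<in> {1..d}" using that by auto
    have "of_int (N i) * \<bar>h i j\<bar> \<le> (4 * C * real (d + 1)) * s" if j: "j \<in> I" for j
    proof -
      have "of_int (N i) * \<bar>h i j\<bar> \<le> 4 * C * s"
      proof (cases "j = i0")
        case True
        have "of_int (N i) * \<bar>h i j\<bar> \<le> of_int (N i) * \<mu>"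
          using h(3)[OF i] True mu N[OF i] by (intro mult_left_mono) auto
        then show ?thesis using big[OF i] by linarith
      next
        case False
        have "of_int (N i) * \<bar>h i j\<bar> \<le> of_int (N i) * (\<bar>g' i j\<bar> + \<mu> / 2)"
          using h(4)[OF i j] N[OF i] by (intro mult_left_mono) auto
        also have "\<dots> \<le> C * (2 * s) + 4 * C * s / 2"
          using Ng[OF i, of j] False j big[OF i] by (simp add: algebra_simps)
        finally show ?thesis by simp
      qed
      also have "\<dots> \<le> (4 * C * real (d + 1)) * s"
        using C s by (intro mult_right_mono) auto
      finally show ?thesis .
    qed
    then show ?thesis using gi[OF i] h(1)[OF i] N[OF i] by simp
  qed
  have c2: "\<forall>i\<in>{1..Suc d}. m i = 0" if "icomb (Suc d) g m = (\<lambda>j. 0)" for m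
  proof -
    have z: "icomb d h m j + of_int (m (Suc d)) * l j = 0" for j
      using that unfolding ic by meson
    then have "icomb d h m = (\<lambda>j. - (of_int (m (Suc d)) * l j))"
      by (intro ext) (metis add_eq_0_iff2)
    then have "proj_along i0 l (icomb d h m) = (\<lambda>j. 0)" using l(4) by (auto simp: proj_along_def)
    then have m: "\<forall>i\<in>{1..d}. m i = 0" using indep pl by simp
    then have "icomb d h m i0 = 0" unfolding icomb_def by (intro sum.neutral) auto
    then have "m (Suc d) = 0" using z[of i0] l(4) by simp
    then show ?thesis using m by (auto simp: le_Suc_eq)
  qed
  have c3: "\<exists>m. (\<forall>i\<in>{1..Suc d}. \<bar>m i\<bar> \<le> N2 i) \<and> w = icomb (Suc d) g m" if w: "w \<in> \<Lambda> \<inter> cube I s" for w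
  proof -
    have "proj_along i0 l w \<in> proj_along i0 l ` \<Lambda> \<inter> cube (I - {i0}) (2 * s)"
      using proj_along_cube[of i0 I l w s] l(2,3,4) w by blast
    then obtain m where m: "\<forall>i\<in>{1..d}. \<bar>m i\<bar> \<le> N i" "proj_along i0 l w = icomb d g' m"
      using cover by blast
    define u where "u = (\<lambda>j. w j - icomb d h m j)"
    have uL: "u \<in> \<Lambda>" unfolding u_def using w h(1) by (intro lattice_on_diff[OF L] icomb_in_lattice[OF L]) auto
    have pu: "proj_along i0 l u = (\<lambda>j. 0)" unfolding u_def proj_along_diff pl m(2) by simp
    define q where "q = u i0 / l i0"
    have uq: "u j = q * l j" for j using fun_cong[OF pu, of j] by (simp add: proj_along_def q_def)
    \<comment> \<open>\<open>u\<close> is a real multiple of \<open>l\<close>; after rounding the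
      multiplier, the remainder is a lattice vector shorter than \<open>l\<close>, hence
      zero.\<close>
    have "(\<lambda>j. u j - of_int (round q) * l j) = (\<lambda>j. 0)"
    proof (rule short[OF lattice_on_diff[OF L uL lattice_on_int_mult[OF L l(1)]]])
      fix j assume j: "j \<in> I"
      have "u j - of_int (round q) * l j = (q - of_int (round q)) * l j" by (simp add: uq algebra_simps)
      then have "\<bar>u j - of_int (round q) * l j\<bar> = \<bar>q - of_int (round q)\<bar> * \<bar>l j\<bar>" by (simp add: abs_mult)
      also have "\<dots> \<le> (1/2) * \<mu>"
        using of_int_round_abs_le[of q] l(3)[OF j] unfolding \<mu>_def
        by (intro mult_mono) (auto simp: abs_minus_commute)
      finally show "\<bar>u j - of_int (round q) * l j\<bar> < \<bar>l i0\<bar>" using mu unfolding \<mu>_def by linarith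
    qed
    then have u: "u j = of_int (round q) * l j" for j by (metis eq_iff_diff_eq_0)
    have hb: "\<bar>icomb d h m i0\<bar> \<le> real d * (2 * C * s)"
    proof -
      have "icomb d h m \<in> cube {i0} (real d * (2 * C * s))"
      proof (rule icomb_cube)
        show "\<bar>m i\<bar> \<le> N i" if "i \<in> {1..d}" for i using m(1) that by blast
        fix i j assume i: "i \<in> {1..d}" and "j \<in> {i0}"
        then have "of_int (N i) * \<bar>h i j\<bar> \<le> of_int (N i) * (\<mu> / 2)"
          using h(3)[OF i] N[OF i] by (intro mult_left_mono) auto
        then show "of_int (N i) * \<bar>h i j\<bar> \<le> 2 * C * s" using big[OF i] by linarith
      qed
      then show ?thesis by (simp add: cube_def)
    qed
    have "\<bar>of_int (round q)\<bar> * \<mu> = \<bar>u i0\<bar>" by (simp add: u \<mu>_def abs_mult)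
    also have "\<dots> \<le> \<bar>w i0\<bar> + \<bar>icomb d h m i0\<bar>" unfolding u_def by linarith
    also have "\<dots> \<le> s + real d * (2 * C * s)"
      using hb w l(2) by (intro add_mono) (auto simp: cube_def)
    also have "\<dots> = (1 + 2 * real d * C) * s" by (simp add: algebra_simps)
    also have "\<dots> \<le> of_int M * \<mu>" by (rule Mge)
    finally have "\<bar>real_of_int (round q)\<bar> \<le> of_int M" using mu by simp
    then have qM: "\<bar>round q\<bar> \<le> M" by linarith
    define m2 where "m2 = m(Suc d := round q)"
    have i2: "icomb d h m2 = icomb d h m" unfolding icomb_def m2_def by (intro ext sum.cong) auto
    have "w j = icomb d h m j + of_int (round q) * l j" for j
      using u[of j] unfolding u_def by linarith
    then have "w = icomb (Suc d) g m2" unfolding ic i2 by (intro ext) (simp add: m2_def)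
    moreover have "\<forall>i\<in>{1..Suc d}. \<bar>m2 i\<bar> \<le> N2 i"
      using m(1) qM gi(2) gS by (auto simp: m2_def N2_def)
    ultimately show ?thesis by blast
  qed
  have "reduced_basis I \<Lambda> s (4 * C * real (d + 1) * s) (Suc d) g N2"
    unfolding reduced_basis_def
    by (intro conjI; (rule ballI, rule c1 | intro allI impI, rule c2 | rule ballI, rule c3))
  then show ?thesis by blast
qed

lemma lattice_reduced_basis:
  "\<exists>C\<ge>1. \<forall>(I::'i set) \<Lambda> s. finite I \<longrightarrow> card I = r \<longrightarrow> lattice_on I \<Lambda> \<longrightarrow> s > 0 \<longrightarrow>
     (\<exists>d\<le>r. \<exists>g N. reduced_basis I \<Lambda> s (C * s) d g N)"
proof (induction r)
  case 0
  have "\<exists>d\<le>0. \<exists>g N. reduced_basis I \<Lambda> s (1 * s) d g N"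
    if "finite I" "card I = 0" "lattice_on I \<Lambda>" for I :: "'i set" and \<Lambda> s
    using lattice_on_support[OF that(3)] that(1,2)
    by (intro exI[of _ 0]) (auto simp: reduced_basis_def icomb_def)
  then show ?case by (intro exI[of _ 1]) blast
next
  case (Suc r)
  then obtain C where C: "C \<ge> 1" and IH: "\<And>(I::'i set) \<Lambda> s. finite I \<Longrightarrow> card I = r \<Longrightarrow> lattice_on I \<Lambda> \<Longrightarrow> s > 0 \<Longrightarrow>
     \<exists>d\<le>r. \<exists>g N. reduced_basis I \<Lambda> s (C * s) d g N"
    by blast
  define C2 where "C2 = 4 * C * real (r + 1)"
  have C2: "C2 \<ge> 1" unfolding C2_def using C mult_mono[of 1 "4 * C" 1 "real (r + 1)"] by simp
  show ?case
  proof (intro exI[of _ C2] conjI allI impI C2)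
    fix I :: "'i set" and \<Lambda> s
    assume I: "finite I" "card I = Suc r" and L: "lattice_on I \<Lambda>" and s: "(s::real) > 0"
    show "\<exists>d\<le>Suc r. \<exists>g N. reduced_basis I \<Lambda> s (C2 * s) d g N"
    proof (cases "\<exists>u\<in>\<Lambda>. u \<noteq> (\<lambda>i. 0) \<and> u \<in> cube I s")
      case False
      then have "reduced_basis I \<Lambda> s (C2 * s) 0 (\<lambda>_ _. 0) (\<lambda>_. 1)"
        by (auto simp: reduced_basis_def icomb_def)
      then show ?thesis by blast
    next
      case True
      then obtain u where u: "u \<in> \<Lambda>" "u \<noteq> (\<lambda>i. 0)" "u \<in> cube I s" by blast
      obtain l i0 where l: "l \<in> \<Lambda>" "i0 \<in> I" "\<And>i. i \<in> I \<Longrightarrow> \<bar>l i\<bar> \<le> \<bar>l i0\<bar>" "l i0 \<noteq> 0" "\<bar>l i0\<bar> \<le> s"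
        "\<And>w. w \<in> \<Lambda> \<Longrightarrow> (\<And>i. i \<in> I \<Longrightarrow> \<bar>w i\<bar> < \<bar>l i0\<bar>) \<Longrightarrow> w = (\<lambda>i. 0)"
        by (rule lattice_on_shortest[OF I(1) L u]) blast
      have "finite (I - {i0})" "card (I - {i0}) = r" using I l(2) by auto
      from IH[OF this lattice_on_proj[OF L l(1-4)], of "2 * s"] s
      obtain d g N where d: "d \<le> r"
        and rb: "reduced_basis (I - {i0}) (proj_along i0 l ` \<Lambda>) (2 * s) (C * (2 * s)) d g N"
        by auto
      have le: "4 * C * real (d + 1) * s \<le> C2 * s"
        unfolding C2_def using d C s by (intro mult_right_mono mult_left_mono) auto
      obtain g2 N2 where "reduced_basis I \<Lambda> s (4 * C * real (d + 1) * s) (Suc d) g2 N2"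
        using lattice_reduced_basis_step[OF I(1) L s C l rb] by blast
      then have "reduced_basis I \<Lambda> s (C2 * s) (Suc d) g2 N2" using le by (rule reduced_basis_mono)
      then show ?thesis using d by (intro exI[of _ "Suc d"] conjI) auto
    qed
  qed
qed

section \<open>Progressions from lattice points\<close>

definition wsum :: "'i set \<Rightarrow> ('i \<Rightarrow> real) \<Rightarrow> ('i \<Rightarrow> real) \<Rightarrow> real" where
  "wsum I y w = (\<Sum>i\<in>I. y i * w i)"

lemma wsum_icomb: "wsum I y (icomb d g m) = gap_point d 0 (\<lambda>i. wsum I y (g i)) m"
proof -
  have "wsum I y (icomb d g m) = (\<Sum>j\<in>I. \<Sum>i=1..d. of_int (m i) * (y j * g i j))"
    unfolding wsum_def icomb_def sum_distrib_left by (intro sum.cong) (auto simp: algebra_simps)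
  also have "\<dots> = (\<Sum>i=1..d. \<Sum>j\<in>I. of_int (m i) * (y j * g i j))" by (rule sum.swap)
  finally show ?thesis by (simp add: gap_point_def wsum_def sum_distrib_left)
qed

text \<open>Two representations are compared through their difference, which lies in the doubled
  box; this is why \<open>indep\<close> is required up to \<open>2 * N i\<close>.\<close>

lemma proper_symmetric_gap_of_independent:
  fixes x :: "nat \<Rightarrow> real" and N :: "nat \<Rightarrow> int"
  assumes N: "\<And>i. i \<in> {1..d} \<Longrightarrow> N i \<ge> 0"
    and indep: "\<And>m. (\<And>i. i \<in> {1..d} \<Longrightarrow> \<bar>m i\<bar> \<le> 2 * N i) \<Longrightarrow> gap_point d 0 x m = 0 \<Longrightarrow> \<forall>i\<in>{1..d}. m i = 0"
  defines "Q \<equiv> gap_point d 0 x ` gap_coeffs d (\<lambda>i. - N i) N"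
  shows "proper_symmetric_gap d Q" and "real (card Q) = (\<Prod>i=1..d. real_of_int (2 * N i + 1))"
proof -
  have inj: "inj_on (gap_point d 0 x) (gap_coeffs d (\<lambda>i. - N i) N)"
  proof (rule inj_onI)
    fix m m' assume m: "m \<in> gap_coeffs d (\<lambda>i. - N i) N" "m' \<in> gap_coeffs d (\<lambda>i. - N i) N"
      and eq: "gap_point d 0 x m = gap_point d 0 x m'"
    have "\<forall>i\<in>{1..d}. m i - m' i = 0"
    proof (rule indep)
      show "\<bar>m i - m' i\<bar> \<le> 2 * N i" if "i \<in> {1..d}" for i
      proof -
        have "m i \<in> {- N i..N i}" "m' i \<in> {- N i..N i}"
          using m that unfolding gap_coeffs_def by (auto dest: PiE_mem)
        then show ?thesis by auto
      qed
      show "gap_point d 0 x (\<lambda>i. m i - m' i) = 0"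
        using eq by (simp add: gap_point_def left_diff_distrib sum_subtractf)
    qed
    then show "m = m'" using m unfolding gap_coeffs_def by (intro PiE_ext[of m "{1..d}" _ m']) auto
  qed
  have "\<exists>!m. m \<in> gap_coeffs d (\<lambda>i. - N i) N \<and> q = gap_point d 0 x m" if "q \<in> Q" for q
    using that inj unfolding Q_def inj_on_def by blast
  then have "gap_proper d 0 x (\<lambda>i. - N i) N Q" by (simp add: gap_proper_def)
  then show "proper_symmetric_gap d Q"
    unfolding proper_symmetric_gap_def gap_represents_def gap_symmetric_def Q_def
    using N by (intro exI[of _ "0::real"] exI[of _ x] exI[of _ "\<lambda>i. - N i"] exI[of _ N]) auto
  have "card Q = card (gap_coeffs d (\<lambda>i. - N i) N)" unfolding Q_def by (rule card_image[OF inj])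
  also have "\<dots> = (\<Prod>i=1..d. nat (2 * N i + 1))"
    unfolding gap_coeffs_def by (subst card_PiE) (auto intro!: prod.cong)
  finally show "real (card Q) = (\<Prod>i=1..d. real_of_int (2 * N i + 1))"
    using N by (simp add: of_nat_prod)
qed

lemma proper_symmetric_gap_zero: "proper_symmetric_gap 0 {0}"
  using proper_symmetric_gap_of_independent(1)[of 0 "\<lambda>_. 0" "\<lambda>_. 0"]
  by (simp add: gap_point_def gap_coeffs_def)

text \<open>Without short kernel vectors both the box \<open>N\<close> and its dilate by the integer
  part of \<open>k\<close> map to proper progressions. The dilate has about k^d times as many
  points, and all of them are values of lattice points in a cube of radius proportional to
  \<open>k * s\<close>.\<close>

lemma lattice_gap_injective:
  assumes I: "finite I" and L: "lattice_on I \<Lambda>" and s: "s > 0" and k: "k \<ge> 1" and C: "C \<ge> 0"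
    and rb: "reduced_basis I \<Lambda> s (C * s) d g N"
    and inj: "\<And>l. l \<in> \<Lambda> \<Longrightarrow> l \<in> cube I (2 * real d * C * k * s) \<Longrightarrow> wsum I y l = 0 \<Longrightarrow> l = (\<lambda>i. 0)"
  shows "\<exists>Q. proper_symmetric_gap d Q \<and> wsum I y ` (\<Lambda> \<inter> cube I s) \<subseteq> Q \<and>
           real (card Q) * k ^ d \<le> 3 ^ d * real (card (wsum I y ` (\<Lambda> \<inter> cube I (real d * C * k * s))))"
proof -
  note g = reduced_basisD(1)[OF rb] and N = reduced_basisD(2)[OF rb] and Ng = reduced_basisD(3)[OF rb]
    and indep = reduced_basisD(4)[OF rb] and cover = reduced_basisD(5)[OF rb]
  define k' where "k' = \<lfloor>k\<rfloor>"
  have k': "k' \<ge> 1" "of_int k' \<le> k" "k \<le> 2 * of_int k'"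
  proof -
    show "k' \<ge> 1" using k by (simp add: k'_def)
    then show "of_int k' \<le> k" "k \<le> 2 * of_int k'" unfolding k'_def by linarith+
  qed
  define x where "x = (\<lambda>i. wsum I y (g i))"
  have bound: "icomb d g m \<in> cube I (real d * (of_int c * C * s))"
    if "c \<ge> 0" "\<And>i. i \<in> {1..d} \<Longrightarrow> \<bar>m i\<bar> \<le> c * N i" for c m
  proof (rule icomb_cube[OF that(2)])
    show "of_int (c * N i) * \<bar>g i j\<bar> \<le> of_int c * C * s" if "i \<in> {1..d}" "j \<in> I" for i j
      using mult_left_mono[OF Ng[OF that], of "of_int c"] \<open>c \<ge> 0\<close> by (simp add: mult.assoc)
  qed
  have free: "\<forall>i\<in>{1..d}. m i = 0"
    if "\<And>i. i \<in> {1..d} \<Longrightarrow> \<bar>m i\<bar> \<le> 2 * (k' * N i)" "gap_point d 0 x m = 0" for m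
  proof -
    have "icomb d g m \<in> cube I (real d * (of_int (2 * k') * C * s))"
      using that(1) k' by (intro bound) (auto simp: algebra_simps)
    moreover have "real d * (of_int (2 * k') * C * s) \<le> 2 * real d * C * k * s"
    proof -
      have "(2 * real d * C * s) * of_int k' \<le> (2 * real d * C * s) * k"
        using k' C s by (intro mult_left_mono) auto
      then show ?thesis by (simp add: algebra_simps)
    qed
    ultimately have "icomb d g m \<in> cube I (2 * real d * C * k * s)" by (rule cube_mono)
    moreover have "icomb d g m \<in> \<Lambda>" using g by (intro icomb_in_lattice[OF L]) auto
    moreover have "wsum I y (icomb d g m) = 0" using that(2) by (simp add: wsum_icomb x_def)
    ultimately have "icomb d g m = (\<lambda>i. 0)" by (intro inj)
    then show ?thesis by (rule indep)
  qed
  define Q where "Q = gap_point d 0 x ` gap_coeffs d (\<lambda>i. - N i) N"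
  define Q' where "Q' = gap_point d 0 x ` gap_coeffs d (\<lambda>i. - (k' * N i)) (\<lambda>i. k' * N i)"
  have Nk: "N i \<le> k' * N i" if "i \<in> {1..d}" for i using k'(1) N[OF that] by (simp add: mult_le_cancel_right1)
  have N0: "0 \<le> N i" "0 \<le> k' * N i" if "i \<in> {1..d}" for i using N[OF that] Nk[OF that] by linarith+
  have free1: "\<forall>i\<in>{1..d}. m i = 0"
    if "\<And>i. i \<in> {1..d} \<Longrightarrow> \<bar>m i\<bar> \<le> 2 * N i" "gap_point d 0 x m = 0" for m
    by (rule free[OF _ that(2)]) (use that(1) Nk in \<open>smt (verit)\<close>)
  have Q: "proper_symmetric_gap d Q" "real (card Q) = (\<Prod>i=1..d. real_of_int (2 * N i + 1))"
    unfolding Q_def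
    using proper_symmetric_gap_of_independent[of d N x, OF N0(1) free1] by blast+
  have Q': "real (card Q') = (\<Prod>i=1..d. real_of_int (2 * (k' * N i) + 1))"
    unfolding Q'_def
    using proper_symmetric_gap_of_independent(2)[of d "\<lambda>i. k' * N i" x, OF N0(2) free] by blast
  have sub: "wsum I y ` (\<Lambda> \<inter> cube I s) \<subseteq> Q"
  proof
    fix q assume "q \<in> wsum I y ` (\<Lambda> \<inter> cube I s)"
    then obtain w where w: "w \<in> \<Lambda> \<inter> cube I s" "q = wsum I y w" by blast
    obtain m where m: "\<forall>i\<in>{1..d}. \<bar>m i\<bar> \<le> N i" "w = icomb d g m" using cover[OF w(1)] by blast
    have "q = gap_point d 0 x m" using w(2) m(2) by (simp add: wsum_icomb x_def)
    also have "\<dots> = gap_point d 0 x (restrict m {1..d})" unfolding gap_point_def by simp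
    finally have "q = gap_point d 0 x (restrict m {1..d})" .
    moreover have "m i \<in> {- N i..N i}" if "i \<in> {1..d}" for i
      using m(1)[rule_format, OF that] by (auto simp: abs_if split: if_splits)
    then have "restrict m {1..d} \<in> gap_coeffs d (\<lambda>i. - N i) N" by (simp add: gap_coeffs_def restrict_PiE_iff)
    ultimately show "q \<in> Q" unfolding Q_def by blast
  qed
  have sub': "Q' \<subseteq> wsum I y ` (\<Lambda> \<inter> cube I (real d * C * k * s))"
  proof
    fix q assume "q \<in> Q'"
    then obtain m where m: "m \<in> gap_coeffs d (\<lambda>i. - (k' * N i)) (\<lambda>i. k' * N i)" "q = gap_point d 0 x m"
      unfolding Q'_def by blast
    have m1: "\<bar>m i\<bar> \<le> k' * N i" if "i \<in> {1..d}" for i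
      using PiE_mem[OF m(1)[unfolded gap_coeffs_def] that] by auto
    have "icomb d g m \<in> cube I (real d * (of_int k' * C * s))" using m1 k' by (intro bound) auto
    moreover have "real d * (of_int k' * C * s) \<le> real d * C * k * s"
    proof -
      have "(real d * C * s) * of_int k' \<le> (real d * C * s) * k"
        using k' C s by (intro mult_left_mono) auto
      then show ?thesis by (simp add: algebra_simps)
    qed
    ultimately have "icomb d g m \<in> cube I (real d * C * k * s)" by (rule cube_mono)
    moreover have "icomb d g m \<in> \<Lambda>" using g by (intro icomb_in_lattice[OF L]) auto
    moreover have "q = wsum I y (icomb d g m)" using m(2) by (simp add: wsum_icomb x_def)
    ultimately show "q \<in> wsum I y ` (\<Lambda> \<inter> cube I (real d * C * k * s))" by blast
  qed
  have "real (card Q) * k ^ d = (\<Prod>i=1..d. real_of_int (2 * N i + 1) * k)"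
    unfolding Q(2) prod.distrib by simp
  also have "\<dots> \<le> (\<Prod>i=1..d. 3 * real_of_int (2 * (k' * N i) + 1))"
  proof (rule prod_mono)
    fix i assume i: "i \<in> {1..d}"
    \<comment> \<open>\<open>2 N + 1 \<le> 3 N\<close> uses \<open>N \<ge> 1\<close>, and passing to
      the integer part at most halves \<open>k\<close>.\<close>
    have "real_of_int (2 * N i + 1) * k \<le> (3 * real_of_int (N i)) * (2 * of_int k')"
      using N[OF i] k' k by (intro mult_mono) auto
    also have "\<dots> \<le> 3 * real_of_int (2 * (k' * N i) + 1)" by (simp add: algebra_simps)
    finally show "0 \<le> real_of_int (2 * N i + 1) * k \<and> real_of_int (2 * N i + 1) * k \<le> 3 * real_of_int (2 * (k' * N i) + 1)"
      using N[OF i] k by simp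
  qed
  also have "\<dots> = 3 ^ d * real (card Q')" unfolding Q' prod.distrib by simp
  also have "\<dots> \<le> 3 ^ d * real (card (wsum I y ` (\<Lambda> \<inter> cube I (real d * C * k * s))))"
    using card_mono[OF finite_imageI[OF lattice_on_finite[OF L]] sub'] by simp
  finally show ?thesis using Q(1) sub by blast
qed

text \<open>Either the previous lemma applies, or \<open>wsum\<close> has a kernel vector
  \<open>u\<close> of size at most \<open>E * k * s\<close>, and projecting along \<open>u\<close>
  keeps all values and lowers the dimension. That \<open>u\<close> may be much longer than
  \<open>s\<close> does no harm: points are lifted back only on the side of the cube of radius
  \<open>D * k * s\<close>, where an error of size \<open>\<bar>u i0\<bar> / 2\<close> is
  affordable.\<close>

lemma lattice_gap:
  "\<exists>C\<ge>1. \<forall>(I::'i set) \<Lambda> y s k. finite I \<longrightarrow> card I = r \<longrightarrow> lattice_on I \<Lambda> \<longrightarrow> s > 0 \<longrightarrow> k \<ge> 1 \<longrightarrow>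
     (\<exists>d\<le>r. \<exists>Q. proper_symmetric_gap d Q \<and> wsum I y ` (\<Lambda> \<inter> cube I s) \<subseteq> Q \<and>
        real (card Q) * k ^ d \<le> C * real (card (wsum I y ` (\<Lambda> \<inter> cube I (C * k * s)))))"
proof (induction r)
  case 0
  have z: "w = (\<lambda>j. 0)" if "lattice_on I \<Lambda>" "finite I" "card I = 0" "w \<in> \<Lambda>" for I \<Lambda> and w :: "'i \<Rightarrow> real"
    using lattice_on_support[OF that(1,4)] that(2,3) by auto
  show ?case
  proof (intro exI[of _ "1::real"] conjI allI impI)
    fix I :: "'i set" and \<Lambda> and y :: "'i \<Rightarrow> real" and s k :: real
    assume a: "finite I" "card I = 0" "lattice_on I \<Lambda>" "0 < s" "1 \<le> k"
    have eq: "wsum I y ` (\<Lambda> \<inter> cube I t) = {0}" for t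
      using a z[OF a(3,1,2)] lattice_on_zero[OF a(3)] by (auto simp: wsum_def cube_def image_iff)
    show "\<exists>d\<le>0. \<exists>Q. proper_symmetric_gap d Q \<and> wsum I y ` (\<Lambda> \<inter> cube I s) \<subseteq> Q \<and>
        real (card Q) * k ^ d \<le> 1 * real (card (wsum I y ` (\<Lambda> \<inter> cube I (1 * k * s))))"
      unfolding eq using proper_symmetric_gap_zero by (intro exI[of _ "0::nat"] conjI exI[of _ "{0}"]) auto
  qed simp
next
  case (Suc r)
  then obtain C where C: "C \<ge> 1" and IH: "\<And>(I::'i set) \<Lambda> y s k. finite I \<Longrightarrow> card I = r \<Longrightarrow> lattice_on I \<Lambda> \<Longrightarrow> s > 0 \<Longrightarrow> k \<ge> 1 \<Longrightarrow>
     (\<exists>d\<le>r. \<exists>Q. proper_symmetric_gap d Q \<and> wsum I y ` (\<Lambda> \<inter> cube I s) \<subseteq> Q \<and>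
        real (card Q) * k ^ d \<le> C * real (card (wsum I y ` (\<Lambda> \<inter> cube I (C * k * s)))))"
    by blast
  obtain B where B: "B \<ge> 1" and basis: "\<And>(I::'i set) \<Lambda> s. finite I \<Longrightarrow> card I = Suc r \<Longrightarrow> lattice_on I \<Lambda> \<Longrightarrow> s > 0 \<Longrightarrow>
     \<exists>d\<le>Suc r. \<exists>g N. reduced_basis I \<Lambda> s (B * s) d g N"
    using lattice_reduced_basis[where r = "Suc r" and 'i = 'i] by blast
  \<comment> \<open>\<open>E * k * s\<close> is the radius on which
    \<open>lattice_gap_injective\<close> needs a trivial kernel, for the largest possible rank. In
    \<open>D\<close>, the power of 3 serves the injective case; \<open>2 * C\<close> serves the
    projected cube, whose radius has doubled, and \<open>E\<close> the lift.\<close>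
  define E where "E = 2 * real (Suc r) * B"
  define D where "D = 3 ^ Suc r + 2 * C + E"
  have "1 * 1 \<le> real (Suc r) * B" using B by (intro mult_mono) auto
  moreover have "E = 2 * (real (Suc r) * B)" by (simp add: E_def)
  ultimately have E: "E \<ge> 1" by linarith
  have "(0::real) < 3 ^ Suc r" by simp
  then have D: "D \<ge> 3 ^ Suc r" "D \<ge> C" "D \<ge> E" "D \<ge> 2 * C + E" "D \<ge> 1"
    using C E unfolding D_def by linarith+
  show ?case
  proof (intro exI[of _ D] conjI allI impI D(5))
    fix I :: "'i set" and \<Lambda> and y :: "'i \<Rightarrow> real" and s k :: real
    assume I: "finite I" "card I = Suc r" and L: "lattice_on I \<Lambda>" and s: "0 < s" and k: "1 \<le> k"
    have mono: "real (card (wsum I y ` (\<Lambda> \<inter> cube I t))) \<le> real (card (wsum I y ` (\<Lambda> \<inter> cube I u)))"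
      if "t \<le> u" for t u
      using cube_mono[OF _ that]
      by (intro of_nat_mono card_mono finite_imageI lattice_on_finite[OF L] image_mono) blast
    show "\<exists>d\<le>Suc r. \<exists>Q. proper_symmetric_gap d Q \<and> wsum I y ` (\<Lambda> \<inter> cube I s) \<subseteq> Q \<and>
        real (card Q) * k ^ d \<le> D * real (card (wsum I y ` (\<Lambda> \<inter> cube I (D * k * s))))"
    proof (cases "\<exists>u\<in>\<Lambda>. u \<in> cube I (E * k * s) \<and> wsum I y u = 0 \<and> u \<noteq> (\<lambda>i. 0)")
      case False
      obtain d g N where d: "d \<le> Suc r" and rb: "reduced_basis I \<Lambda> s (B * s) d g N"
        using basis[OF I L s] by blast
      have dE: "2 * real d * B * k * s \<le> E * k * s" "real d * B * k * s \<le> E * k * s"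
      proof -
        have *: "real d * (B * k * s) \<le> real (Suc r) * (B * k * s)"
          using d B k s by (intro mult_right_mono) auto
        moreover have "0 \<le> real d * (B * k * s)" using B k s by simp
        moreover have "E * k * s = 2 * (real (Suc r) * (B * k * s))" by (simp add: E_def)
        moreover have "2 * real d * B * k * s = 2 * (real d * (B * k * s))"
          "real d * B * k * s = real d * (B * k * s)" by simp_all
        ultimately show "2 * real d * B * k * s \<le> E * k * s" "real d * B * k * s \<le> E * k * s"
          by linarith+
      qed
      have "\<exists>Q. proper_symmetric_gap d Q \<and> wsum I y ` (\<Lambda> \<inter> cube I s) \<subseteq> Q \<and>
           real (card Q) * k ^ d \<le> 3 ^ d * real (card (wsum I y ` (\<Lambda> \<inter> cube I (real d * B * k * s))))"
      proof (rule lattice_gap_injective[OF I(1) L s k _ rb])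
        fix l assume "l \<in> \<Lambda>" "l \<in> cube I (2 * real d * B * k * s)" "wsum I y l = 0"
        then show "l = (\<lambda>i. 0)" using False cube_mono[OF _ dE(1)] by blast
      qed (use B in auto)
      then obtain Q where Q: "proper_symmetric_gap d Q" "wsum I y ` (\<Lambda> \<inter> cube I s) \<subseteq> Q"
        "real (card Q) * k ^ d \<le> 3 ^ d * real (card (wsum I y ` (\<Lambda> \<inter> cube I (real d * B * k * s))))"
        by blast
      note Q(3)
      also have "3 ^ d * real (card (wsum I y ` (\<Lambda> \<inter> cube I (real d * B * k * s))))
          \<le> D * real (card (wsum I y ` (\<Lambda> \<inter> cube I (D * k * s))))"
      proof (rule mult_mono[OF _ mono])
        have "(3::real) ^ d \<le> 3 ^ Suc r" using d by (intro power_increasing) auto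
        then show "3 ^ d \<le> D" using D(1) by linarith
        have "E * k * s \<le> D * k * s" using D(3) k s by (intro mult_right_mono) auto
        then show "real d * B * k * s \<le> D * k * s" using dE(2) by linarith
      qed (use D in auto)
      finally show ?thesis using Q d by blast
    next
      case True
      then obtain u where u: "u \<in> \<Lambda>" "u \<in> cube I (E * k * s)" "wsum I y u = 0" "u \<noteq> (\<lambda>i. 0)" by blast
      have ne: "I \<noteq> {}" using I by auto
      have "Max ((\<lambda>i. \<bar>u i\<bar>) ` I) \<in> (\<lambda>i. \<bar>u i\<bar>) ` I" using I(1) ne by (intro Max_in) auto
      then obtain i0 where i0: "i0 \<in> I" "Max ((\<lambda>i. \<bar>u i\<bar>) ` I) = \<bar>u i0\<bar>" by blast
      have i0max: "\<bar>u i\<bar> \<le> \<bar>u i0\<bar>" if "i \<in> I" for i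
        unfolding i0(2)[symmetric] using I(1) that by (intro Max_ge) auto
      note i0 = i0(1) i0max
      have nz: "u i0 \<noteq> 0"
      proof
        assume "u i0 = 0"
        then have "u i = 0" for i
          using i0(2)[of i] lattice_on_support[OF L u(1), of i] by (cases "i \<in> I") auto
        then show False using u(4) by auto
      qed
      have us: "\<bar>u i0\<bar> \<le> E * k * s" using u(2) i0(1) by (auto simp: cube_def)
      let ?P = "proj_along i0 u"
      have phi: "wsum (I - {i0}) y (?P w) = wsum I y w" for w
      proof -
        have "wsum I y (?P w) = wsum I y w - (w i0 / u i0) * wsum I y u"
          unfolding wsum_def proj_along_def
          by (simp add: algebra_simps sum_subtractf sum_distrib_left sum_divide_distrib)
        then have "wsum I y (?P w) = wsum I y w" using u(3) by simp
        moreover have "wsum I y (?P w) = wsum (I - {i0}) y (?P w)"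
          unfolding wsum_def using sum.remove[OF I(1) i0(1), of "\<lambda>i. y i * ?P w i"] nz
          by (simp add: proj_along_def)
        ultimately show ?thesis by simp
      qed
      have "finite (I - {i0})" "card (I - {i0}) = r" using I i0(1) by auto
      from IH[OF this lattice_on_proj[OF L u(1) i0 nz], of "2 * s" k y] s k
      obtain d Q where d: "d \<le> r" and Q: "proper_symmetric_gap d Q"
        "wsum (I - {i0}) y ` (?P ` \<Lambda> \<inter> cube (I - {i0}) (2 * s)) \<subseteq> Q"
        "real (card Q) * k ^ d \<le> C * real (card (wsum (I - {i0}) y ` (?P ` \<Lambda> \<inter> cube (I - {i0}) (C * k * (2 * s)))))"
        by auto
      have "wsum I y ` (\<Lambda> \<inter> cube I s) \<subseteq> Q"
      proof
        fix q assume "q \<in> wsum I y ` (\<Lambda> \<inter> cube I s)"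
        then obtain w where w: "w \<in> \<Lambda>" "w \<in> cube I s" "q = wsum I y w" by blast
        have "?P w \<in> cube (I - {i0}) (2 * s)" by (rule proj_along_cube[of i0 I u w s]) (use i0 nz w in auto)
        then have "wsum (I - {i0}) y (?P w) \<in> Q" using Q(2) w(1) by blast
        then show "q \<in> Q" by (simp add: w(3) phi)
      qed
      moreover have "wsum (I - {i0}) y ` (?P ` \<Lambda> \<inter> cube (I - {i0}) (C * k * (2 * s)))
          \<subseteq> wsum I y ` (\<Lambda> \<inter> cube I (D * k * s))"
      proof
        fix q assume "q \<in> wsum (I - {i0}) y ` (?P ` \<Lambda> \<inter> cube (I - {i0}) (C * k * (2 * s)))"
        then obtain w' where w': "w' \<in> ?P ` \<Lambda>" "w' \<in> cube (I - {i0}) (C * k * (2 * s))" "q = wsum (I - {i0}) y w'"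
          by blast
        obtain w where w: "w \<in> \<Lambda>" "?P w = w'" "\<bar>w i0\<bar> \<le> \<bar>u i0\<bar> / 2" "\<forall>j\<in>I. \<bar>w j\<bar> \<le> \<bar>w' j\<bar> + \<bar>u i0\<bar> / 2"
          using proj_along_lift[OF L u(1) i0 nz w'(1)] by blast
        have DD: "C * k * (2 * s) + E * k * s \<le> D * k * s"
        proof -
          have "(2 * C + E) * (k * s) \<le> D * (k * s)" using D(4) k s by (intro mult_right_mono) auto
          then show ?thesis by (simp add: algebra_simps)
        qed
        have "\<bar>w j\<bar> \<le> D * k * s" if "j \<in> I" for j
        proof (cases "j = i0")
          case True
          have "0 \<le> C * k * (2 * s)" using C k s by simp
          then show ?thesis using w(3) us DD abs_ge_zero[of "u i0"] unfolding True by linarith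
        next
          case False
          then have "\<bar>w' j\<bar> \<le> C * k * (2 * s)" using w'(2) that by (simp add: cube_def)
          then show ?thesis using w(4) that us DD by fastforce
        qed
        then have "w \<in> cube I (D * k * s)" by (simp add: cube_def)
        then show "q \<in> wsum I y ` (\<Lambda> \<inter> cube I (D * k * s))" using w w' phi[of w] by auto
      qed
      then have "real (card (wsum (I - {i0}) y ` (?P ` \<Lambda> \<inter> cube (I - {i0}) (C * k * (2 * s)))))
          \<le> real (card (wsum I y ` (\<Lambda> \<inter> cube I (D * k * s))))"
        by (intro of_nat_mono card_mono finite_imageI lattice_on_finite[OF L])
      then have "C * real (card (wsum (I - {i0}) y ` (?P ` \<Lambda> \<inter> cube (I - {i0}) (C * k * (2 * s)))))
          \<le> D * real (card (wsum I y ` (\<Lambda> \<inter> cube I (D * k * s))))"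
        using D C by (intro mult_mono) auto
      ultimately show ?thesis using d Q(1) order_trans[OF Q(3)]
        by (intro exI[of _ d] conjI exI[of _ Q]) auto
    qed
  qed
qed

section \<open>Additive relations of bounded length\<close>

text \<open>Vector spaces over the rationals, not the reals: rational values have common
  denominators, and these later make the lattice of words discrete and its quotient finite.\<close>

definition qspace :: "'a set \<Rightarrow> ('a \<Rightarrow> real) set \<Rightarrow> bool" where
  "qspace X W \<longleftrightarrow> (\<lambda>x. 0) \<in> W \<and> (\<forall>f\<in>W. \<forall>g\<in>W. \<forall>q\<in>\<rat>. (\<lambda>x. f x + q * g x) \<in> W) \<and> (\<forall>f\<in>W. \<forall>x\<in>X. f x \<in> \<rat>)"

text \<open>The functions \<open>F b\<close> witness that the evaluations at the points of
  \<open>B\<close> are linearly independent on \<open>W\<close>.\<close>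

definition dual_system :: "'a set \<Rightarrow> ('a \<Rightarrow> real) set \<Rightarrow> 'a set \<Rightarrow> ('a \<Rightarrow> 'a \<Rightarrow> real) \<Rightarrow> bool" where
  "dual_system X W B F \<longleftrightarrow> B \<subseteq> X \<and> (\<forall>b\<in>B. F b \<in> W) \<and> (\<forall>b\<in>B. \<forall>b'\<in>B. F b b' = (if b = b' then 1 else 0))"

lemma qspace_zero: "qspace X W \<Longrightarrow> (\<lambda>x. 0) \<in> W"
  and qspace_lin: "qspace X W \<Longrightarrow> f \<in> W \<Longrightarrow> g \<in> W \<Longrightarrow> q \<in> \<rat> \<Longrightarrow> (\<lambda>x. f x + q * g x) \<in> W"
  and qspace_Rats: "qspace X W \<Longrightarrow> f \<in> W \<Longrightarrow> x \<in> X \<Longrightarrow> f x \<in> \<rat>"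
  unfolding qspace_def by blast+

lemma qspace_scale:
  assumes "qspace X W" "f \<in> W" "q \<in> \<rat>"
  shows "(\<lambda>x. q * f x) \<in> W"
  using qspace_lin[OF assms(1) qspace_zero[OF assms(1)] assms(2,3)] by simp

lemma qspace_sum:
  assumes "qspace X W" "finite B" "\<And>b. b \<in> B \<Longrightarrow> F b \<in> W" "\<And>b. b \<in> B \<Longrightarrow> q b \<in> \<rat>"
  shows "(\<lambda>x. \<Sum>b\<in>B. q b * F b x) \<in> W"
  using assms(2,3,4)
proof (induction B rule: finite_induct)
  case empty
  then show ?case using qspace_zero[OF assms(1)] by simp
next
  case (insert b B)
  then have "(\<lambda>x. (\<Sum>b\<in>B. q b * F b x) + q b * F b x) \<in> W"
    by (intro qspace_lin[OF assms(1)]) auto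
  then show ?case using insert by (simp add: add.commute)
qed

lemma dual_systemD:
  assumes "dual_system X W B F"
  shows "B \<subseteq> X" and "\<And>b. b \<in> B \<Longrightarrow> F b \<in> W"
    and "\<And>b b'. b \<in> B \<Longrightarrow> b' \<in> B \<Longrightarrow> F b b' = (if b = b' then 1 else 0)"
  using assms unfolding dual_system_def by blast+

lemma dual_system_eval:
  assumes "dual_system X W B F" "finite B" "b \<in> B"
  shows "(\<Sum>c\<in>B. f c * F c b) = f b"
proof -
  have "(\<Sum>c\<in>B. f c * F c b) = (\<Sum>c\<in>B. if c = b then f c else 0)"
    using dual_systemD(3)[OF assms(1)] assms(3) by (intro sum.cong) auto
  then show ?thesis using assms(2,3) by simp
qed

text \<open>Gaussian elimination with full pivoting keeps the dual functions bounded.\<close>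
lemma complete_dual_system:
  assumes "finite X" "qspace X W"
  shows "\<exists>B F. dual_system X W B F \<and> (\<forall>b\<in>B. \<forall>x\<in>X. \<bar>F b x\<bar> \<le> fact (card B)) \<and>
           (\<forall>f\<in>W. \<forall>x\<in>X. f x = (\<Sum>b\<in>B. f b * F b x))"
  using assms(2)
proof (induction "card {x\<in>X. \<exists>f\<in>W. f x \<noteq> 0}" arbitrary: W rule: less_induct)
  case less
  note W = less.prems
  show ?case
  proof (cases "\<exists>f\<in>W. \<exists>x\<in>X. f x \<noteq> 0")
    case False
    then show ?thesis by (intro exI[of _ "{}"]) (auto simp: dual_system_def)
  next
    case True
    then obtain f0 x0 where f0: "f0 \<in> W" "x0 \<in> X" "f0 x0 \<noteq> 0" by blast
    have "Max ((\<lambda>x. \<bar>f0 x\<bar>) ` X) \<in> (\<lambda>x. \<bar>f0 x\<bar>) ` X" using assms(1) f0(2) by (intro Max_in) auto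
    then obtain x1 where x1: "x1 \<in> X" "Max ((\<lambda>x. \<bar>f0 x\<bar>) ` X) = \<bar>f0 x1\<bar>" by blast
    have mx: "\<bar>f0 x\<bar> \<le> \<bar>f0 x1\<bar>" if "x \<in> X" for x
      unfolding x1(2)[symmetric] using assms(1) that by (intro Max_ge) auto
    have nz: "f0 x1 \<noteq> 0" using mx[OF f0(2)] f0(3) by auto
    define f where "f = (\<lambda>x. inverse (f0 x1) * f0 x)"
    have f: "f \<in> W" unfolding f_def
      using qspace_Rats[OF W f0(1) x1(1)] by (intro qspace_scale[OF W f0(1)]) simp
    have f1: "f x1 = 1" using nz by (simp add: f_def)
    have fb: "\<bar>f x\<bar> \<le> 1" if "x \<in> X" for x
      using mx[OF that] nz by (simp add: f_def abs_mult divide_simps)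
    \<comment> \<open>Passing to the functions that vanish at the pivot \<open>x1\<close> lowers the
      number of points of \<open>X\<close> at which the space is nonzero, which is the induction
      measure.\<close>
    define W' where "W' = {g\<in>W. g x1 = 0}"
    have W': "qspace X W'" using W unfolding qspace_def W'_def by auto
    have "{x\<in>X. \<exists>f\<in>W'. f x \<noteq> 0} \<subset> {x\<in>X. \<exists>f\<in>W. f x \<noteq> 0}"
      using x1(1) f f1 unfolding W'_def by force
    then have "card {x\<in>X. \<exists>f\<in>W'. f x \<noteq> 0} < card {x\<in>X. \<exists>f\<in>W. f x \<noteq> 0}"
      using assms(1) by (intro psubset_card_mono) auto
    from less.hyps[OF this W'] obtain B F where BF: "dual_system X W' B F"
      and bd: "\<And>b x. b \<in> B \<Longrightarrow> x \<in> X \<Longrightarrow> \<bar>F b x\<bar> \<le> fact (card B)"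
      and comp: "\<And>g x. g \<in> W' \<Longrightarrow> x \<in> X \<Longrightarrow> g x = (\<Sum>b\<in>B. g b * F b x)" by blast
    note D = dual_systemD[OF BF]
    have fin: "finite B" using D(1) assms(1) finite_subset by blast
    have F0: "F b x1 = 0" if "b \<in> B" for b using D(2)[OF that] by (simp add: W'_def)
    have x1B: "x1 \<notin> B" using F0[of x1] D(3)[of x1 x1] by auto
    define F1 where "F1 = (\<lambda>x. f x + (-1) * (\<Sum>b\<in>B. f b * F b x))"
    have F1: "F1 \<in> W" unfolding F1_def
      using D(1,2) qspace_Rats[OF W f]
      by (intro qspace_lin[OF W f] qspace_sum[OF W fin]) (auto simp: W'_def)
    define F2 where "F2 = F(x1 := F1)"
    have eq: "F2 b = F b" if "b \<in> B" for b using that x1B by (auto simp: F2_def)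
    have dual: "dual_system X W (insert x1 B) F2"
      unfolding dual_system_def
    proof (intro conjI ballI)
      show "insert x1 B \<subseteq> X" using x1 D by auto
      show "F2 b \<in> W" if "b \<in> insert x1 B" for b
        using that F1 D(2) eq by (cases "b = x1") (auto simp: F2_def W'_def)
      fix b b' assume b: "b \<in> insert x1 B" "b' \<in> insert x1 B"
      have "F1 b' = 0" if "b' \<in> B" using dual_system_eval[OF BF fin that] by (simp add: F1_def)
      moreover have "F1 x1 = 1" using F0 f1 by (simp add: F1_def)
      ultimately show "F2 b b' = (if b = b' then 1 else 0)"
        using b x1B D(3) F0 by (auto simp: F2_def)
    qed
    have bnd: "\<bar>F2 b x\<bar> \<le> fact (card (insert x1 B))" if "b \<in> insert x1 B" "x \<in> X" for b x
    proof (cases "b = x1")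
      case True
      have "\<bar>\<Sum>b\<in>B. f b * F b x\<bar> \<le> (\<Sum>b\<in>B. \<bar>f b * F b x\<bar>)" by (rule sum_abs)
      also have "\<dots> \<le> (\<Sum>b\<in>B. 1 * fact (card B))"
      proof (rule sum_mono)
        fix b assume b: "b \<in> B"
        then show "\<bar>f b * F b x\<bar> \<le> 1 * fact (card B)"
          unfolding abs_mult using fb[of b] D(1) bd[OF b that(2)] by (intro mult_mono) auto
      qed
      finally have "\<bar>F1 x\<bar> \<le> 1 + real (card B) * fact (card B)" using fb[OF that(2)] by (simp add: F1_def)
      also have "\<dots> \<le> fact (card B) + real (card B) * fact (card B)" by (simp add: fact_ge_1)
      also have "\<dots> = fact (card (insert x1 B))" using x1B fin by (simp add: algebra_simps)
      finally show ?thesis using True by (simp add: F2_def)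
    next
      case False
      then have b: "b \<in> B" using that by auto
      have "(fact (card B) :: real) \<le> fact (card (insert x1 B))"
        using fin by (intro fact_mono card_mono) auto
      then show ?thesis using bd[OF b that(2)] eq[OF b] by simp
    qed
    have cmp: "g x = (\<Sum>b\<in>insert x1 B. g b * F2 b x)" if g: "g \<in> W" and x: "x \<in> X" for g x
    proof -
      define h where "h = (\<lambda>x. g x + (- g x1) * f x)"
      have "h \<in> W'" unfolding W'_def h_def
        using qspace_lin[OF W g f, of "- g x1"] qspace_Rats[OF W g x1(1)] f1 by auto
      then have "h x = (\<Sum>b\<in>B. h b * F b x)" using comp x by blast
      also have "\<dots> = (\<Sum>b\<in>B. g b * F b x) - g x1 * (\<Sum>b\<in>B. f b * F b x)"
        by (simp add: h_def algebra_simps sum_subtractf sum_distrib_left)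
      finally have "g x = g x1 * F1 x + (\<Sum>b\<in>B. g b * F b x)" by (simp add: h_def F1_def algebra_simps)
      moreover have "(\<Sum>b\<in>B. g b * F b x) = (\<Sum>b\<in>B. g b * F2 b x)" by (intro sum.cong) (auto simp: eq)
      ultimately show ?thesis using x1B fin by (simp add: F2_def)
    qed
    show ?thesis using dual bnd cmp by blast
  qed
qed

text \<open>The interpolation of \<open>f\<close> at \<open>B\<close> lies in \<open>W'\<close>, so
  \<open>f\<close> differs from it at some \<open>x\<close> in \<open>X\<close>. The difference
  vanishes on \<open>B\<close> but not at \<open>x\<close>, hence makes \<open>x\<close> a new
  point, and the old dual functions are corrected by multiples of it.\<close>

lemma dual_system_augment:
  assumes X: "finite X" and W: "qspace X W" "W' \<subseteq> W" "qspace X W'" and BF: "dual_system X W' B F"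
    and f: "f \<in> W" "\<And>g. g \<in> W' \<Longrightarrow> \<exists>x\<in>X. f x \<noteq> g x"
  shows "\<exists>B' F'. dual_system X W B' F' \<and> card B' = Suc (card B)"
proof -
  note D = dual_systemD[OF BF]
  have fin: "finite B" using D(1) X finite_subset by blast
  have "(\<lambda>x. \<Sum>b\<in>B. f b * F b x) \<in> W'"
    using D(1,2) qspace_Rats[OF W(1) f(1)] by (intro qspace_sum[OF W(3) fin]) auto
  then obtain x where x: "x \<in> X" "f x \<noteq> (\<Sum>b\<in>B. f b * F b x)" using f(2) by fastforce
  define h where "h = (\<lambda>x. f x + (-1) * (\<Sum>b\<in>B. f b * F b x))"
  have h: "h \<in> W" unfolding h_def
    using D(1,2) W(2) qspace_Rats[OF W(1) f(1)]
    by (intro qspace_lin[OF W(1) f(1)] qspace_sum[OF W(1) fin]) auto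
  have hx: "h x \<noteq> 0" using x(2) by (simp add: h_def)
  have hB: "h b = 0" if "b \<in> B" for b using dual_system_eval[OF BF fin that] by (simp add: h_def)
  have xB: "x \<notin> B" using hx hB by auto
  define k where "k = (\<lambda>y. inverse (h x) * h y)"
  have k: "k \<in> W" unfolding k_def
    using qspace_Rats[OF W(1) h x(1)] by (intro qspace_scale[OF W(1) h]) simp
  have k1: "k x = 1" "\<And>b. b \<in> B \<Longrightarrow> k b = 0" using hx hB by (auto simp: k_def)
  define F' where "F' b = (if b = x then k else (\<lambda>y. F b y + (- F b x) * k y))" for b
  have "dual_system X W (insert x B) F'"
    unfolding dual_system_def
  proof (intro conjI ballI)
    show "insert x B \<subseteq> X" using x D by auto
    show "F' b \<in> W" if "b \<in> insert x B" for b
    proof (cases "b = x")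
      case False
      then have b: "F b \<in> W" using that D(2) W(2) by auto
      show ?thesis using False qspace_lin[OF W(1) b k, of "- F b x"] qspace_Rats[OF W(1) b x(1)]
        by (simp add: F'_def)
    qed (use k in \<open>simp add: F'_def\<close>)
    fix b b' assume "b \<in> insert x B" "b' \<in> insert x B"
    then show "F' b b' = (if b = b' then 1 else 0)"
      using k1 xB D(3) by (auto simp: F'_def)
  qed
  then show ?thesis using xB fin by (intro exI[of _ "insert x B"] exI[of _ F']) simp
qed

lemma dual_system_of_chain:
  assumes "finite X" "\<And>j. j \<le> N \<Longrightarrow> qspace X (W j)" "\<And>j. j < N \<Longrightarrow> W (Suc j) \<subseteq> W j"
    and "\<And>j. j < N \<Longrightarrow> \<exists>f\<in>W j. \<forall>g\<in>W (Suc j). \<exists>x\<in>X. f x \<noteq> g x"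
  shows "\<exists>B F. dual_system X (W 0) B F \<and> card B = N"
  using assms(2-4)
proof (induction N arbitrary: W)
  case 0
  then show ?case by (intro exI[of _ "{}"]) (auto simp: dual_system_def)
next
  case (Suc N)
  have "\<exists>B F. dual_system X (W (Suc 0)) B F \<and> card B = N"
    using Suc.prems by (intro Suc.IH[of "\<lambda>j. W (Suc j)"]) auto
  then obtain B F where B: "dual_system X (W (Suc 0)) B F" "card B = N" by blast
  obtain f where f: "f \<in> W 0" "\<And>g. g \<in> W (Suc 0) \<Longrightarrow> \<exists>x\<in>X. f x \<noteq> g x" using Suc.prems(3)[of 0] by auto
  have "qspace X (W 0)" "W (Suc 0) \<subseteq> W 0" "qspace X (W (Suc 0))" using Suc.prems by auto
  from dual_system_augment[OF assms(1) this B(1) f] B(2) show ?case by simp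
qed

lemma dual_system_subset:
  assumes "dual_system X W B F" "B' \<subseteq> B"
  shows "dual_system X W B' F"
  using assms unfolding dual_system_def by blast

section \<open>Words, their relations and iterated sumsets\<close>

definition l1 :: "'a set \<Rightarrow> ('a \<Rightarrow> int) \<Rightarrow> int" where
  "l1 X c = (\<Sum>x\<in>X. \<bar>c x\<bar>)"

definition wval :: "'a set \<Rightarrow> ('a \<Rightarrow> int) \<Rightarrow> ('a \<Rightarrow> real) \<Rightarrow> real" where
  "wval X c f = (\<Sum>x\<in>X. of_int (c x) * f x)"

definition ival :: "int set \<Rightarrow> (int \<Rightarrow> int) \<Rightarrow> int" where
  "ival X c = (\<Sum>x\<in>X. c x * x)"

text \<open>The \<open>k\<close>-fold sumset of \<open>X \<union> -X \<union> {0}\<close>, the words being encoded as coefficient functions.\<close>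
definition ksum :: "int set \<Rightarrow> nat \<Rightarrow> int set" where
  "ksum X k = ival X ` {c. l1 X c \<le> int k}"

text \<open>The linear dual over \<open>\<rat>\<close> of the universal ambient group of \<open>X\<close> of order \<open>t\<close>.\<close>
definition rel_funs :: "int set \<Rightarrow> nat \<Rightarrow> (int \<Rightarrow> real) set" where
  "rel_funs X t = {f. (\<forall>x\<in>X. f x \<in> \<rat>) \<and> (\<forall>c. l1 X c \<le> int t \<longrightarrow> ival X c = 0 \<longrightarrow> wval X c f = 0)}"

lemma wval_of_int: "wval X c real_of_int = of_int (ival X c)"
  by (simp add: wval_def ival_def)

lemma wval_add: "wval X (\<lambda>x. c x + c' x) f = wval X c f + wval X c' f"
  and wval_diff: "wval X (\<lambda>x. c x - c' x) f = wval X c f - wval X c' f"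
  and ival_add: "ival Y (\<lambda>x. d x + d' x) = ival Y d + ival Y d'"
  and ival_diff: "ival Y (\<lambda>x. d x - d' x) = ival Y d - ival Y d'"
  by (simp_all add: wval_def ival_def algebra_simps sum.distrib sum_subtractf)

lemma l1_add: "l1 X (\<lambda>x. c x + c' x) \<le> l1 X c + l1 X c'"
  and l1_diff: "l1 X (\<lambda>x. c x - c' x) \<le> l1 X c + l1 X c'"
  unfolding l1_def sum.distrib[symmetric] by (rule sum_mono; simp)+

lemma wval_bound:
  assumes "\<And>x. x \<in> X \<Longrightarrow> \<bar>f x\<bar> \<le> e"
  shows "\<bar>wval X c f\<bar> \<le> of_int (l1 X c) * e"
proof -
  have "\<bar>wval X c f\<bar> \<le> (\<Sum>x\<in>X. \<bar>of_int (c x) * f x\<bar>)" unfolding wval_def by (rule sum_abs)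
  also have "\<dots> \<le> (\<Sum>x\<in>X. of_int \<bar>c x\<bar> * e)"
    using assms by (intro sum_mono) (auto simp: abs_mult intro!: mult_left_mono)
  finally show ?thesis by (simp add: l1_def sum_distrib_right)
qed

text \<open>The words themselves are infinitely many, as coefficients outside \<open>X\<close> are
  free; what is finite is the range of their values.\<close>

lemma finite_ksum:
  assumes "finite X"
  shows "finite (ksum X k)"
proof -
  have "ksum X k \<subseteq> {- (int k * (\<Sum>x\<in>X. \<bar>x\<bar>))..int k * (\<Sum>x\<in>X. \<bar>x\<bar>)}"
  proof
    fix z assume "z \<in> ksum X k"
    then obtain c where c: "l1 X c \<le> int k" "z = ival X c" by (auto simp: ksum_def)
    have "\<bar>z\<bar> \<le> (\<Sum>x\<in>X. \<bar>c x * x\<bar>)" unfolding c(2) ival_def by (rule sum_abs)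
    also have "\<dots> \<le> (\<Sum>x\<in>X. int k * \<bar>x\<bar>)"
    proof (rule sum_mono)
      fix x assume x: "x \<in> X"
      have "\<bar>c x\<bar> \<le> l1 X c" unfolding l1_def using assms x by (intro member_le_sum) auto
      then show "\<bar>c x * x\<bar> \<le> int k * \<bar>x\<bar>" using c(1) by (simp add: abs_mult mult_right_mono)
    qed
    finally show "z \<in> {- (int k * (\<Sum>x\<in>X. \<bar>x\<bar>))..int k * (\<Sum>x\<in>X. \<bar>x\<bar>)}"
      by (auto simp: sum_distrib_left abs_le_iff)
  qed
  then show ?thesis by (rule finite_subset) simp
qed

lemma ksum_mono: "j \<le> k \<Longrightarrow> ksum X j \<subseteq> ksum X k"
  unfolding ksum_def by force

lemma qspace_rel_funs: "qspace X (rel_funs X t)"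
  unfolding qspace_def
proof (intro conjI ballI)
  fix f g q assume f: "f \<in> rel_funs X t" and g: "g \<in> rel_funs X t" and q: "(q::real) \<in> \<rat>"
  have "wval X c (\<lambda>x. f x + q * g x) = wval X c f + q * wval X c g" for c
    by (simp add: wval_def algebra_simps sum.distrib sum_distrib_left)
  then show "(\<lambda>x. f x + q * g x) \<in> rel_funs X t" using f g q by (auto simp: rel_funs_def)
qed (auto simp: rel_funs_def wval_def)

lemma rel_funs_antimono: "t \<le> T \<Longrightarrow> rel_funs X T \<subseteq> rel_funs X t"
  unfolding rel_funs_def by force

lemma of_int_in_rel_funs: "real_of_int \<in> rel_funs X t"
  unfolding rel_funs_def by (simp add: wval_of_int)

text \<open>The sums of the b in \<open>B\<close> with coefficients between 0 and \<open>u\<close>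
  are distinct: a coincidence is a relation of length at most \<open>t\<close>, which every
  \<open>F b\<close> respects, and \<open>F b\<close> reads off the coefficient of b.\<close>

lemma dual_system_card_bound:
  assumes X: "finite X" and BF: "dual_system X (rel_funs X t) B F" and t: "card B * u \<le> t"
  shows "(u + 1) ^ card B \<le> card (ksum X (card B * u))"
proof -
  note D = dual_systemD[OF BF]
  have fin: "finite B" using D(1) X finite_subset by blast
  define P where "P = (\<Pi>\<^sub>E b\<in>B. {0..int u})"
  define w where "w m = (\<lambda>x. if x \<in> B then m x else (0::int))" for m
  have l1: "l1 X (w m) = (\<Sum>b\<in>B. \<bar>m b\<bar>)" for m
    unfolding l1_def w_def using D(1) X by (intro sum.mono_neutral_cong_right) auto
  have wv: "wval X (w m) (F b) = m b" if "b \<in> B" for m b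
  proof -
    have "wval X (w m) (F b) = (\<Sum>c\<in>B. of_int (m c) * F b c)"
      unfolding wval_def w_def using D(1) X by (intro sum.mono_neutral_cong_right) auto
    also have "\<dots> = (\<Sum>c\<in>B. if c = b then of_int (m c) else 0)"
      using D(3)[OF that] by (intro sum.cong) auto
    also have "\<dots> = m b" using that fin by simp
    finally show ?thesis .
  qed
  have "inj_on (\<lambda>m. ival X (w m)) P"
  proof (rule inj_onI)
    fix m m' assume m: "m \<in> P" "m' \<in> P" and eq: "ival X (w m) = ival X (w m')"
    define n where "n = (\<lambda>x. m x - m' x)"
    have wn: "w n = (\<lambda>x. w m x - w m' x)" by (auto simp: w_def n_def)
    have "l1 X (w n) \<le> (\<Sum>b\<in>B. int u)" unfolding l1
    proof (rule sum_mono)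
      fix b assume "b \<in> B"
      then have "m b \<in> {0..int u}" "m' b \<in> {0..int u}" using m unfolding P_def by (auto dest: PiE_mem)
      then show "\<bar>n b\<bar> \<le> int u" by (auto simp: n_def)
    qed
    also have "\<dots> \<le> int t" using t by (simp flip: of_nat_mult)
    finally have "l1 X (w n) \<le> int t" .
    moreover have "ival X (w n) = 0" using eq by (simp add: wn ival_diff)
    ultimately have "wval X (w n) (F b) = 0" if "b \<in> B" for b
      using D(2)[OF that] by (auto simp: rel_funs_def)
    then have "m b = m' b" if "b \<in> B" for b using wv[OF that, of n] that by (simp add: n_def)
    then show "m = m'" using m unfolding P_def by (intro PiE_ext[of m B _ m']) auto
  qed
  then have "card P = card ((\<lambda>m. ival X (w m)) ` P)" by (rule card_image[symmetric])
  also have "\<dots> \<le> card (ksum X (card B * u))"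
  proof (intro card_mono finite_ksum[OF X] subsetI)
    fix z assume "z \<in> (\<lambda>m. ival X (w m)) ` P"
    then obtain m where m: "m \<in> P" "z = ival X (w m)" by blast
    have "l1 X (w m) \<le> (\<Sum>b\<in>B. int u)" unfolding l1
      using m(1) unfolding P_def by (intro sum_mono) (auto dest: PiE_mem)
    then show "z \<in> ksum X (card B * u)" unfolding ksum_def m(2) by auto
  qed
  also have "card P = (u + 1) ^ card B" unfolding P_def by (subst card_PiE[OF fin]) (simp add: nat_add_distrib)
  finally show ?thesis .
qed

section \<open>Characters\<close>

definition e2pi :: "real \<Rightarrow> complex" where
  "e2pi x = cis (2 * pi * x)"

lemma e2pi_add: "e2pi (x + y) = e2pi x * e2pi y"
  and e2pi_diff: "e2pi (x - y) = e2pi x * cnj (e2pi y)"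
  and e2pi_0: "e2pi 0 = 1"
  and norm_e2pi: "norm (e2pi x) = 1"
  by (simp_all add: e2pi_def cis_mult cis_cnj algebra_simps)

lemma e2pi_Ints: "x \<in> \<int> \<Longrightarrow> e2pi x = 1"
  by (simp add: e2pi_def)

lemma e2pi_cong_Ints:
  assumes "x - y \<in> \<int>"
  shows "e2pi x = e2pi y"
  using e2pi_add[of "x - y" y] e2pi_Ints[OF assms] by simp

lemma e2pi_sum: "e2pi (\<Sum>i\<in>S. f i) = (\<Prod>i\<in>S. e2pi (f i))"
  by (induction S rule: infinite_finite_induct) (simp_all add: e2pi_0 e2pi_add)

lemma e2pi_power: "e2pi (real n * x) = e2pi x ^ n"
  by (induction n) (simp_all add: e2pi_0 e2pi_add algebra_simps)

lemma abs_sin_ge_half: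
  assumes "\<bar>x\<bar> \<le> pi / 2"
  shows "\<bar>x\<bar> / 2 \<le> \<bar>sin x\<bar>"
proof -
  have "\<bar>sin x - x\<bar> \<le> \<bar>x\<bar> ^ 3 / 6"
    using Maclaurin_sin_bound[of x 3]
    by (simp add: numeral_eq_Suc sin_coeff_def lessThan_Suc)
  moreover have "\<bar>x\<bar> ^ 3 / 6 \<le> \<bar>x\<bar> / 2"
  proof -
    have "pi \<le> 3.2" using pi_approx(2) by (rule order_trans) simp
    then have "\<bar>x\<bar> \<le> 1.6" using assms by simp
    then have "\<bar>x\<bar>\<^sup>2 \<le> 1.6\<^sup>2" by (intro power_mono) auto
    then have "\<bar>x\<bar>\<^sup>2 \<le> 3" by (simp add: power2_eq_square)
    then have "\<bar>x\<bar>\<^sup>2 * \<bar>x\<bar> \<le> 3 * \<bar>x\<bar>" by (intro mult_right_mono) auto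
    then show ?thesis by (simp add: power3_eq_cube power2_eq_square)
  qed
  ultimately show ?thesis by linarith
qed

lemma norm_e2pi_minus_one: "norm (e2pi x - 1) = 2 * \<bar>sin (pi * x)\<bar>"
proof -
  have "(norm (e2pi x - 1))\<^sup>2 = (cos (2 * (pi * x)) - 1)\<^sup>2 + (sin (2 * (pi * x)))\<^sup>2"
    by (simp add: e2pi_def cmod_power2 mult.assoc)
  also have "\<dots> = (2 * sin (pi * x))\<^sup>2"
  proof -
    have "(sin (2 * (pi * x)))\<^sup>2 + (cos (2 * (pi * x)))\<^sup>2 = 1" by (rule sin_cos_squared_add)
    moreover have "cos (2 * (pi * x)) = 1 - 2 * (sin (pi * x))\<^sup>2" by (rule cos_double_sin)
    ultimately show ?thesis by (simp add: power2_eq_square algebra_simps)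
  qed
  finally show ?thesis
    by (metis abs_mult abs_numeral norm_ge_zero power2_abs power2_eq_imp_eq abs_ge_zero)
qed

text \<open>What matters is that the constant exceeds 2: in \<open>large_coef_trivial\<close> it has
  to beat the factor 2 of \<open>coef_shift\<close>.\<close>

lemma norm_e2pi_minus_one_ge: "3 * \<bar>x - of_int (round x)\<bar> \<le> norm (e2pi x - 1)"
proof -
  define r where "r = x - of_int (round x)"
  have r: "\<bar>r\<bar> \<le> 1 / 2" using of_int_round_abs_le[of x] by (simp add: r_def abs_minus_commute)
  have "e2pi x = e2pi r" by (rule e2pi_cong_Ints) (simp add: r_def)
  then have "norm (e2pi x - 1) = 2 * \<bar>sin (pi * r)\<bar>" by (simp add: norm_e2pi_minus_one)
  moreover have "\<bar>pi * r\<bar> \<le> pi / 2" using r mult_left_mono[OF r, of pi] by (simp add: abs_mult)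
  ultimately have "norm (e2pi x - 1) \<ge> pi * \<bar>r\<bar>" using abs_sin_ge_half by (fastforce simp: abs_mult)
  moreover have "3 * \<bar>r\<bar> \<le> pi * \<bar>r\<bar>" using pi_gt3 by (intro mult_right_mono) auto
  ultimately show ?thesis by (simp add: r_def)
qed

lemma frac_eq_iff: "frac x = frac y \<longleftrightarrow> x - y \<in> \<int>"
proof
  assume "frac x = frac y"
  then have "x - y = of_int (\<lfloor>x\<rfloor> - \<lfloor>y\<rfloor>)" by (simp add: frac_def)
  then show "x - y \<in> \<int>" by (metis Ints_of_int)
next
  assume "x - y \<in> \<int>"
  then obtain n where "x = y + of_int n" by (auto elim!: Ints_cases simp: algebra_simps)
  then show "frac x = frac y" by (simp add: frac_def)
qed

lemma sum_e2pi_period: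
  assumes D: "D > 0" "real D * z \<in> \<int>"
  shows "(\<Sum>n<D. e2pi (real n * z)) = (if z \<in> \<int> then of_nat D else 0)"
proof (cases "z \<in> \<int>")
  case True
  then show ?thesis by (simp add: e2pi_Ints)
next
  case False
  have "e2pi z \<noteq> 1"
  proof
    assume "e2pi z = 1"
    then have "3 * \<bar>z - of_int (round z)\<bar> \<le> 0" using norm_e2pi_minus_one_ge[of z] by simp
    then have "z = of_int (round z)" by simp
    then show False using False Ints_of_int by metis
  qed
  moreover have "(\<Sum>n<D. e2pi (real n * z)) = (\<Sum>n<D. e2pi z ^ n)" by (simp add: e2pi_power)
  moreover have "e2pi z ^ D = 1" using e2pi_power[of D z] e2pi_Ints[OF D(2)] by simp
  ultimately show ?thesis using False by (simp add: sum_gp_strict)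
qed

lemma sum_e2pi_period_PiE:
  assumes B: "finite B" and D: "D > 0" "\<And>b. b \<in> B \<Longrightarrow> real D * z b \<in> \<int>"
  shows "(\<Sum>\<xi>\<in>(\<Pi>\<^sub>E b\<in>B. {..<D}). e2pi (\<Sum>b\<in>B. real (\<xi> b) * z b)) =
           (if \<forall>b\<in>B. z b \<in> \<int> then of_nat (D ^ card B) else 0)"
proof -
  have "(\<Sum>\<xi>\<in>(\<Pi>\<^sub>E b\<in>B. {..<D}). e2pi (\<Sum>b\<in>B. real (\<xi> b) * z b)) =
      (\<Prod>b\<in>B. \<Sum>n<D. e2pi (real n * z b))"
    by (subst prod_sum_PiE[OF B]) (auto simp: e2pi_sum)
  also have "\<dots> = (\<Prod>b\<in>B. if z b \<in> \<int> then of_nat D else 0)"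
    using D by (intro prod.cong) (auto simp: sum_e2pi_period)
  also have "\<dots> = (if \<forall>b\<in>B. z b \<in> \<int> then of_nat (D ^ card B) else 0)"
    using B by (auto simp: prod_zero_iff)
  finally show ?thesis .
qed

section \<open>Classes of words modulo the sublattice spanned by \<open>B\<close>\<close>

lemma common_denominator:
  assumes "finite S" "\<And>s. s \<in> S \<Longrightarrow> f s \<in> \<rat>"
  shows "\<exists>D>0. \<forall>s\<in>S. real D * f s \<in> \<int>"
  using assms
proof (induction S rule: finite_induct)
  case (insert x S)
  then obtain D where D: "D > 0" "\<forall>s\<in>S. real D * f s \<in> \<int>" by auto
  obtain i n where n: "n \<noteq> 0" "f x = real_of_int i / real n"
    using insert.prems[of x] by (auto simp: Rats_eq_int_div_nat)
  have "real (n * D) * f s \<in> \<int>" if "s \<in> insert x S" for s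
  proof (cases "s = x")
    case True
    then have "real (n * D) * f s = real D * of_int i" using n by simp
    then show ?thesis by (simp only: Ints_mult Ints_of_nat Ints_of_int)
  next
    case False
    then have "real D * f s \<in> \<int>" using that D by auto
    from Ints_mult[OF Ints_of_nat this] have "real n * (real D * f s) \<in> \<int>" .
    then show ?thesis by (simp add: mult.assoc)
  qed
  then show ?case using D(1) n(1) by (intro exI[of _ "n * D"]) auto
qed (auto intro: exI[of _ 1])

text \<open>Words are read through their coordinates \<open>wval X c (F b)\<close>. Letters in
  \<open>B\<close> have unit vectors as coordinates, so integer vectors are exactly the coordinates
  of words in \<open>B\<close>, and reducing modulo integers means passing to the quotient by the
  sublattice that \<open>B\<close> spans. \<open>stable\<close> says that going from relations of
  length \<open>t\<close> to relations of length \<open>T\<close> adds no constraint on these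
  coordinates.\<close>

locale word_classes =
  fixes X :: "int set" and t T :: nat and B :: "int set" and F :: "int \<Rightarrow> int \<Rightarrow> real"
  assumes finite_X: "finite X"
    and dual: "dual_system X (rel_funs X t) B F"
    and complete: "\<And>f x. f \<in> rel_funs X t \<Longrightarrow> x \<in> X \<Longrightarrow> f x = (\<Sum>b\<in>B. f b * F b x)"
    and stable: "\<And>b. b \<in> B \<Longrightarrow> F b \<in> rel_funs X T"
begin

definition vec :: "(int \<Rightarrow> int) \<Rightarrow> int \<Rightarrow> real" where
  "vec c = (\<lambda>b. wval X c (F b))"

text \<open>The representative with coordinates in [0,1), extensional on \<open>B\<close>, so that
  equal classes are equal functions and can be counted.\<close>

definition red :: "(int \<Rightarrow> real) \<Rightarrow> int \<Rightarrow> real" where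
  "red p = restrict (\<lambda>b. frac (p b)) B"

definition A :: "nat \<Rightarrow> (int \<Rightarrow> real) set" where
  "A j = (\<lambda>c. red (vec c)) ` {c. l1 X c \<le> int j}"

definition chi :: "(int \<Rightarrow> nat) \<Rightarrow> (int \<Rightarrow> real) \<Rightarrow> complex" where
  "chi \<xi> p = e2pi (\<Sum>b\<in>B. real (\<xi> b) * p b)"

lemma finite_B: "finite B"
  using dual_systemD(1)[OF dual] finite_X finite_subset by blast

lemma red_eq_iff: "red p = red q \<longleftrightarrow> (\<forall>b\<in>B. p b - q b \<in> \<int>)"
  unfolding red_def restrict_def by (auto simp: fun_eq_iff frac_eq_iff)

lemma red_red: "red (red p) = red p"
  by (auto simp: red_def restrict_def frac_eq)

lemma red_A: "p \<in> A j \<Longrightarrow> red p = p"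
  unfolding A_def by (auto simp: red_red)

lemma chi_cong: "(\<And>b. b \<in> B \<Longrightarrow> p b - q b \<in> \<int>) \<Longrightarrow> chi \<xi> p = chi \<xi> q"
  unfolding chi_def
  by (rule e2pi_cong_Ints, simp add: sum_subtractf[symmetric] right_diff_distrib[symmetric])
     (intro Ints_sum Ints_mult, auto)

lemma chi_red: "chi \<xi> (red p) = chi \<xi> p"
  using red_eq_iff[of "red p" p] by (intro chi_cong) (auto simp: red_red)

lemma chi_add: "chi \<xi> (\<lambda>b. p b + q b) = chi \<xi> p * chi \<xi> q"
  by (simp add: chi_def e2pi_add[symmetric] algebra_simps sum.distrib)

lemma chi_diff: "chi \<xi> (\<lambda>b. p b - q b) = chi \<xi> p * cnj (chi \<xi> q)"
  by (simp add: chi_def e2pi_diff[symmetric] algebra_simps sum_subtractf)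

lemma norm_chi: "norm (chi \<xi> p) = 1"
  by (simp add: chi_def norm_e2pi)

lemma vec_add: "vec (\<lambda>x. c x + c' x) b = vec c b + vec c' b"
  by (simp add: vec_def wval_add)

lemma A_nonempty: "A j \<noteq> {}"
proof -
  have "(\<lambda>_. 0) \<in> {c. l1 X c \<le> int j}" by (simp add: l1_def)
  then show ?thesis unfolding A_def by blast
qed

lemma A_mono: "i \<le> j \<Longrightarrow> A i \<subseteq> A j"
  unfolding A_def by force

text \<open>Words of length \<open>j\<close> with the same value have the same vector, since their difference is a
  relation of length \<open>2 j\<close>.\<close>
lemma A_card:
  assumes "2 * j \<le> T"
  shows "finite (A j)" and "card (A j) \<le> card (ksum X j)"
proof -
  define h where "h z = red (vec (SOME c. l1 X c \<le> int j \<and> ival X c = z))" for z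
  have "A j \<subseteq> h ` ksum X j"
  proof
    fix p assume "p \<in> A j"
    then obtain c where c: "l1 X c \<le> int j" "p = red (vec c)" by (auto simp: A_def)
    define c' where "c' = (SOME c'. l1 X c' \<le> int j \<and> ival X c' = ival X c)"
    have c': "l1 X c' \<le> int j \<and> ival X c' = ival X c" unfolding c'_def by (rule someI[of _ c]) (use c in auto)
    have "l1 X (\<lambda>x. c x - c' x) \<le> int T" using l1_diff[of X c c'] c c' assms by linarith
    moreover have "ival X (\<lambda>x. c x - c' x) = 0" using c' by (simp add: ival_diff)
    ultimately have "vec c b = vec c' b" if "b \<in> B" for b
      using stable[OF that] wval_diff[of X c c' "F b"] by (auto simp: rel_funs_def vec_def)
    then have "p = red (vec c')" unfolding c(2) red_eq_iff by simp
    then have "p = h (ival X c)" unfolding h_def c'_def .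
    then show "p \<in> h ` ksum X j" using c(1) by (auto simp: ksum_def)
  qed
  then show "finite (A j)" "card (A j) \<le> card (ksum X j)"
    using finite_ksum[OF finite_X, of j] by (auto intro: finite_subset surj_card_le)
qed

definition coef :: "nat \<Rightarrow> (int \<Rightarrow> nat) \<Rightarrow> complex" where
  "coef s \<xi> = (\<Sum>p\<in>A s. chi \<xi> p)"

text \<open>Multiplication by the value of the character at the letter \<open>x\<close> translates
  \<open>A s\<close> by \<open>x\<close>. The set and its translate both lie in
  \<open>A (s + 1)\<close> and miss equally many of its elements.\<close>

lemma coef_shift:
  assumes x: "x \<in> X" and s: "2 * (s + 1) \<le> T"
  shows "norm ((chi \<xi> (\<lambda>b. F b x) - 1) * coef s \<xi>) \<le> 2 * (real (card (A (s + 1))) - real (card (A s)))"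
proof -
  define \<tau> where "\<tau> p = red (\<lambda>b. p b + F b x)" for p
  have fin: "finite (A (s + 1))" by (rule A_card(1)[OF s])
  have sub: "A s \<subseteq> A (s + 1)" by (rule A_mono) simp
  have fin': "finite (A s)" using fin sub finite_subset by blast
  have inj: "inj_on \<tau> (A s)"
  proof (rule inj_onI)
    fix p p' assume p: "p \<in> A s" "p' \<in> A s" "\<tau> p = \<tau> p'"
    then have "red p = red p'" unfolding \<tau>_def red_eq_iff by simp
    then show "p = p'" using red_A p by metis
  qed
  have img: "\<tau> ` A s \<subseteq> A (s + 1)"
  proof
    fix q assume "q \<in> \<tau> ` A s"
    then obtain c where c: "l1 X c \<le> int s" "q = \<tau> (red (vec c))" unfolding A_def by blast
    define e where "e y = (if y = x then 1 else 0 :: int)" for y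
    have e1: "l1 X e = 1" unfolding l1_def e_def using x finite_X by (simp add: if_distrib cong: if_cong)
    have "wval X e f = f x" for f :: "int \<Rightarrow> real"
    proof -
      have "wval X e f = (\<Sum>y\<in>X. if y = x then f y else 0)" unfolding wval_def e_def by (intro sum.cong) auto
      then show ?thesis using x finite_X by simp
    qed
    then have ev: "vec e b = F b x" for b by (simp add: vec_def)
    have "q = red (vec (\<lambda>y. c y + e y))"
      unfolding c(2) \<tau>_def red_eq_iff vec_add ev
      using red_eq_iff[of "red (vec c)" "vec c"] by (auto simp: red_red)
    moreover have "l1 X (\<lambda>y. c y + e y) \<le> int (s + 1)" using l1_add[of X c e] c(1) e1 by linarith
    ultimately show "q \<in> A (s + 1)" unfolding A_def by blast
  qed
  have "chi \<xi> (\<lambda>b. F b x) * coef s \<xi> = (\<Sum>p\<in>A s. chi \<xi> (\<tau> p))"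
    unfolding coef_def sum_distrib_left \<tau>_def chi_red chi_add by (simp add: mult.commute)
  also have "\<dots> = (\<Sum>p\<in>\<tau> ` A s. chi \<xi> p)" by (simp add: sum.reindex[OF inj])
  finally have "(chi \<xi> (\<lambda>b. F b x) - 1) * coef s \<xi> = (\<Sum>p\<in>\<tau> ` A s. chi \<xi> p) - (\<Sum>p\<in>A s. chi \<xi> p)"
    by (simp add: left_diff_distrib coef_def)
  also have "\<dots> = (\<Sum>p\<in>A (s + 1) - A s. chi \<xi> p) - (\<Sum>p\<in>A (s + 1) - \<tau> ` A s. chi \<xi> p)"
    using sum_diff[OF fin sub, of "chi \<xi>"] sum_diff[OF fin img, of "chi \<xi>"] by simp
  also have "norm \<dots> \<le> real (card (A (s + 1) - A s)) + real (card (A (s + 1) - \<tau> ` A s))"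
    by (rule order_trans[OF norm_triangle_ineq4 add_mono]; rule order_trans[OF norm_sum]; simp add: norm_chi)
  also have "\<dots> = 2 * (real (card (A (s + 1))) - real (card (A s)))"
  proof -
    have "card (A (s + 1) - A s) = card (A (s + 1)) - card (A s)" by (rule card_Diff_subset[OF fin' sub])
    moreover have "card (A (s + 1) - \<tau> ` A s) = card (A (s + 1)) - card (A s)"
      using card_Diff_subset[OF finite_imageI[OF fin'] img] card_image[OF inj] by simp
    ultimately show ?thesis using card_mono[OF fin sub] by (simp only: of_nat_diff) simp
  qed
  finally show ?thesis .
qed

text \<open>A character that is large on an almost invariant set is close to \<open>1\<close> on \<open>X\<close>; its small
  logarithm then satisfies all relations of length \<open>t\<close> and vanishes on \<open>B\<close>, hence everywhere.\<close>
lemma large_coef_trivial: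
  assumes s: "2 * (s + 1) \<le> T" and \<beta>: "\<beta> > 0" and large: "norm (coef s \<xi>) \<ge> \<beta> * real (card (A s))"
    and \<epsilon>: "real (card (A (s + 1))) - real (card (A s)) \<le> \<epsilon> * real (card (A s))" "real t * \<epsilon> \<le> \<beta>"
    and x: "x \<in> X"
  shows "(\<Sum>b\<in>B. real (\<xi> b) * F b x) \<in> \<int>"
proof -
  define \<theta> where "\<theta> y = (\<Sum>b\<in>B. real (\<xi> b) * F b y)" for y
  define f where "f y = \<theta> y - of_int (round (\<theta> y))" for y
  have n0: "real (card (A s)) > 0"
    using A_nonempty[of s] A_card(1)[of s] s by (simp add: card_gt_0_iff)
  have fb: "\<bar>f y\<bar> \<le> 2 * \<epsilon> / (3 * \<beta>)" if y: "y \<in> X" for y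
  proof -
    have "norm (e2pi (\<theta> y) - 1) * (\<beta> * real (card (A s))) \<le> norm (e2pi (\<theta> y) - 1) * norm (coef s \<xi>)"
      using large by (intro mult_left_mono) auto
    also have "\<dots> = norm ((chi \<xi> (\<lambda>b. F b y) - 1) * coef s \<xi>)" by (simp add: norm_mult chi_def \<theta>_def)
    also have "\<dots> \<le> 2 * (\<epsilon> * real (card (A s)))"
      by (rule order_trans[OF coef_shift[OF y s] mult_left_mono[OF \<epsilon>(1)]]) simp
    finally have "norm (e2pi (\<theta> y) - 1) * \<beta> \<le> 2 * \<epsilon>" using n0 by (simp flip: mult.assoc)
    then have "3 * \<bar>f y\<bar> * \<beta> \<le> 2 * \<epsilon>"
      using mult_right_mono[OF norm_e2pi_minus_one_ge[of "\<theta> y"], of \<beta>] \<beta> unfolding f_def by linarith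
    then show ?thesis using \<beta> by (simp add: field_simps)
  qed
  have \<theta>W: "\<theta> \<in> rel_funs X t"
    unfolding \<theta>_def using dual_systemD(2)[OF dual]
    by (intro qspace_sum[OF qspace_rel_funs finite_B]) auto
  have "f \<in> rel_funs X t"
    unfolding rel_funs_def
  proof (intro CollectI conjI ballI allI impI)
    show "f y \<in> \<rat>" if "y \<in> X" for y
      using \<theta>W that by (auto simp: f_def rel_funs_def intro!: Rats_diff)
    fix c assume c: "l1 X c \<le> int t" "ival X c = 0"
    have "wval X c f = wval X c \<theta> - (\<Sum>y\<in>X. of_int (c y) * of_int (round (\<theta> y)))"
      by (simp add: wval_def f_def algebra_simps sum_subtractf)
    also have "wval X c \<theta> = 0" using \<theta>W c by (auto simp: rel_funs_def)
    finally have "wval X c f = of_int (- (\<Sum>y\<in>X. c y * round (\<theta> y)))" by simp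
    \<comment> \<open>The value is an integer because \<theta> annihilates the relation; the bound
      on letters together with \<open>t * \<epsilon> \<le> \<beta>\<close> keeps it below 2/3, so it
      is zero.\<close>
    moreover have "\<bar>wval X c f\<bar> < 1"
    proof -
      have "0 \<le> 2 * \<epsilon> / (3 * \<beta>)" using fb[OF x] by linarith
      have "\<bar>wval X c f\<bar> \<le> of_int (l1 X c) * (2 * \<epsilon> / (3 * \<beta>))" by (rule wval_bound) (rule fb)
      also have "\<dots> \<le> real t * (2 * \<epsilon> / (3 * \<beta>))"
        using c(1) \<open>0 \<le> 2 * \<epsilon> / (3 * \<beta>)\<close> by (intro mult_right_mono) auto
      also have "\<dots> = 2 * (real t * \<epsilon>) / (3 * \<beta>)" by simp
      also have "\<dots> \<le> 2 * \<beta> / (3 * \<beta>)" using \<epsilon>(2) \<beta> by (intro divide_right_mono) auto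
      also have "\<dots> < 1" using \<beta> by simp
      finally show ?thesis .
    qed
    ultimately show "wval X c f = 0" by (metis Ints_nonzero_abs_less1 Ints_of_int)
  qed
  then have "f x = (\<Sum>b\<in>B. f b * F b x)" by (rule complete) (rule x)
  moreover have "f b = 0" if b: "b \<in> B" for b
  proof -
    have "\<theta> b = real (\<xi> b)" unfolding \<theta>_def
      using dual_system_eval[OF dual finite_B b, of "\<lambda>b. real (\<xi> b)"] .
    then show ?thesis by (simp add: f_def)
  qed
  ultimately have "f x = 0" by simp
  then have "\<theta> x = of_int (round (\<theta> x))" by (simp add: f_def)
  then show ?thesis unfolding \<theta>_def by (metis Ints_of_int)
qed

lemma chi_vec_trivial:
  assumes "\<And>x. x \<in> X \<Longrightarrow> (\<Sum>b\<in>B. real (\<xi> b) * F b x) \<in> \<int>"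
  shows "chi \<xi> (vec c) = 1"
proof -
  have "(\<Sum>b\<in>B. real (\<xi> b) * vec c b) = (\<Sum>x\<in>X. of_int (c x) * (\<Sum>b\<in>B. real (\<xi> b) * F b x))"
    unfolding vec_def wval_def sum_distrib_left by (subst sum.swap) (simp add: mult_ac)
  also have "\<dots> \<in> \<int>" by (intro Ints_sum Ints_mult[OF Ints_of_int] assms)
  finally show ?thesis unfolding chi_def by (rule e2pi_Ints)
qed

text \<open>Counting \<open>L\<close>-fold sums of \<open>A s\<close> by characters: the trivial characters contribute the same to
  every class and dominate, so a class that is not hit would make all counts too small.\<close>
lemma sumset_covers:
  assumes T: "2 * (s + 1) \<le> T" "2 * (L * s) \<le> T" and L: "L \<ge> 2" and \<beta>: "\<beta> > 0"
    and \<epsilon>: "real (card (A (s + 1))) - real (card (A s)) \<le> \<epsilon> * real (card (A s))" "real t * \<epsilon> \<le> \<beta>"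
    and Y: "real (card (ksum X (L * s))) \<le> Y" "2 * Y * \<beta> ^ (L - 2) < 1"
  shows "\<exists>c'. l1 X c' \<le> int (L * s) \<and> (\<forall>b\<in>B. vec c b - vec c' b \<in> \<int>)"
proof (rule ccontr)
  assume none: "\<not> ?thesis"
  define a where "a = real (card (A s))"
  have finA: "finite (A s)" using T(1) by (intro A_card(1)) simp
  have a1: "a \<ge> 1" using A_nonempty[of s] finA by (simp add: a_def Suc_le_eq card_gt_0_iff)
  \<comment> \<open>All coordinates of words have denominator \<open>D\<close>, so the frequencies
    with entries below \<open>D\<close> already separate the classes and Fourier analysis becomes
    finite.\<close>
  have "\<exists>D>0. \<forall>z\<in>B \<times> X. real D * F (fst z) (snd z) \<in> \<int>"
    using finite_B finite_X dual_systemD(2)[OF dual]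
    by (intro common_denominator) (auto simp: rel_funs_def)
  then obtain D where D: "D > 0" "\<And>b x. b \<in> B \<Longrightarrow> x \<in> X \<Longrightarrow> real D * F b x \<in> \<int>" by fastforce
  have Dvec: "real D * vec c b \<in> \<int>" if b: "b \<in> B" for c b
  proof -
    have "real D * vec c b = (\<Sum>x\<in>X. of_int (c x) * (real D * F b x))"
      by (simp add: vec_def wval_def sum_distrib_left mult_ac)
    also have "\<dots> \<in> \<int>" by (intro Ints_sum Ints_mult[OF Ints_of_int] D(2) b)
    finally show ?thesis .
  qed
  have DA: "real D * p b \<in> \<int>" if p: "p \<in> A j" and b: "b \<in> B" for p b j
  proof -
    obtain c where "p = red (vec c)" using p by (auto simp: A_def)
    then have "vec c b - p b = of_int \<lfloor>vec c b\<rfloor>" using b by (simp add: red_def frac_def)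
    then have "p b = vec c b - of_int \<lfloor>vec c b\<rfloor>" by linarith
    then have "real D * p b = real D * (vec c b - of_int \<lfloor>vec c b\<rfloor>)" by (rule arg_cong)
    also have "\<dots> = real D * vec c b - of_int (int D * \<lfloor>vec c b\<rfloor>)" by (simp add: right_diff_distrib)
    finally have "real D * p b = real D * vec c b - of_int (int D * \<lfloor>vec c b\<rfloor>)" .
    then show ?thesis using Ints_diff[OF Dvec[OF b, of c] Ints_of_int] by metis
  qed
  define \<Xi> where "\<Xi> = (\<Pi>\<^sub>E b\<in>B. {..<D})"
  have fin\<Xi>: "finite \<Xi>" unfolding \<Xi>_def using finite_B by (intro finite_PiE) auto
  define G where "G = real (D ^ card B)"
  have G: "G > 0" using D(1) by (simp add: G_def)
  have orth: "(\<Sum>\<xi>\<in>\<Xi>. chi \<xi> z) = (if \<forall>b\<in>B. z b \<in> \<int> then of_real G else 0)"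
    if "\<And>b. b \<in> B \<Longrightarrow> real D * z b \<in> \<int>" for z
    unfolding chi_def \<Xi>_def G_def using sum_e2pi_period_PiE[OF finite_B D(1) that] by simp
  \<comment> \<open>The frequencies whose characters are trivial on all words; they form the main
    term in \<open>count\<close>, which is the same for every class.\<close>
  define H where "H = {\<xi>\<in>\<Xi>. \<forall>x\<in>X. (\<Sum>b\<in>B. real (\<xi> b) * F b x) \<in> \<int>}"
  have H1: "chi \<xi> (vec c) = 1" if "\<xi> \<in> H" for \<xi> c using that by (intro chi_vec_trivial) (auto simp: H_def)
  have HA: "coef s \<xi> = of_real a" if "\<xi> \<in> H" for \<xi>
  proof -
    have "chi \<xi> p = 1" if p: "p \<in> A s" for p
      using p H1[OF \<open>\<xi> \<in> H\<close>] by (auto simp: A_def chi_red)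
    then show ?thesis by (simp add: coef_def a_def)
  qed
  have small: "norm (coef s \<xi>) \<le> \<beta> * a" if "\<xi> \<in> \<Xi> - H" for \<xi>
  proof (rule ccontr)
    assume "\<not> ?thesis"
    then have "norm (coef s \<xi>) \<ge> \<beta> * real (card (A s))" by (simp add: a_def)
    from large_coef_trivial[OF T(1) \<beta> this \<epsilon>] that show False by (auto simp: H_def)
  qed
  have parseval: "(\<Sum>\<xi>\<in>\<Xi>. (norm (coef s \<xi>))\<^sup>2) = G * a"
  proof -
    have "of_real (\<Sum>\<xi>\<in>\<Xi>. (norm (coef s \<xi>))\<^sup>2) = (\<Sum>\<xi>\<in>\<Xi>. coef s \<xi> * cnj (coef s \<xi>))"
      by (simp only: of_real_sum complex_norm_square)
    also have "\<dots> = (\<Sum>\<xi>\<in>\<Xi>. \<Sum>p\<in>A s. \<Sum>q\<in>A s. chi \<xi> (\<lambda>b. p b - q b))"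
      by (simp add: coef_def cnj_sum sum_product chi_diff)
    also have "\<dots> = (\<Sum>p\<in>A s. \<Sum>q\<in>A s. \<Sum>\<xi>\<in>\<Xi>. chi \<xi> (\<lambda>b. p b - q b))"
      by (subst sum.swap, intro sum.cong refl, rule sum.swap)
    also have "\<dots> = (\<Sum>p\<in>A s. \<Sum>q\<in>A s. if q = p then of_real G else 0)"
    proof (intro sum.cong refl)
      fix p q assume pq: "p \<in> A s" "q \<in> A s"
      have "real D * (p b - q b) \<in> \<int>" if "b \<in> B" for b
        unfolding right_diff_distrib by (rule Ints_diff[OF DA[OF pq(1) that] DA[OF pq(2) that]])
      moreover have "(\<forall>b\<in>B. p b - q b \<in> \<int>) = (q = p)"
        using red_eq_iff[of p q] red_A[OF pq(1)] red_A[OF pq(2)] by auto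
      ultimately show "(\<Sum>\<xi>\<in>\<Xi>. chi \<xi> (\<lambda>b. p b - q b)) = (if q = p then of_real G else 0)"
        by (simp add: orth)
    qed
    also have "\<dots> = (\<Sum>p\<in>A s. of_real G)" using finA by simp
    also have "\<dots> = of_real (G * a)" by (simp add: a_def)
    finally show ?thesis by (simp only: of_real_eq_iff)
  qed
  define P where "P = (\<Pi>\<^sub>E j\<in>{..<L}. A s)"
  have finP: "finite P" unfolding P_def using finA by (intro finite_PiE) auto
  have cardP: "real (card P) = a ^ L" unfolding P_def by (subst card_PiE) (simp_all add: a_def)
  define tot where "tot p = (\<lambda>b. \<Sum>j<L. p j b)" for p :: "nat \<Rightarrow> int \<Rightarrow> real"
  define N where "N w = real (card {p\<in>P. \<forall>b\<in>B. tot p b - w b \<in> \<int>})" for w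
  \<comment> \<open>Outside \<open>H\<close>, all but two of the \<open>L\<close> factors are
    bounded by \<open>\<beta> * a\<close>, and the remaining two are summed by Parseval.\<close>
  define E where "E = (\<beta> * a) ^ (L - 2) * (G * a)"
  have count: "\<bar>G * N (vec c) - real (card H) * a ^ L\<bar> \<le> E" for c
  proof -
    have prod: "(\<Prod>j<L. chi \<xi> (p j)) = chi \<xi> (tot p)" for \<xi> p
      unfolding chi_def tot_def e2pi_sum[symmetric] sum_distrib_left by (subst sum.swap) simp
    have "(\<Sum>\<xi>\<in>\<Xi>. coef s \<xi> ^ L * cnj (chi \<xi> (vec c))) = (\<Sum>\<xi>\<in>\<Xi>. \<Sum>p\<in>P. chi \<xi> (\<lambda>b. tot p b - vec c b))"
    proof (intro sum.cong refl)
      fix \<xi>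
      have "coef s \<xi> ^ L = (\<Prod>j<L. \<Sum>q\<in>A s. chi \<xi> q)" by (simp add: coef_def)
      also have "\<dots> = (\<Sum>p\<in>P. \<Prod>j<L. chi \<xi> (p j))"
        unfolding P_def by (rule prod_sum_PiE) (use finA in auto)
      finally show "coef s \<xi> ^ L * cnj (chi \<xi> (vec c)) = (\<Sum>p\<in>P. chi \<xi> (\<lambda>b. tot p b - vec c b))"
        by (simp add: prod chi_diff sum_distrib_right)
    qed
    also have "\<dots> = (\<Sum>p\<in>P. \<Sum>\<xi>\<in>\<Xi>. chi \<xi> (\<lambda>b. tot p b - vec c b))" by (rule sum.swap)
    also have "\<dots> = (\<Sum>p\<in>P. if \<forall>b\<in>B. tot p b - vec c b \<in> \<int> then of_real G else 0)"
    proof (intro sum.cong refl orth)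
      fix p b assume p: "p \<in> P" and b: "b \<in> B"
      have pj: "p j \<in> A s" if "j < L" for j using p that unfolding P_def by auto
      have "real D * tot p b = (\<Sum>j<L. real D * p j b)" by (simp add: tot_def sum_distrib_left)
      also have "\<dots> \<in> \<int>" using DA[OF pj b] by (intro Ints_sum) auto
      finally show "real D * (tot p b - vec c b) \<in> \<int>"
        unfolding right_diff_distrib by (intro Ints_diff Dvec b)
    qed
    also have "\<dots> = of_real (G * N (vec c))"
      using finP by (simp add: sum.inter_filter[symmetric] N_def mult.commute)
    finally have eq: "(\<Sum>\<xi>\<in>\<Xi>. coef s \<xi> ^ L * cnj (chi \<xi> (vec c))) = of_real (G * N (vec c))" .
    have "(\<Sum>\<xi>\<in>\<Xi>. coef s \<xi> ^ L * cnj (chi \<xi> (vec c))) =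
        (\<Sum>\<xi>\<in>H. coef s \<xi> ^ L * cnj (chi \<xi> (vec c))) + (\<Sum>\<xi>\<in>\<Xi> - H. coef s \<xi> ^ L * cnj (chi \<xi> (vec c)))"
      using sum.subset_diff[of H \<Xi>] fin\<Xi> by (simp add: H_def add.commute)
    also have "(\<Sum>\<xi>\<in>H. coef s \<xi> ^ L * cnj (chi \<xi> (vec c))) = of_real (real (card H) * a ^ L)"
      by (simp add: HA H1)
    finally have "of_real (G * N (vec c) - real (card H) * a ^ L) =
        (\<Sum>\<xi>\<in>\<Xi> - H. coef s \<xi> ^ L * cnj (chi \<xi> (vec c)))" unfolding eq by simp
    then have "\<bar>G * N (vec c) - real (card H) * a ^ L\<bar> =
        norm (\<Sum>\<xi>\<in>\<Xi> - H. coef s \<xi> ^ L * cnj (chi \<xi> (vec c)))" by (metis norm_of_real)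
    also have "\<dots> \<le> (\<Sum>\<xi>\<in>\<Xi> - H. norm (coef s \<xi>) ^ L)"
      by (rule order_trans[OF norm_sum]) (simp add: norm_mult norm_power norm_chi)
    also have "\<dots> \<le> (\<Sum>\<xi>\<in>\<Xi> - H. (\<beta> * a) ^ (L - 2) * (norm (coef s \<xi>))\<^sup>2)"
    proof (rule sum_mono)
      fix \<xi> assume "\<xi> \<in> \<Xi> - H"
      from power_mono[OF small[OF this], of "L - 2"]
      have "norm (coef s \<xi>) ^ (L - 2) * (norm (coef s \<xi>))\<^sup>2 \<le> (\<beta> * a) ^ (L - 2) * (norm (coef s \<xi>))\<^sup>2"
        by (intro mult_right_mono) auto
      then show "norm (coef s \<xi>) ^ L \<le> (\<beta> * a) ^ (L - 2) * (norm (coef s \<xi>))\<^sup>2"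
        using L by (simp only: power_add[symmetric] le_add_diff_inverse2)
    qed
    also have "\<dots> \<le> (\<Sum>\<xi>\<in>\<Xi>. (\<beta> * a) ^ (L - 2) * (norm (coef s \<xi>))\<^sup>2)"
      using \<beta> a1 by (intro sum_mono2 fin\<Xi>) auto
    also have "\<dots> = E" by (simp add: sum_distrib_left[symmetric] parseval E_def)
    finally show ?thesis .
  qed
  have hit: "\<exists>c'. l1 X c' \<le> int (L * s) \<and> (\<forall>b\<in>B. tot p b - vec c' b \<in> \<int>)" if p: "p \<in> P" for p
  proof -
    have "\<forall>j<L. \<exists>c. l1 X c \<le> int s \<and> p j = red (vec c)"
    proof (intro allI impI)
      fix j assume "j < L"
      then have "p j \<in> A s" using p unfolding P_def by auto
      then show "\<exists>c. l1 X c \<le> int s \<and> p j = red (vec c)" unfolding A_def by blast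
    qed
    then obtain C where C: "\<And>j. j < L \<Longrightarrow> l1 X (C j) \<le> int s" "\<And>j. j < L \<Longrightarrow> p j = red (vec (C j))" by metis
    define c' where "c' x = (\<Sum>j<L. C j x)" for x
    have "l1 X c' \<le> (\<Sum>x\<in>X. \<Sum>j<L. \<bar>C j x\<bar>)" unfolding l1_def c'_def by (intro sum_mono sum_abs)
    also have "\<dots> = (\<Sum>j<L. l1 X (C j))" unfolding l1_def by (rule sum.swap)
    also have "\<dots> \<le> (\<Sum>j<L. int s)" using C(1) by (intro sum_mono) auto
    finally have l: "l1 X c' \<le> int (L * s)" by simp
    have v: "vec c' b = (\<Sum>j<L. vec (C j) b)" for b
      unfolding vec_def wval_def c'_def by (subst sum.swap) (simp add: sum_distrib_right)
    have "tot p b - vec c' b \<in> \<int>" if b: "b \<in> B" for b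
    proof -
      have "tot p b - vec c' b = (\<Sum>j<L. p j b - vec (C j) b)" by (simp add: tot_def v sum_subtractf)
      also have "\<dots> = (\<Sum>j<L. of_int (- \<lfloor>vec (C j) b\<rfloor>))"
        using C(2) b by (intro sum.cong) (auto simp: red_def frac_def)
      also have "\<dots> \<in> \<int>" by (intro Ints_sum Ints_of_int)
      finally show ?thesis .
    qed
    then show ?thesis using l by blast
  qed
  have "N (vec c) = 0"
  proof -
    have "{p\<in>P. \<forall>b\<in>B. tot p b - vec c b \<in> \<int>} = {}"
    proof (rule ccontr)
      assume "\<not> ?thesis"
      then obtain p where p: "p \<in> P" "\<forall>b\<in>B. tot p b - vec c b \<in> \<int>" by blast
      obtain c' where c': "l1 X c' \<le> int (L * s)" "\<forall>b\<in>B. tot p b - vec c' b \<in> \<int>" using hit[OF p(1)] by blast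
      have "vec c b - vec c' b \<in> \<int>" if "b \<in> B" for b
      proof -
        have "vec c b - vec c' b = (tot p b - vec c' b) - (tot p b - vec c b)" by simp
        then show ?thesis using Ints_diff[of "tot p b - vec c' b" "tot p b - vec c b"] p(2) c'(2) that by metis
      qed
      then show False using none c'(1) by blast
    qed
    then show ?thesis by (simp only: N_def card.empty of_nat_0)
  qed
  then have "real (card H) * a ^ L \<le> E" using count[of c] by simp
  then have N2: "G * N (vec c') \<le> 2 * E" for c' using count[of c'] by linarith
  define Z where "Z = A (L * s)"
  have Z: "finite Z" "real (card Z) \<le> Y" using A_card[OF T(2)] Y(1) by (auto simp: Z_def)
  have NZ: "G * N z \<le> 2 * E" if z: "z \<in> Z" for z
  proof -
    obtain c' where c': "z = red (vec c')" using z by (auto simp: Z_def A_def)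
    have "(\<forall>b\<in>B. tot p b - z b \<in> \<int>) = (\<forall>b\<in>B. tot p b - vec c' b \<in> \<int>)" for p
      using red_eq_iff[of "tot p" z] red_eq_iff[of "tot p" "vec c'"] by (simp add: c' red_red)
    then have "N z = N (vec c')" by (simp add: N_def)
    then show ?thesis using N2 by simp
  qed
  \<comment> \<open>All a^L tuples are shared among the at most \<open>Y\<close> classes of
    \<open>Z\<close>, none of which receives more than \<open>2 * E / G\<close>.\<close>
  have "P \<subseteq> (\<Union>z\<in>Z. {p\<in>P. \<forall>b\<in>B. tot p b - z b \<in> \<int>})"
  proof
    fix p assume p: "p \<in> P"
    obtain c' where c': "l1 X c' \<le> int (L * s)" "\<forall>b\<in>B. tot p b - vec c' b \<in> \<int>" using hit[OF p] by blast
    have "red (vec c') \<in> Z" using c'(1) by (auto simp: Z_def A_def)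
    moreover have "\<forall>b\<in>B. tot p b - red (vec c') b \<in> \<int>"
      using c'(2) red_eq_iff[of "tot p" "red (vec c')"] red_eq_iff[of "tot p" "vec c'"] by (simp add: red_red)
    ultimately show "p \<in> (\<Union>z\<in>Z. {p\<in>P. \<forall>b\<in>B. tot p b - z b \<in> \<int>})" using p by blast
  qed
  then have "card P \<le> card (\<Union>z\<in>Z. {p\<in>P. \<forall>b\<in>B. tot p b - z b \<in> \<int>})"
    using finP Z(1) by (intro card_mono finite_UN_I) auto
  also have "\<dots> \<le> (\<Sum>z\<in>Z. card {p\<in>P. \<forall>b\<in>B. tot p b - z b \<in> \<int>})" by (rule card_UN_le[OF Z(1)])
  finally have "a ^ L \<le> (\<Sum>z\<in>Z. N z)" unfolding cardP[symmetric] N_def of_nat_sum[symmetric] by (rule of_nat_mono)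
  then have "G * a ^ L \<le> (\<Sum>z\<in>Z. G * N z)" using G by (simp add: sum_distrib_left[symmetric])
  also have "\<dots> \<le> (\<Sum>z\<in>Z. 2 * E)" by (rule sum_mono) (rule NZ)
  also have "\<dots> \<le> Y * (2 * E)" using Z(2) \<beta> a1 G by (simp add: E_def mult_right_mono)
  also have "\<dots> = (2 * Y * \<beta> ^ (L - 2)) * (G * (a ^ (L - 2) * a))" by (simp add: E_def power_mult_distrib)
  also have "\<dots> < 1 * (G * (a ^ (L - 2) * a))" using Y(2) G a1 by (intro mult_strict_right_mono) auto
  also have "\<dots> \<le> G * a ^ L"
  proof -
    have "a ^ (L - 2) * a = a ^ (L - 1)" using L by (metis Suc_diff_Suc Suc_le_lessD numeral_2_eq_2 power_Suc2 diff_Suc_1 One_nat_def)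
    also have "\<dots> \<le> a ^ L" using a1 by (intro power_increasing) auto
    finally show ?thesis using G by simp
  qed
  finally show False by simp
qed

end

section \<open>The long-range inverse theorem\<close>

lemma rel_funs_cong:
  assumes "\<And>x. x \<in> X \<Longrightarrow> f x = g x" "g \<in> rel_funs X t"
  shows "f \<in> rel_funs X t"
proof -
  have "wval X c f = wval X c g" for c unfolding wval_def using assms(1) by (intro sum.cong) auto
  then show ?thesis using assms by (auto simp: rel_funs_def)
qed

lemma dual_system_mono: "dual_system X W B F \<Longrightarrow> W \<subseteq> W' \<Longrightarrow> dual_system X W' B F"
  unfolding dual_system_def by blast

text \<open>Growth by a factor above \<open>1 + \<epsilon>\<close> at each of the \<open>S\<close>
  steps would accumulate to \<open>(1 + \<epsilon>) ^ S\<close>. A step without it yields a set of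
  classes that is almost invariant under every letter.\<close>

lemma exists_slow_growth:
  fixes f :: "nat \<Rightarrow> real"
  assumes "f S \<ge> 1" "f (2 * S) < (1 + \<epsilon>) ^ S" "\<epsilon> \<ge> 0"
  shows "\<exists>s. S \<le> s \<and> s < 2 * S \<and> f (s + 1) \<le> (1 + \<epsilon>) * f s"
proof (rule ccontr)
  assume none: "\<not> ?thesis"
  have "(1 + \<epsilon>) ^ i \<le> f (S + i)" if "i \<le> S" for i
    using that
  proof (induction i)
    case 0
    then show ?case using assms(1) by simp
  next
    case (Suc i)
    have "f (S + i + 1) > (1 + \<epsilon>) * f (S + i)"
    proof (rule ccontr)
      assume "\<not> ?thesis"
      then have "S \<le> S + i \<and> S + i < 2 * S \<and> f (S + i + 1) \<le> (1 + \<epsilon>) * f (S + i)" using Suc.prems by simp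
      then show False using none by blast
    qed
    moreover have "(1 + \<epsilon>) * (1 + \<epsilon>) ^ i \<le> (1 + \<epsilon>) * f (S + i)"
      using Suc assms(3) by (intro mult_left_mono) auto
    ultimately show ?case by simp
  qed
  from this[of S] assms(2) show False by (simp add: mult_2)
qed

lemma one_plus_inverse_power_ge:
  assumes "n > 0"
  shows "(2::real) ^ q \<le> (1 + 1 / real n) ^ (n * q)"
proof -
  have "-1 \<le> 1 / real n" by (rule order_trans[of _ 0]) auto
  from Bernoulli_inequality[OF this, of n] have "2 \<le> (1 + 1 / real n) ^ n" using assms by simp
  then have "2 ^ q \<le> ((1 + 1 / real n) ^ n) ^ q" by (intro power_mono) auto
  then show ?thesis by (simp add: power_mult)
qed

text \<open>Among the \<open>R + 1\<close> scales \<open>q ^ (a + 4 j)\<close> two consecutive ones must have the same universal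
  ambient group, for otherwise the chain of strict inclusions yields \<open>R\<close> independent directions,
  too many for the size of the sumset.\<close>
lemma stable_scale:
  fixes X :: "int set"
  assumes X: "finite X" and card: "card (ksum X k) \<le> q ^ G" and k: "q ^ (a + 4 * R) \<le> k"
    and R: "G < R * (a - 1)" "R \<le> q" and q: "q \<ge> 2" "4 * (G + 3) \<le> q\<^sup>2" "q ^ G < 2 ^ q"
  shows "\<exists>B F l. B \<subseteq> X \<and> card B < R \<and> l \<le> q ^ (a + 4 * R) \<and>
     (\<forall>b\<in>B. \<forall>b'\<in>B. F b b' = (if b = b' then 1 else 0)) \<and>
     (\<forall>b\<in>B. \<forall>x\<in>X. F b x \<in> \<rat> \<and> \<bar>F b x\<bar> \<le> fact R) \<and>
     (\<forall>x\<in>X. real_of_int x = (\<Sum>b\<in>B. of_int b * F b x)) \<and>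
     (\<forall>c. \<exists>c'. l1 X c' \<le> int l \<and> (\<forall>b\<in>B. wval X c (F b) - wval X c' (F b) \<in> \<int>))"
proof -
  define t where "t j = q ^ (a + 4 * j)" for j
  define W where "W j = rel_funs X (t j)" for j
  have a: "a \<ge> 1" using R(1) by (cases a) auto
  have tmono: "t i \<le> t j" if "i \<le> j" for i j
    unfolding t_def using q(1) that by (intro power_increasing) auto
  have tR: "t j \<le> q ^ (a + 4 * R)" if "j \<le> R" for j using tmono[OF that] by (simp add: t_def)
  have ks: "card (ksum X j) \<le> q ^ G" if "j \<le> k" for j
    using card_mono[OF finite_ksum[OF X] ksum_mono[OF that]] card by (rule order_trans)
  \<comment> \<open>Too many independent directions at the smallest scale would give more than q^G
    sums. Each direction uses length q^(a-1) instead of q^a, which leaves room for the factor R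
    \<le> q in the total length.\<close>
  have no: False if BF: "dual_system X (W 0) B F" "R \<le> card B" for B F
  proof -
    obtain B' where B': "B' \<subseteq> B" "card B' = R" by (rule obtain_subset_with_card_n[OF BF(2)]) blast
    have le: "R * q ^ (a - 1) \<le> t 0"
      using mult_right_mono[OF R(2), of "q ^ (a - 1)"] a by (simp add: t_def power_eq_if)
    have "(q ^ (a - 1) + 1) ^ R \<le> card (ksum X (R * q ^ (a - 1)))"
      using dual_system_card_bound[OF X dual_system_subset[OF BF(1)[unfolded W_def] B'(1)], of "q ^ (a - 1)"] le B'(2)
      by simp
    also have "\<dots> \<le> q ^ G" using le tR[of 0] k by (intro ks) simp
    also have "\<dots> < q ^ (R * (a - 1))" using R(1) q(1) by (intro power_strict_increasing) auto
    also have "\<dots> = (q ^ (a - 1)) ^ R" by (simp add: power_mult[symmetric] mult.commute)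
    also have "\<dots> \<le> (q ^ (a - 1) + 1) ^ R" by (intro power_mono) auto
    finally show False by simp
  qed
  have "\<exists>j<R. \<forall>f\<in>W j. \<exists>g\<in>W (Suc j). \<forall>x\<in>X. f x = g x"
  proof (rule ccontr)
    assume "\<not> ?thesis"
    then have strict: "\<exists>f\<in>W j. \<forall>g\<in>W (Suc j). \<exists>x\<in>X. f x \<noteq> g x" if "j < R" for j using that by blast
    have "\<exists>B F. dual_system X (W 0) B F \<and> card B = R"
    proof (rule dual_system_of_chain[where W = W and N = R, OF X _ _ strict])
      show "qspace X (W j)" for j unfolding W_def by (rule qspace_rel_funs)
      show "W (Suc j) \<subseteq> W j" for j unfolding W_def by (intro rel_funs_antimono tmono) simp
    qed
    then show False using no by blast
  qed
  then obtain j where j: "j < R" "\<And>f. f \<in> W j \<Longrightarrow> f \<in> W (Suc j)"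
    unfolding W_def using rel_funs_cong by metis
  obtain B F where BF: "dual_system X (W j) B F" and bd: "\<And>b x. b \<in> B \<Longrightarrow> x \<in> X \<Longrightarrow> \<bar>F b x\<bar> \<le> fact (card B)"
    and comp: "\<And>f x. f \<in> W j \<Longrightarrow> x \<in> X \<Longrightarrow> f x = (\<Sum>b\<in>B. f b * F b x)"
    using complete_dual_system[OF X qspace_rel_funs, of "t j"] unfolding W_def by blast
  have "W j \<subseteq> W 0" unfolding W_def by (intro rel_funs_antimono tmono) simp
  then have BR: "card B < R" using no[OF dual_system_mono[OF BF]] by (meson not_le)
  interpret word_classes X "t j" "t (Suc j)" B F
    using X BF comp j(2) dual_systemD(2)[OF BF] by unfold_locales (auto simp: W_def)
  have t0: "t j > 0" using q(1) by (simp add: t_def)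
  have tS: "t (Suc j) = t j * q ^ 4" by (simp add: t_def power_add)
  \<comment> \<open>\<open>S\<close> is t q times q: with \<epsilon> = 1/(t q), growth by 1 +
    \<epsilon> over \<open>S\<close> steps would reach 2^q, beyond q^G, while t \<epsilon> = 1/q is
    the \<beta> of \<open>sumset_covers\<close>. The remaining factor q^2 up to the next scale pays
    for \<open>4 * L\<close>.\<close>
  define S where "S = t j * q\<^sup>2"
  \<comment> \<open>L - 2 = G + 1 turns the condition of \<open>sumset_covers\<close> into 2 / q <
    1.\<close>
  define L where "L = G + 3"
  have S4: "4 * (L * S) \<le> t (Suc j)" and LS: "S \<le> L * S"
  proof -
    show "S \<le> L * S" by (simp add: L_def)
    have "4 * (L * S) \<le> q\<^sup>2 * S" unfolding mult.assoc[symmetric]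
      using q(2) unfolding L_def by (intro mult_right_mono) auto
    also have "\<dots> = t (Suc j)" by (simp add: S_def tS power4_eq_xxxx power2_eq_square)
    finally show "4 * (L * S) \<le> t (Suc j)" .
  qed
  have tk: "t (Suc j) \<le> k" using tR[of "Suc j"] j(1) k by simp
  define \<epsilon> where "\<epsilon> = 1 / real (t j * q)"
  have "\<exists>s. S \<le> s \<and> s < 2 * S \<and> real (card (A (s + 1))) \<le> (1 + \<epsilon>) * real (card (A s))"
  proof (rule exists_slow_growth)
    have fin: "finite (A S)" using S4 LS by (intro A_card(1)) linarith
    show "1 \<le> real (card (A S))" using A_nonempty[of S] fin by (simp add: Suc_le_eq card_gt_0_iff)
    have "card (A (2 * S)) \<le> card (ksum X (2 * S))" using S4 LS by (intro A_card(2)) linarith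
    also have "\<dots> \<le> q ^ G" using S4 LS tk by (intro ks) linarith
    also have "\<dots> < 2 ^ q" by (rule q(3))
    finally have "real (card (A (2 * S))) < real (2 ^ q)" by (simp only: of_nat_less_iff)
    also have "real (2 ^ q) = 2 ^ q" by simp
    also have "(2::real) ^ q \<le> (1 + \<epsilon>) ^ S"
      using one_plus_inverse_power_ge[of "t j * q" q] t0 q(1)
      by (simp add: \<epsilon>_def S_def power2_eq_square mult.assoc)
    finally show "real (card (A (2 * S))) < (1 + \<epsilon>) ^ S" .
  qed (simp add: \<epsilon>_def)
  then obtain s where s: "S \<le> s" "s < 2 * S" "real (card (A (s + 1))) \<le> (1 + \<epsilon>) * real (card (A s))" by blast
  have Ls: "2 * (L * s) \<le> t (Suc j)"
  proof -
    have "L * s \<le> L * (2 * S)" using s(2) by (intro mult_left_mono) auto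
    then show ?thesis using S4 by linarith
  qed
  have s1: "2 * (s + 1) \<le> t (Suc j)"
  proof -
    have "2 * (s + 1) \<le> 4 * S" using s(2) by simp
    also have "\<dots> \<le> 4 * (L * S)" by (rule mult_le_mono2[OF LS])
    finally show ?thesis using S4 by (rule order_trans)
  qed
  have cover: "\<exists>c'. l1 X c' \<le> int (L * s) \<and> (\<forall>b\<in>B. vec c b - vec c' b \<in> \<int>)" for c
  proof (rule sumset_covers[where \<beta> = "1 / real q" and \<epsilon> = \<epsilon> and Y = "real (q ^ G)"])
    show "2 * (s + 1) \<le> t (Suc j)" by (rule s1)
    show "2 * (L * s) \<le> t (Suc j)" by (rule Ls)
    show "real (card (A (s + 1))) - real (card (A s)) \<le> \<epsilon> * real (card (A s))"
      using s(3) by (simp add: algebra_simps)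
    show "real (t j) * \<epsilon> \<le> 1 / real q" using t0 q(1) by (simp add: \<epsilon>_def)
    show "real (card (ksum X (L * s))) \<le> real (q ^ G)" using Ls tk by (intro of_nat_mono ks) simp
    have "q > 2" using q(2) by (rule contrapos_pp) (auto simp: not_less le_Suc_eq numeral_2_eq_2)
    then show "2 * real (q ^ G) * (1 / real q) ^ (L - 2) < 1"
      by (simp add: L_def power_divide field_simps)
  qed (use q(1) in \<open>auto simp: L_def\<close>)
  show ?thesis
  proof (intro exI[of _ B] exI[of _ F] exI[of _ "L * s"] conjI ballI allI)
    show "B \<subseteq> X" by (rule dual_systemD(1)[OF BF])
    show "card B < R" by (rule BR)
    show "L * s \<le> q ^ (a + 4 * R)" using Ls tR[of "Suc j"] j(1) by simp
    show "F b b' = (if b = b' then 1 else 0)" if "b \<in> B" "b' \<in> B" for b b'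
      by (rule dual_systemD(3)[OF BF that])
    show "F b x \<in> \<rat>" if "b \<in> B" "x \<in> X" for b x
      using dual_systemD(2)[OF BF that(1)] that(2) by (auto simp: W_def rel_funs_def)
    show "\<bar>F b x\<bar> \<le> fact R" if "b \<in> B" "x \<in> X" for b x
    proof -
      have "(fact (card B) :: real) \<le> fact R" using BR by (intro fact_mono) auto
      then show ?thesis using bd[OF that] by linarith
    qed
    show "real_of_int x = (\<Sum>b\<in>B. of_int b * F b x)" if "x \<in> X" for x
      using comp[of real_of_int x] of_int_in_rel_funs that by (simp add: W_def)
    show "\<exists>c'. l1 X c' \<le> int (L * s) \<and> (\<forall>b\<in>B. wval X c (F b) - wval X c' (F b) \<in> \<int>)" for c
      using cover[of c] by (simp add: vec_def)
  qed
qed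

lemma lattice_gap_uniform:
  "\<exists>C\<ge>1. \<forall>(I::'i set) \<Lambda> y s k. finite I \<longrightarrow> card I < R \<longrightarrow> lattice_on I \<Lambda> \<longrightarrow> s > 0 \<longrightarrow> k \<ge> 1 \<longrightarrow>
     (\<exists>d\<le>card I. \<exists>Q. proper_symmetric_gap d Q \<and> wsum I y ` (\<Lambda> \<inter> cube I s) \<subseteq> Q \<and>
        real (card Q) * k ^ d \<le> C * real (card (wsum I y ` (\<Lambda> \<inter> cube I (C * k * s)))))"
proof -
  have "\<exists>C. \<forall>r. C r \<ge> 1 \<and> (\<forall>(I::'i set) \<Lambda> y s k. finite I \<longrightarrow> card I = r \<longrightarrow> lattice_on I \<Lambda> \<longrightarrow> s > 0 \<longrightarrow> k \<ge> 1 \<longrightarrow>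
     (\<exists>d\<le>r. \<exists>Q. proper_symmetric_gap d Q \<and> wsum I y ` (\<Lambda> \<inter> cube I s) \<subseteq> Q \<and>
        real (card Q) * k ^ d \<le> C r * real (card (wsum I y ` (\<Lambda> \<inter> cube I (C r * k * s))))))"
    by (rule choice) (intro allI lattice_gap)
  then obtain C where CC: "\<forall>r. C r \<ge> 1 \<and> (\<forall>(I::'i set) \<Lambda> y s k. finite I \<longrightarrow> card I = r \<longrightarrow> lattice_on I \<Lambda> \<longrightarrow> s > 0 \<longrightarrow> k \<ge> 1 \<longrightarrow>
     (\<exists>d\<le>r. \<exists>Q. proper_symmetric_gap d Q \<and> wsum I y ` (\<Lambda> \<inter> cube I s) \<subseteq> Q \<and>
        real (card Q) * k ^ d \<le> C r * real (card (wsum I y ` (\<Lambda> \<inter> cube I (C r * k * s))))))" by (rule exE)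
  have C: "C r \<ge> (1::real)" for r using CC[THEN spec, of r] by (rule conjunct1)
  have gap: "\<exists>d\<le>card I. \<exists>Q. proper_symmetric_gap d Q \<and> wsum I y ` (\<Lambda> \<inter> cube I s) \<subseteq> Q \<and>
        real (card Q) * k ^ d \<le> C (card I) * real (card (wsum I y ` (\<Lambda> \<inter> cube I (C (card I) * k * s))))"
    if "finite I" "lattice_on I \<Lambda>" "s > 0" "k \<ge> 1" for I :: "'i set" and \<Lambda> y s k
    using CC[THEN spec, of "card I", THEN conjunct2, rule_format, OF that(1) refl that(2-4)] .
  define D where "D = 1 + (\<Sum>r<R. C r)"
  have CD: "C r \<le> D" if "r < R" for r
  proof -
    have "C r \<le> (\<Sum>r<R. C r)"
      by (rule member_le_sum) (use that order_trans[OF zero_le_one C] in auto)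
    then show ?thesis by (simp add: D_def)
  qed
  have D1: "D \<ge> 1" using sum_nonneg[of "{..<R}" C] order_trans[OF zero_le_one C] by (simp add: D_def)
  show ?thesis
  proof (intro exI[of _ D] conjI allI impI D1)
    fix I :: "'i set" and \<Lambda> and y :: "'i \<Rightarrow> real" and s k :: real
    assume I: "finite I" "card I < R" and L: "lattice_on I \<Lambda>" and s: "0 < s" and k: "1 \<le> k"
    obtain d Q where Q: "d \<le> card I" "proper_symmetric_gap d Q" "wsum I y ` (\<Lambda> \<inter> cube I s) \<subseteq> Q"
      "real (card Q) * k ^ d \<le> C (card I) * real (card (wsum I y ` (\<Lambda> \<inter> cube I (C (card I) * k * s))))"
      using gap[OF I(1) L s k] by blast
    have "C (card I) * k * s \<le> D * k * s" using CD[OF I(2)] k s by (intro mult_right_mono) auto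
    then have "wsum I y ` (\<Lambda> \<inter> cube I (C (card I) * k * s)) \<subseteq> wsum I y ` (\<Lambda> \<inter> cube I (D * k * s))"
      using cube_mono by blast
    then have "card (wsum I y ` (\<Lambda> \<inter> cube I (C (card I) * k * s))) \<le> card (wsum I y ` (\<Lambda> \<inter> cube I (D * k * s)))"
      by (intro card_mono finite_imageI lattice_on_finite[OF L])
    then have "C (card I) * real (card (wsum I y ` (\<Lambda> \<inter> cube I (C (card I) * k * s))))
        \<le> D * real (card (wsum I y ` (\<Lambda> \<inter> cube I (D * k * s))))"
      using CD[OF I(2)] D1 by (intro mult_mono) auto
    then show "\<exists>d\<le>card I. \<exists>Q. proper_symmetric_gap d Q \<and> wsum I y ` (\<Lambda> \<inter> cube I s) \<subseteq> Q \<and>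
        real (card Q) * k ^ d \<le> D * real (card (wsum I y ` (\<Lambda> \<inter> cube I (D * k * s))))"
      using Q order_trans[OF Q(4)] by (intro exI[of _ d] conjI exI[of _ Q]) auto
  qed
qed

text \<open>For a complete dual system \<open>F\<close> of \<open>rel_funs X t\<close>, this is the
  universal ambient group of order \<open>t\<close> modulo torsion, in the coordinates dual to
  \<open>B\<close>.\<close>

definition word_lattice :: "int set \<Rightarrow> int set \<Rightarrow> (int \<Rightarrow> int \<Rightarrow> real) \<Rightarrow> (int \<Rightarrow> real) set" where
  "word_lattice X B F = range (\<lambda>c b. if b \<in> B then wval X c (F b) else 0)"

lemma word_latticeI: "(\<lambda>b. if b \<in> B then wval X c (F b) else 0) \<in> word_lattice X B F"
  by (auto simp: word_lattice_def)

lemma lattice_on_word_lattice: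
  assumes X: "finite X" and B: "finite B" and rat: "\<And>b x. b \<in> B \<Longrightarrow> x \<in> X \<Longrightarrow> F b x \<in> \<rat>"
  shows "lattice_on B (word_lattice X B F)"
  unfolding lattice_on_def
proof (intro conjI ballI allI impI)
  have "(\<lambda>b. 0) = (\<lambda>b. if b \<in> B then wval X (\<lambda>_. 0) (F b) else 0)" by (auto simp: wval_def)
  then show "(\<lambda>b. 0) \<in> word_lattice X B F" by (metis word_latticeI)
next
  fix u w assume "u \<in> word_lattice X B F" "w \<in> word_lattice X B F"
  then obtain c c' where c: "u = (\<lambda>b. if b \<in> B then wval X c (F b) else 0)"
    "w = (\<lambda>b. if b \<in> B then wval X c' (F b) else 0)" unfolding word_lattice_def by blast
  have "(\<lambda>b. u b - w b) = (\<lambda>b. if b \<in> B then wval X (\<lambda>x. c x - c' x) (F b) else 0)"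
    unfolding c by (auto simp: wval_diff)
  then show "(\<lambda>b. u b - w b) \<in> word_lattice X B F" by (metis word_latticeI)
next
  fix w b assume "w \<in> word_lattice X B F" "b \<notin> B"
  then show "w b = 0" by (auto simp: word_lattice_def)
next
  fix s :: real
  have "\<exists>D>0. \<forall>z\<in>B \<times> X. real D * F (fst z) (snd z) \<in> \<int>"
    using X B rat by (intro common_denominator) auto
  then obtain D where D: "D > 0" "\<And>b x. b \<in> B \<Longrightarrow> x \<in> X \<Longrightarrow> real D * F b x \<in> \<int>" by fastforce
  define V where "V = (\<lambda>i. of_int i / real D) ` {- \<lceil>real D * s\<rceil>..\<lceil>real D * s\<rceil>}"
  define ext where "ext p = (\<lambda>b. if b \<in> B then p b else (0::real))" for p :: "int \<Rightarrow> real"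
  have "word_lattice X B F \<inter> cube B s \<subseteq> ext ` (\<Pi>\<^sub>E b\<in>B. V)"
  proof
    fix w assume w: "w \<in> word_lattice X B F \<inter> cube B s"
    then obtain c where c: "w = (\<lambda>b. if b \<in> B then wval X c (F b) else 0)" by (auto simp: word_lattice_def)
    have wV: "w b \<in> V" if b: "b \<in> B" for b
    proof -
      have "real D * w b = (\<Sum>x\<in>X. of_int (c x) * (real D * F b x))"
        using b by (simp add: c wval_def sum_distrib_left mult_ac)
      also have "\<dots> \<in> \<int>" by (intro Ints_sum Ints_mult[OF Ints_of_int] D(2) b)
      finally obtain i where i: "real D * w b = of_int i" by (rule Ints_cases)
      have "\<bar>of_int i\<bar> \<le> real D * s"
        using w b D(1) unfolding i[symmetric] by (simp add: cube_def abs_mult)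
      then have "i \<in> {- \<lceil>real D * s\<rceil>..\<lceil>real D * s\<rceil>}" by (auto simp: abs_le_iff) linarith+
      moreover have "w b = of_int i / real D" using i D(1) by (simp add: field_simps)
      ultimately show ?thesis unfolding V_def by blast
    qed
    have "w = ext (restrict w B)" by (auto simp: ext_def c)
    moreover have "restrict w B \<in> (\<Pi>\<^sub>E b\<in>B. V)" using wV by auto
    ultimately show "w \<in> ext ` (\<Pi>\<^sub>E b\<in>B. V)" by blast
  qed
  moreover have "finite (ext ` (\<Pi>\<^sub>E b\<in>B. V))" unfolding V_def using B by (intro finite_imageI finite_PiE) auto
  ultimately show "finite (word_lattice X B F \<inter> cube B s)" by (rule finite_subset)
qed

text \<open>A lattice point has the coordinates of a word of length at most \<open>l\<close> plus an
  integer vector, and an integer vector is a word in the letters of \<open>B\<close>. For a point of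
  the cube its entries are at most \<open>\<sigma> + real l * M\<close>, so the total length stays
  below \<open>k\<close>.\<close>

lemma wsum_word_lattice:
  assumes X: "finite X" and B: "finite B" "B \<subseteq> X"
    and cmp: "\<And>x. x \<in> X \<Longrightarrow> real_of_int x = (\<Sum>b\<in>B. of_int b * F b x)"
    and bd: "\<And>b x. b \<in> B \<Longrightarrow> x \<in> X \<Longrightarrow> \<bar>F b x\<bar> \<le> M"
    and cover: "\<And>c. \<exists>c'. l1 X c' \<le> int l \<and> (\<forall>b\<in>B. wval X c (F b) - wval X c' (F b) \<in> \<int>)"
    and k: "real l + real (card B) * (\<sigma> + real l * M) \<le> real k" and M: "M \<ge> 0"
  shows "wsum B (\<lambda>b. \<eta> * of_int b) ` (word_lattice X B F \<inter> cube B \<sigma>) \<subseteq> (\<lambda>z. \<eta> * of_int z) ` ksum X k"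
proof
  fix q assume "q \<in> wsum B (\<lambda>b. \<eta> * of_int b) ` (word_lattice X B F \<inter> cube B \<sigma>)"
  then obtain c where q: "q = wsum B (\<lambda>b. \<eta> * of_int b) (\<lambda>b. if b \<in> B then wval X c (F b) else 0)"
    and cs: "\<And>b. b \<in> B \<Longrightarrow> \<bar>wval X c (F b)\<bar> \<le> \<sigma>" by (auto simp: word_lattice_def cube_def)
  obtain c' where c': "l1 X c' \<le> int l" "\<And>b. b \<in> B \<Longrightarrow> wval X c (F b) - wval X c' (F b) \<in> \<int>"
    using cover by blast
  then have "\<exists>n. \<forall>b\<in>B. wval X c (F b) - wval X c' (F b) = of_int (n b)"
    by (intro bchoice ballI) (auto elim: Ints_cases)
  then obtain n where n: "\<And>b. b \<in> B \<Longrightarrow> wval X c (F b) - wval X c' (F b) = of_int (n b)" by blast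
  \<comment> \<open>The integer vector \<open>n\<close>, read as a word whose letters lie in
    \<open>B\<close>.\<close>
  define e where "e x = (if x \<in> B then n x else 0)" for x
  have "(\<Sum>b\<in>B. of_int b * wval X c' (F b)) = (\<Sum>x\<in>X. of_int (c' x) * (\<Sum>b\<in>B. of_int b * F b x))"
    unfolding wval_def sum_distrib_left by (subst sum.swap) (simp add: mult_ac)
  also have "\<dots> = (\<Sum>x\<in>X. of_int (c' x) * of_int x)" using cmp by simp
  finally have v: "(\<Sum>b\<in>B. of_int b * wval X c' (F b)) = of_int (ival X c')" by (simp add: ival_def)
  have e: "ival X e = (\<Sum>b\<in>B. n b * b)"
    unfolding ival_def e_def using X B by (intro sum.mono_neutral_cong_right) auto
  have "q = \<eta> * (\<Sum>b\<in>B. of_int b * wval X c (F b))"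
    unfolding q wsum_def by (simp add: sum_distrib_left mult.assoc)
  also have "(\<Sum>b\<in>B. of_int b * wval X c (F b)) = (\<Sum>b\<in>B. of_int b * wval X c' (F b) + of_int (n b * b))"
  proof (rule sum.cong[OF refl])
    fix b assume "b \<in> B"
    from n[OF this] have "wval X c (F b) = wval X c' (F b) + of_int (n b)" by linarith
    then show "of_int b * wval X c (F b) = of_int b * wval X c' (F b) + of_int (n b * b)"
      by (simp add: algebra_simps)
  qed
  also have "\<dots> = of_int (ival X (\<lambda>x. c' x + e x))" by (simp add: sum.distrib v e ival_add)
  finally have "q = \<eta> * of_int (ival X (\<lambda>x. c' x + e x))" .
  moreover have "l1 X (\<lambda>x. c' x + e x) \<le> int k"
  proof -
    have "real_of_int (l1 X e) = (\<Sum>b\<in>B. \<bar>of_int (n b)\<bar>)"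
      unfolding l1_def e_def of_int_sum using X B by (intro sum.mono_neutral_cong_right) auto
    also have "\<dots> \<le> (\<Sum>b\<in>B. \<sigma> + real l * M)"
    proof (rule sum_mono)
      fix b assume b: "b \<in> B"
      have "\<bar>wval X c' (F b)\<bar> \<le> of_int (l1 X c') * M" using bd[OF b] by (rule wval_bound)
      also have "\<dots> \<le> real l * M" using c'(1) M by (intro mult_right_mono) auto
      finally show "\<bar>of_int (n b)\<bar> \<le> \<sigma> + real l * M" using cs[OF b] n[OF b] by linarith
    qed
    also have "\<dots> = real (card B) * (\<sigma> + real l * M)" by simp
    finally have "real_of_int (l1 X e) \<le> real (card B) * (\<sigma> + real l * M)" .
    moreover have "real_of_int (l1 X (\<lambda>x. c' x + e x)) \<le> of_int (l1 X c') + of_int (l1 X e)"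
      using l1_add[of X c' e] by linarith
    moreover have "real_of_int (l1 X c') \<le> real l" using c'(1) by linarith
    ultimately have "real_of_int (l1 X (\<lambda>x. c' x + e x)) \<le> real k" using k by linarith
    then show ?thesis by linarith
  qed
  ultimately show "q \<in> (\<lambda>z. \<eta> * of_int z) ` ksum X k" unfolding ksum_def by blast
qed

text \<open>An integer M-th root of \<open>k\<close>; it supplies the base q for the scales of
  \<open>stable_scale\<close>.\<close>

lemma exists_power_bracket:
  fixes k Q M :: nat
  assumes "Q ^ M \<le> k" "M \<ge> 1"
  shows "\<exists>q\<ge>Q. q ^ M \<le> k \<and> k < (q + 1) ^ M"
proof -
  define q where "q = (LEAST q. k < (q + 1) ^ M)"
  have "k + 1 \<le> (k + 1) ^ M" using assms(2) by (metis le_add2 self_le_power zero_less_one le_eq_less_or_eq less_le_trans)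
  then have bound: "k < (k + 1) ^ M" by linarith
  have q1: "k < (q + 1) ^ M" unfolding q_def by (rule LeastI[where P = "\<lambda>q. k < (q + 1) ^ M", OF bound])
  have "Q \<le> q"
  proof (rule ccontr)
    assume "\<not> ?thesis"
    then have "(q + 1) ^ M \<le> Q ^ M" by (intro power_mono) auto
    then show False using q1 assms(1) by simp
  qed
  moreover have "q ^ M \<le> k"
  proof (cases q)
    case 0
    then show ?thesis using assms(2) by (simp add: power_0_left)
  next
    case (Suc p)
    then have "\<not> k < (p + 1) ^ M" using not_less_Least[of p "\<lambda>q. k < (q + 1) ^ M"] unfolding q_def by simp
    then show ?thesis using Suc by simp
  qed
  ultimately show ?thesis using q1 by blast
qed

text \<open>Letters have coordinates of size at most R!, so \<open>X\<close> sits in the cube of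
  radius \<open>Mf\<close>, while cubes larger by a factor of order k still take values in
  \<open>ksum X k\<close>. Applying \<open>lattice_gap_uniform\<close> to these two radii produces
  the saving k^d.\<close>

lemma long_range_inverse:
  "\<exists>R C k0. 0 < C \<and> (\<forall>k\<ge>k0. \<forall>X \<eta>. finite X \<longrightarrow> card (ksum X k) \<le> k ^ \<gamma> \<longrightarrow>
     (\<exists>d\<le>R. \<exists>Q. proper_symmetric_gap d Q \<and> (\<forall>x\<in>X. \<eta> * real_of_int x \<in> Q) \<and>
        real (card Q) * real k ^ d \<le> C * real (card (ksum X k))))"
proof -
  \<comment> \<open>From k < (q + 1)^M \<le> q^(2M) the sumset has at most q^G elements with G = 2 M
    \<gamma>, whereas R directions give q^(R(a-1)). Taking R = 2 \<gamma> + 1 leaves a surplus of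
    one a on the side of the directions, and the quadratic choice of \<open>a\<close> makes it
    exceed the other terms.\<close>
  define R where "R = 2 * \<gamma> + 1"
  define a where "a = 16 * \<gamma>\<^sup>2 + 20 * \<gamma> + 10"
  \<comment> \<open>The summand 1 leaves a factor q between the bound on the word length
    \<open>l\<close> and \<open>k\<close>; it absorbs \<open>1 + real R * Mf\<close>.\<close>
  define M where "M = a + 4 * R + 1"
  define G where "G = 2 * M * \<gamma>"
  have GR: "G < R * (a - 1)"
    unfolding G_def M_def R_def a_def by (simp add: algebra_simps power2_eq_square)
  define Mf where "Mf = (fact R :: real)"
  have Mf: "Mf \<ge> 1" unfolding Mf_def by (rule fact_ge_1)
  obtain Cg where Cg: "Cg \<ge> 1" and gap: "\<And>(I::int set) \<Lambda> y s k. finite I \<Longrightarrow> card I < R \<Longrightarrow> lattice_on I \<Lambda> \<Longrightarrow> s > 0 \<Longrightarrow> k \<ge> 1 \<Longrightarrow>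
     \<exists>d\<le>card I. \<exists>Q. proper_symmetric_gap d Q \<and> wsum I y ` (\<Lambda> \<inter> cube I s) \<subseteq> Q \<and>
        real (card Q) * k ^ d \<le> Cg * real (card (wsum I y ` (\<Lambda> \<inter> cube I (Cg * k * s))))"
    using lattice_gap_uniform[of R] by blast
  \<comment> \<open>With \<open>k1 = k / U\<close> the cube consumes half of the available length
    \<open>k\<close>; the other half is left for the words of length \<open>l\<close>.\<close>
  define U where "U = 2 * real R * Cg * Mf"
  have R1: "real R \<ge> 1" by (simp add: R_def)
  have U: "U \<ge> 1"
  proof -
    have "1 * 1 * 1 \<le> real R * Cg * Mf" using R1 Cg Mf by (intro mult_mono) auto
    then show ?thesis by (simp add: U_def)
  qed
  have "\<forall>\<^sub>F q in sequentially. q ^ G < (2::nat) ^ q"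
  proof -
    have "\<forall>\<^sub>F q in sequentially. real q ^ G < (2::real) ^ q" by real_asymp
    moreover have "q ^ G < (2::nat) ^ q" if "real q ^ G < (2::real) ^ q" for q
    proof -
      have "real (q ^ G) < real (2 ^ q)" using that by simp
      then show ?thesis by (simp only: of_nat_less_iff)
    qed
    ultimately show ?thesis by (rule eventually_mono)
  qed
  then obtain Q1 where Q1: "\<And>q. q \<ge> Q1 \<Longrightarrow> q ^ G < (2::nat) ^ q" by (auto simp: eventually_sequentially)
  define Q0 where "Q0 = Q1 + R + 4 * (G + 3) + 2 + nat \<lceil>2 * (1 + real R * Mf)\<rceil> + nat \<lceil>U\<rceil>"
  show ?thesis
  proof (rule exI[of _ R], rule exI[of _ "Cg * U ^ R"], rule exI[of _ "Q0 ^ M"], intro conjI allI impI)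
    show "0 < Cg * U ^ R" using Cg U by simp
    fix k :: nat and X :: "int set" and \<eta> :: real
    assume k: "Q0 ^ M \<le> k" and X: "finite X" and card: "card (ksum X k) \<le> k ^ \<gamma>"
    have "M \<ge> 1" by (simp add: M_def)
    obtain q where q: "q \<ge> Q0" "q ^ M \<le> k" "k < (q + 1) ^ M"
      using exists_power_bracket[OF k \<open>M \<ge> 1\<close>] by blast
    have q': "q \<ge> Q1" "q \<ge> R" "q \<ge> 4 * (G + 3)" "q \<ge> 2" "real q \<ge> 2 * (1 + real R * Mf)" "real q \<ge> U"
    proof -
      show "q \<ge> Q1" "q \<ge> R" "q \<ge> 4 * (G + 3)" "q \<ge> 2" using q(1) by (auto simp: Q0_def)
      have "nat \<lceil>2 * (1 + real R * Mf)\<rceil> \<le> q" "nat \<lceil>U\<rceil> \<le> q"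
        using q(1) unfolding Q0_def by linarith+
      then show "real q \<ge> 2 * (1 + real R * Mf)" "real q \<ge> U" by linarith+
    qed
    have qk: "q ^ (a + 4 * R) * q \<le> k" using q(2) by (simp add: M_def mult.commute)
    have c1: "card (ksum X k) \<le> q ^ G"
    proof -
      have "q + 1 \<le> 2 * q" using q'(4) by simp
      also have "\<dots> \<le> q\<^sup>2" unfolding power2_eq_square using q'(4) by (rule mult_le_mono1)
      finally have "q + 1 \<le> q\<^sup>2" .
      then have "(q + 1) ^ M \<le> (q\<^sup>2) ^ M" by (intro power_mono) auto
      then have "k \<le> q ^ (2 * M)" using q(3) by (simp add: power_mult)
      then have "k ^ \<gamma> \<le> (q ^ (2 * M)) ^ \<gamma>" by (intro power_mono) auto
      then show ?thesis using card by (simp add: G_def power_mult)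
    qed
    have c2: "q ^ (a + 4 * R) \<le> k"
      using qk q'(4) by (metis le_trans mult.right_neutral mult_le_mono2 one_le_numeral)
    have c3: "4 * (G + 3) \<le> q\<^sup>2"
    proof -
      have "q * 1 \<le> q * q" using q'(4) by (intro mult_le_mono2) simp
      then show ?thesis using q'(3) unfolding power2_eq_square by linarith
    qed
    obtain B F l where B: "B \<subseteq> X" "card B < R" and l: "l \<le> q ^ (a + 4 * R)"
      and F: "\<forall>b\<in>B. \<forall>x\<in>X. F b x \<in> \<rat> \<and> \<bar>F b x\<bar> \<le> fact R"
      and cmp: "\<forall>x\<in>X. real_of_int x = (\<Sum>b\<in>B. of_int b * F b x)"
      and cover: "\<forall>c. \<exists>c'. l1 X c' \<le> int l \<and> (\<forall>b\<in>B. wval X c (F b) - wval X c' (F b) \<in> \<int>)"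
      using stable_scale[OF X c1 c2 GR q'(2) q'(4) c3 Q1[OF q'(1)]] by blast
    have finB: "finite B" using B(1) X finite_subset by blast
    define \<Lambda> where "\<Lambda> = word_lattice X B F"
    have L: "lattice_on B \<Lambda>" unfolding \<Lambda>_def using F by (intro lattice_on_word_lattice X finB) auto
    define k1 where "k1 = real k / U"
    have k1: "k1 \<ge> 1"
    proof -
      have "1 * q \<le> q ^ (a + 4 * R) * q" using q'(4) by (intro mult_right_mono) auto
      then have "real q \<le> real k" using qk by linarith
      then show ?thesis using q'(6) U unfolding k1_def by simp
    qed
    obtain d Q where d: "d \<le> card B" and Q: "proper_symmetric_gap d Q"
      "wsum B (\<lambda>b. \<eta> * of_int b) ` (\<Lambda> \<inter> cube B Mf) \<subseteq> Q"
      "real (card Q) * k1 ^ d \<le> Cg * real (card (wsum B (\<lambda>b. \<eta> * of_int b) ` (\<Lambda> \<inter> cube B (Cg * k1 * Mf))))"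
      using gap[OF finB B(2) L, of Mf k1 "\<lambda>b. \<eta> * of_int b"] Mf k1 by auto
    have in_Q: "\<eta> * real_of_int x \<in> Q" if x: "x \<in> X" for x
    proof -
      define e where "e y = (if y = x then 1 else 0 :: int)" for y
      have ev: "wval X e f = f x" for f :: "int \<Rightarrow> real"
      proof -
        have "wval X e f = (\<Sum>y\<in>X. if y = x then f y else 0)" unfolding wval_def e_def by (intro sum.cong) auto
        then show ?thesis using x X by simp
      qed
      define w where "w = (\<lambda>b. if b \<in> B then wval X e (F b) else 0)"
      have "w \<in> \<Lambda>" unfolding \<Lambda>_def word_lattice_def w_def by blast
      moreover have "w \<in> cube B Mf" using F x by (auto simp: cube_def w_def ev Mf_def)
      moreover have "wsum B (\<lambda>b. \<eta> * of_int b) w = \<eta> * real_of_int x"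
        unfolding cmp[rule_format, OF x] wsum_def sum_distrib_left
        by (intro sum.cong) (auto simp: w_def ev)
      ultimately show ?thesis using Q(2) by (metis IntI image_subset_iff)
    qed
    have "wsum B (\<lambda>b. \<eta> * of_int b) ` (\<Lambda> \<inter> cube B (Cg * k1 * Mf)) \<subseteq> (\<lambda>z. \<eta> * of_int z) ` ksum X k"
      unfolding \<Lambda>_def
    proof (rule wsum_word_lattice[where M = Mf and l = l])
      have Bl: "real (card B) \<le> real R" using B(2) by simp
      have "real l * (1 + real R * Mf) \<le> real (q ^ (a + 4 * R)) * (real q / 2)"
        using l q'(5) Mf R1 by (intro mult_mono) auto
      also have "\<dots> = real (q ^ (a + 4 * R) * q) / 2" by simp
      also have "\<dots> \<le> real k / 2" using qk by (intro divide_right_mono of_nat_mono) auto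
      finally have h1: "real l * (1 + real R * Mf) \<le> real k / 2" .
      have "real R * (Cg * k1 * Mf) = real k / 2"
        using R1 Cg Mf unfolding k1_def U_def by (simp add: field_simps)
      then have "real l + real R * (Cg * k1 * Mf + real l * Mf) \<le> real k" using h1 by (simp add: algebra_simps)
      moreover have "real (card B) * (Cg * k1 * Mf + real l * Mf) \<le> real R * (Cg * k1 * Mf + real l * Mf)"
        using Bl Cg k1 Mf by (intro mult_right_mono) auto
      ultimately show "real l + real (card B) * (Cg * k1 * Mf + real l * Mf) \<le> real k" by linarith
    qed (use X finB B F cmp cover Mf in \<open>auto simp: Mf_def\<close>)
    then have "card (wsum B (\<lambda>b. \<eta> * of_int b) ` (\<Lambda> \<inter> cube B (Cg * k1 * Mf))) \<le> card (ksum X k)"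
      using finite_ksum[OF X] by (rule surj_card_le[rotated])
    then have "Cg * real (card (wsum B (\<lambda>b. \<eta> * of_int b) ` (\<Lambda> \<inter> cube B (Cg * k1 * Mf)))) \<le> Cg * real (card (ksum X k))"
      using Cg by (intro mult_left_mono) auto
    then have *: "real (card Q) * k1 ^ d \<le> Cg * real (card (ksum X k))" using Q(3) by (rule order_trans[rotated])
    have "real (card Q) * real k ^ d = real (card Q) * k1 ^ d * U ^ d"
      using U by (simp add: k1_def power_divide)
    also have "\<dots> \<le> Cg * real (card (ksum X k)) * U ^ R"
    proof (rule mult_mono[OF *])
      show "U ^ d \<le> U ^ R" using U d B(2) by (intro power_increasing) auto
    qed (use U Cg in auto)
    also have "\<dots> = Cg * U ^ R * real (card (ksum X k))" by simp
    finally show "\<exists>d\<le>R. \<exists>Q. proper_symmetric_gap d Q \<and> (\<forall>x\<in>X. \<eta> * real_of_int x \<in> Q) \<and>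
        real (card Q) * real k ^ d \<le> Cg * U ^ R * real (card (ksum X k))"
      using d B(2) Q(1) in_Q by (intro exI[of _ d] conjI exI[of _ Q]) auto
  qed
qed

section \<open>Random permutations\<close>

abbreviation perms :: "nat \<Rightarrow> (nat \<Rightarrow> nat) set" where
  "perms n \<equiv> {\<pi>. \<pi> permutes {1..n}}"

abbreviation swapping :: "nat \<Rightarrow> nat \<Rightarrow> nat \<Rightarrow> nat" where
  "swapping \<equiv> Transposition.transpose"

lemma finite_perms: "finite (perms n)"
  by (rule finite_permutations) simp

text \<open>A switching argument: \<sigma> takes the value \<open>i\<close> at some position q of
  \<open>K\<close>, and exchanging the positions \<open>p\<close> and q moves it to \<open>p\<close>
  at the cost of a factor \<open>C\<close>. For each q the exchange is injective, so a target is
  reached at most \<open>card K\<close> times.\<close>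

lemma forced_value_sum:
  fixes F :: "(nat \<Rightarrow> nat) \<Rightarrow> real"
  assumes S: "finite S" and K: "finite K" and F: "\<And>\<sigma>. \<sigma> \<in> S \<Longrightarrow> F \<sigma> \<ge> 0" and C: "C \<ge> 0"
    and hit: "\<And>\<sigma>. \<sigma> \<in> S \<Longrightarrow> \<exists>q\<in>K. \<sigma> q = i"
    and swap: "\<And>\<sigma> q. \<sigma> \<in> S \<Longrightarrow> q \<in> K \<Longrightarrow> \<sigma> q = i \<Longrightarrow> \<sigma> \<circ> swapping p q \<in> S"
    and le: "\<And>\<sigma> q. \<sigma> \<in> S \<Longrightarrow> q \<in> K \<Longrightarrow> \<sigma> q = i \<Longrightarrow> F \<sigma> \<le> C * F (\<sigma> \<circ> swapping p q)"
  shows "(\<Sum>\<sigma>\<in>S. F \<sigma>) \<le> C * real (card K) * (\<Sum>\<sigma>\<in>{\<sigma>\<in>S. \<sigma> p = i}. F \<sigma>)"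
proof -
  have "(\<Sum>\<sigma>\<in>S. F \<sigma>) \<le> (\<Sum>\<sigma>\<in>S. \<Sum>q\<in>K. if \<sigma> q = i then F \<sigma> else 0)"
  proof (rule sum_mono)
    fix \<sigma> assume \<sigma>: "\<sigma> \<in> S"
    then obtain q where q: "q \<in> K" "\<sigma> q = i" using hit by blast
    have "(if \<sigma> q = i then F \<sigma> else 0) \<le> (\<Sum>q\<in>K. if \<sigma> q = i then F \<sigma> else 0)"
      using F[OF \<sigma>] by (intro member_le_sum q(1) K) auto
    then show "F \<sigma> \<le> (\<Sum>q\<in>K. if \<sigma> q = i then F \<sigma> else 0)" using q(2) by simp
  qed
  also have "\<dots> = (\<Sum>q\<in>K. \<Sum>\<sigma>\<in>{\<sigma>\<in>S. \<sigma> q = i}. F \<sigma>)"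
    by (subst sum.swap) (simp add: sum.inter_filter[OF S])
  also have "\<dots> \<le> (\<Sum>q\<in>K. C * (\<Sum>\<sigma>\<in>{\<sigma>\<in>S. \<sigma> p = i}. F \<sigma>))"
  proof (rule sum_mono)
    fix q assume q: "q \<in> K"
    have inj: "inj_on (\<lambda>\<sigma>. \<sigma> \<circ> swapping p q) {\<sigma>\<in>S. \<sigma> q = i}"
      by (rule inj_onI) (metis (no_types, lifting) comp_assoc comp_id transpose_comp_involutory)
    have "(\<Sum>\<sigma>\<in>{\<sigma>\<in>S. \<sigma> q = i}. F \<sigma>) \<le> (\<Sum>\<sigma>\<in>{\<sigma>\<in>S. \<sigma> q = i}. C * F (\<sigma> \<circ> swapping p q))"
      using le q by (intro sum_mono) auto
    also have "\<dots> = C * (\<Sum>\<sigma>\<in>(\<lambda>\<sigma>. \<sigma> \<circ> swapping p q) ` {\<sigma>\<in>S. \<sigma> q = i}. F \<sigma>)"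
      by (simp add: sum.reindex[OF inj] sum_distrib_left)
    also have "\<dots> \<le> C * (\<Sum>\<sigma>\<in>{\<sigma>\<in>S. \<sigma> p = i}. F \<sigma>)"
      using S F swap q by (intro mult_left_mono[OF _ C] sum_mono2) auto
    finally show "(\<Sum>\<sigma>\<in>{\<sigma>\<in>S. \<sigma> q = i}. F \<sigma>) \<le> C * (\<Sum>\<sigma>\<in>{\<sigma>\<in>S. \<sigma> p = i}. F \<sigma>)" .
  qed
  also have "\<dots> = C * real (card K) * (\<Sum>\<sigma>\<in>{\<sigma>\<in>S. \<sigma> p = i}. F \<sigma>)" by simp
  finally show ?thesis .
qed

lemma permutes_comp_swapping:
  assumes "\<sigma> \<in> perms n" "p \<in> {1..n}" "q \<in> {1..n}"
  shows "\<sigma> \<circ> swapping p q \<in> perms n"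
  unfolding mem_Collect_eq
  by (rule permutes_compose[OF permutes_swap_id[OF assms(2,3)]]) (use assms(1) in blast)

lemma permutes_hit:
  assumes "\<sigma> \<in> perms n" "i \<in> {1..n}"
  shows "\<exists>q\<in>{1..n}. \<sigma> q = i"
proof -
  have "\<sigma> ` {1..n} = {1..n}" using assms(1) by (intro permutes_image) blast
  then have "i \<in> \<sigma> ` {1..n}" using assms(2) by blast
  then show ?thesis by blast
qed

lemma forced_pair_sum:
  fixes F :: "(nat \<Rightarrow> nat) \<Rightarrow> real"
  assumes F: "\<And>\<sigma>. \<sigma> \<in> perms n \<Longrightarrow> F \<sigma> \<ge> 0" and C: "C \<ge> 0"
    and le: "\<And>\<sigma> p q. \<sigma> \<in> perms n \<Longrightarrow> p \<in> {1..n} \<Longrightarrow> q \<in> {1..n} \<Longrightarrow> F \<sigma> \<le> C * F (\<sigma> \<circ> swapping p q)"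
    and p: "p \<in> {1..n}" "p' \<in> {1..n}" "p \<noteq> p'" and i: "i \<in> {1..n}" "j \<in> {1..n}" "i \<noteq> j"
  shows "(\<Sum>\<sigma>\<in>perms n. F \<sigma>) \<le> (C * real n)\<^sup>2 * (\<Sum>\<sigma>\<in>{\<sigma>\<in>perms n. \<sigma> p = i \<and> \<sigma> p' = j}. F \<sigma>)"
proof -
  have s1: "(\<Sum>\<sigma>\<in>perms n. F \<sigma>) \<le> C * real (card {1..n}) * (\<Sum>\<sigma>\<in>{\<sigma>\<in>perms n. \<sigma> p = i}. F \<sigma>)"
    by (rule forced_value_sum[OF finite_perms])
      (use F C permutes_hit i(1) permutes_comp_swapping p(1) le in blast)+
  have "(\<Sum>\<sigma>\<in>{\<sigma>\<in>perms n. \<sigma> p = i}. F \<sigma>) \<le>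
      C * real (card ({1..n} - {p})) * (\<Sum>\<sigma>\<in>{\<sigma>\<in>{\<sigma>\<in>perms n. \<sigma> p = i}. \<sigma> p' = j}. F \<sigma>)"
  proof (rule forced_value_sum)
    show "finite {\<sigma>\<in>perms n. \<sigma> p = i}" using finite_perms[of n] by simp
    fix \<sigma> assume \<sigma>: "\<sigma> \<in> {\<sigma>\<in>perms n. \<sigma> p = i}"
    show "0 \<le> F \<sigma>" using F \<sigma> by blast
    \<comment> \<open>Since \<open>\<sigma> p = i \<noteq> j\<close>, the second exchange never
      touches \<open>p\<close> and preserves the value forced first.\<close>
    show "\<exists>q\<in>{1..n} - {p}. \<sigma> q = j" using permutes_hit[of \<sigma> n j] \<sigma> i by blast
    fix q assume q: "q \<in> {1..n} - {p}"
    have "\<sigma> \<circ> swapping p' q \<in> perms n" using \<sigma> p q by (intro permutes_comp_swapping) auto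
    moreover have "(\<sigma> \<circ> swapping p' q) p = i" using \<sigma> p(3) q by (simp add: Transposition.transpose_def)
    ultimately show "\<sigma> \<circ> swapping p' q \<in> {\<sigma>\<in>perms n. \<sigma> p = i}" by blast
    show "F \<sigma> \<le> C * F (\<sigma> \<circ> swapping p' q)" using le[of \<sigma> p' q] \<sigma> p q by blast
  qed (use C in auto)
  also have "\<dots> \<le> C * real n * (\<Sum>\<sigma>\<in>{\<sigma>\<in>perms n. \<sigma> p = i \<and> \<sigma> p' = j}. F \<sigma>)"
  proof -
    have "{\<sigma>\<in>{\<sigma>\<in>perms n. \<sigma> p = i}. \<sigma> p' = j} = {\<sigma>\<in>perms n. \<sigma> p = i \<and> \<sigma> p' = j}" by auto
    moreover have "card ({1..n} - {p}) \<le> n" using card_mono[of "{1..n}" "{1..n} - {p}"] by simp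
    ultimately show ?thesis using C F by (auto intro!: mult_right_mono mult_left_mono sum_nonneg)
  qed
  finally have s2: "(\<Sum>\<sigma>\<in>{\<sigma>\<in>perms n. \<sigma> p = i}. F \<sigma>) \<le>
      C * real n * (\<Sum>\<sigma>\<in>{\<sigma>\<in>perms n. \<sigma> p = i \<and> \<sigma> p' = j}. F \<sigma>)" .
  show ?thesis
    using order_trans[OF s1 mult_left_mono[OF s2]] C by (simp add: power2_eq_square mult.assoc)
qed

section \<open>Sums over disjoint pairs of positions\<close>

definition pair_sum :: "nat \<Rightarrow> (nat \<Rightarrow> nat \<Rightarrow> nat \<Rightarrow> nat \<Rightarrow> real) \<Rightarrow> (nat \<Rightarrow> nat) \<Rightarrow> (nat \<Rightarrow> nat) \<Rightarrow> real" where
  "pair_sum N h \<sigma> \<tau> = (\<Sum>a<N. h (\<sigma> (2 * a + 1)) (\<sigma> (2 * a + 2)) (\<tau> (2 * a + 1)) (\<tau> (2 * a + 2)))"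

lemma sum_change_two:
  fixes f g :: "nat \<Rightarrow> real"
  assumes "\<And>a. a \<noteq> u \<Longrightarrow> a \<noteq> v \<Longrightarrow> f a = g a" "\<And>a. f a \<le> 1" "\<And>a. g a \<ge> 0"
  shows "(\<Sum>a<N. f a) \<le> (\<Sum>a<N. g a) + 2"
proof -
  have "(\<Sum>a<N. f a) \<le> (\<Sum>a<N. g a + ((if a = u then 1 else 0) + (if a = v then 1 else 0)))"
    using assms by (intro sum_mono) (auto intro: order_trans[OF assms(2)] add_increasing)
  also have "\<dots> \<le> (\<Sum>a<N. g a) + (1 + 1)"
    unfolding sum.distrib by (intro add_left_mono add_mono) auto
  finally show ?thesis by simp
qed

lemma pair_sum_swapping:
  assumes "\<And>i j k l. 0 \<le> h i j k l" "\<And>i j k l. h i j k l \<le> 1"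
  shows "pair_sum N h (\<sigma> \<circ> swapping p q) \<tau> \<le> pair_sum N h \<sigma> \<tau> + 2"
    and "pair_sum N h \<sigma> (\<tau> \<circ> swapping p q) \<le> pair_sum N h \<sigma> \<tau> + 2"
proof -
  \<comment> \<open>The pair containing a position p \<ge> 1 has index \<open>(p - 1) div 2\<close>.
    Position 0 lies in no pair, and truncated subtraction gives it the harmless index 0.\<close>
  have *: "swapping p q (2 * a + 1) = 2 * a + 1 \<and> swapping p q (2 * a + 2) = 2 * a + 2"
    if "a \<noteq> (p - 1) div 2" "a \<noteq> (q - 1) div 2" for a
    using that by (auto simp: Transposition.transpose_def)
  show "pair_sum N h (\<sigma> \<circ> swapping p q) \<tau> \<le> pair_sum N h \<sigma> \<tau> + 2"
    "pair_sum N h \<sigma> (\<tau> \<circ> swapping p q) \<le> pair_sum N h \<sigma> \<tau> + 2"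
    unfolding pair_sum_def
    by (rule sum_change_two[of "(p - 1) div 2" "(q - 1) div 2"]; use * assms in simp)+
qed

text \<open>Forcing the values at one pair of positions costs a bounded number of transpositions, hence
  changes the sum by a bounded amount. So under the tilted measure the expectation of
  \<open>pair_sum\<close> is still a constant proportion of its mean.\<close>
lemma tilted_mean:
  assumes h: "\<And>i j k l. 0 \<le> h i j k l" "\<And>i j k l. h i j k l \<le> 1"
    and diag: "\<And>i k l. h i i k l = 0" "\<And>i j k. h i j k k = 0"
    and \<theta>: "0 \<le> \<theta>" and N: "2 * N \<le> n" and n: "n \<ge> 1"
  defines "E \<equiv> \<lambda>\<sigma> \<tau>. exp (- \<theta> * pair_sum N h \<sigma> \<tau>)"
  shows "exp (- 8 * \<theta>) * (real N / real n ^ 4 * (\<Sum>i=1..n. \<Sum>j=1..n. \<Sum>k=1..n. \<Sum>l=1..n. h i j k l))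
      * (\<Sum>\<sigma>\<in>perms n. \<Sum>\<tau>\<in>perms n. E \<sigma> \<tau>)
    \<le> (\<Sum>\<sigma>\<in>perms n. \<Sum>\<tau>\<in>perms n. pair_sum N h \<sigma> \<tau> * E \<sigma> \<tau>)"
proof -
  define T where "T = (\<Sum>\<sigma>\<in>perms n. \<Sum>\<tau>\<in>perms n. E \<sigma> \<tau>)"
  define C where "C = exp (2 * \<theta>)"
  have E0: "E \<sigma> \<tau> \<ge> 0" for \<sigma> \<tau> by (simp add: E_def)
  have EC: "E \<sigma> \<tau> \<le> C * E (\<sigma> \<circ> swapping p q) \<tau>" "E \<sigma> \<tau> \<le> C * E \<sigma> (\<tau> \<circ> swapping p q)" for \<sigma> \<tau> p q
  proof -
    have "\<theta> * pair_sum N h (\<sigma> \<circ> swapping p q) \<tau> \<le> \<theta> * (pair_sum N h \<sigma> \<tau> + 2)"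
      "\<theta> * pair_sum N h \<sigma> (\<tau> \<circ> swapping p q) \<le> \<theta> * (pair_sum N h \<sigma> \<tau> + 2)"
      using pair_sum_swapping[OF h] \<theta> by (auto intro!: mult_left_mono)
    then show "E \<sigma> \<tau> \<le> C * E (\<sigma> \<circ> swapping p q) \<tau>" "E \<sigma> \<tau> \<le> C * E \<sigma> (\<tau> \<circ> swapping p q)"
      by (auto simp: E_def C_def exp_add[symmetric] algebra_simps)
  qed
  define M where "M p p' i j k l =
    (\<Sum>\<sigma>\<in>{\<sigma>\<in>perms n. \<sigma> p = i \<and> \<sigma> p' = j}. \<Sum>\<tau>\<in>{\<tau>\<in>perms n. \<tau> p = k \<and> \<tau> p' = l}. E \<sigma> \<tau>)" for p p' i j k l
  have force: "T \<le> ((C * real n)\<^sup>2)\<^sup>2 * M p p' i j k l"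
    if p: "p \<in> {1..n}" "p' \<in> {1..n}" "p \<noteq> p'" and ij: "i \<in> {1..n}" "j \<in> {1..n}" "i \<noteq> j"
      and kl: "k \<in> {1..n}" "l \<in> {1..n}" "k \<noteq> l" for p p' i j k l
  proof -
    have s1: "T \<le> (C * real n)\<^sup>2 * (\<Sum>\<sigma>\<in>{\<sigma>\<in>perms n. \<sigma> p = i \<and> \<sigma> p' = j}. \<Sum>\<tau>\<in>perms n. E \<sigma> \<tau>)"
      unfolding T_def
      by (rule forced_pair_sum[OF _ _ _ p ij])
        (auto simp: sum_distrib_left C_def intro!: sum_nonneg E0 sum_mono EC[unfolded C_def])
    have "(\<Sum>\<sigma>\<in>{\<sigma>\<in>perms n. \<sigma> p = i \<and> \<sigma> p' = j}. \<Sum>\<tau>\<in>perms n. E \<sigma> \<tau>) =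
        (\<Sum>\<tau>\<in>perms n. \<Sum>\<sigma>\<in>{\<sigma>\<in>perms n. \<sigma> p = i \<and> \<sigma> p' = j}. E \<sigma> \<tau>)" by (rule sum.swap)
    also have "\<dots> \<le> (C * real n)\<^sup>2 * (\<Sum>\<tau>\<in>{\<tau>\<in>perms n. \<tau> p = k \<and> \<tau> p' = l}. \<Sum>\<sigma>\<in>{\<sigma>\<in>perms n. \<sigma> p = i \<and> \<sigma> p' = j}. E \<sigma> \<tau>)"
      by (rule forced_pair_sum[OF _ _ _ p kl])
        (auto simp: sum_distrib_left C_def intro!: sum_nonneg E0 sum_mono EC[unfolded C_def])
    also have "(\<Sum>\<tau>\<in>{\<tau>\<in>perms n. \<tau> p = k \<and> \<tau> p' = l}. \<Sum>\<sigma>\<in>{\<sigma>\<in>perms n. \<sigma> p = i \<and> \<sigma> p' = j}. E \<sigma> \<tau>) = M p p' i j k l"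
      unfolding M_def by (rule sum.swap)
    finally have s2: "(\<Sum>\<sigma>\<in>{\<sigma>\<in>perms n. \<sigma> p = i \<and> \<sigma> p' = j}. \<Sum>\<tau>\<in>perms n. E \<sigma> \<tau>)
      \<le> (C * real n)\<^sup>2 * M p p' i j k l" .
    show ?thesis
      using order_trans[OF s1 mult_left_mono[OF s2 zero_le_power2]] by (simp add: power2_eq_square mult.assoc)
  qed
  define Z where "Z = exp (- 8 * \<theta>) / real n ^ 4"
  \<comment> \<open>Two exchanges for \<sigma> and two for \<tau>, each costing exp (2 \<theta>):
    this is the origin of exp (- 8 \<theta>).\<close>
  have ZC: "Z * ((C * real n)\<^sup>2)\<^sup>2 = 1"
  proof -
    have "((C * real n)\<^sup>2)\<^sup>2 = C ^ 4 * real n ^ 4" by (simp add: power_mult_distrib)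
    also have "C ^ 4 = exp (8 * \<theta>)" unfolding C_def by (simp flip: exp_of_nat_mult)
    finally show ?thesis using n by (simp add: Z_def exp_minus field_simps)
  qed
  have Z0: "Z \<ge> 0" by (simp add: Z_def)
  have per_pair: "Z * T * (\<Sum>i=1..n. \<Sum>j=1..n. \<Sum>k=1..n. \<Sum>l=1..n. h i j k l)
      \<le> (\<Sum>\<sigma>\<in>perms n. \<Sum>\<tau>\<in>perms n. h (\<sigma> p) (\<sigma> p') (\<tau> p) (\<tau> p') * E \<sigma> \<tau>)"
    if p: "p \<in> {1..n}" "p' \<in> {1..n}" "p \<noteq> p'" for p p'
  proof -
    let ?I = "{1..n}"
    have le: "Z * T * h i j k l \<le> h i j k l * M p p' i j k l" if "i \<in> ?I" "j \<in> ?I" "k \<in> ?I" "l \<in> ?I" for i j k l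
    \<comment> \<open>No permutation takes equal values at two positions, so nothing can be forced
      here; \<open>diag\<close> covers this case.\<close>
    proof (cases "i = j \<or> k = l")
      case True
      then show ?thesis using diag by auto
    next
      case False
      then have "Z * T \<le> Z * (((C * real n)\<^sup>2)\<^sup>2 * M p p' i j k l)"
        using force[OF p] that Z0 by (intro mult_left_mono) auto
      also have "\<dots> = M p p' i j k l" using ZC by (simp flip: mult.assoc)
      finally have "Z * T * h i j k l \<le> M p p' i j k l * h i j k l" using h(1) by (rule mult_right_mono)
      then show ?thesis by (simp add: mult.commute)
    qed
    have fin: "finite (perms n)" by (rule finite_perms)
    have grp: "(\<Sum>x\<in>?I. \<Sum>y\<in>?I. \<Sum>\<sigma>\<in>{\<sigma>\<in>perms n. \<sigma> p = x \<and> \<sigma> p' = y}. G x y \<sigma>) = (\<Sum>\<sigma>\<in>perms n. G (\<sigma> p) (\<sigma> p') \<sigma>)"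
      for G :: "nat \<Rightarrow> nat \<Rightarrow> (nat \<Rightarrow> nat) \<Rightarrow> real"
    proof -
      have "(\<Sum>x\<in>?I. \<Sum>y\<in>?I. \<Sum>\<sigma>\<in>{\<sigma>\<in>perms n. \<sigma> p = x \<and> \<sigma> p' = y}. G x y \<sigma>) =
          (\<Sum>z\<in>?I \<times> ?I. \<Sum>\<sigma>\<in>{\<sigma>\<in>perms n. (\<sigma> p, \<sigma> p') = z}. G (\<sigma> p) (\<sigma> p') \<sigma>)"
        unfolding sum.cartesian_product by (intro sum.cong) auto
      also have "\<dots> = (\<Sum>\<sigma>\<in>perms n. G (\<sigma> p) (\<sigma> p') \<sigma>)"
      proof (rule sum.group[OF fin])
        show "(\<lambda>\<sigma>. (\<sigma> p, \<sigma> p')) ` perms n \<subseteq> ?I \<times> ?I" using p permutes_in_image by fastforce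
      qed simp
      finally show ?thesis .
    qed
    have "Z * T * (\<Sum>i=1..n. \<Sum>j=1..n. \<Sum>k=1..n. \<Sum>l=1..n. h i j k l)
        = (\<Sum>i=1..n. \<Sum>j=1..n. \<Sum>k=1..n. \<Sum>l=1..n. Z * T * h i j k l)"
      by (simp add: sum_distrib_left)
    also have "\<dots> \<le> (\<Sum>i=1..n. \<Sum>j=1..n. \<Sum>k=1..n. \<Sum>l=1..n. h i j k l * M p p' i j k l)"
      using le by (intro sum_mono) auto
    also have "\<dots> = (\<Sum>i=1..n. \<Sum>j=1..n. \<Sum>\<sigma>\<in>{\<sigma>\<in>perms n. \<sigma> p = i \<and> \<sigma> p' = j}.
        \<Sum>k=1..n. \<Sum>l=1..n. \<Sum>\<tau>\<in>{\<tau>\<in>perms n. \<tau> p = k \<and> \<tau> p' = l}. h i j k l * E \<sigma> \<tau>)"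
    proof (intro sum.cong refl)
      fix i j
      let ?S = "{\<sigma>\<in>perms n. \<sigma> p = i \<and> \<sigma> p' = j}"
      have "(\<Sum>k=1..n. \<Sum>l=1..n. h i j k l * M p p' i j k l) =
          (\<Sum>k=1..n. \<Sum>l=1..n. \<Sum>\<sigma>\<in>?S. \<Sum>\<tau>\<in>{\<tau>\<in>perms n. \<tau> p = k \<and> \<tau> p' = l}. h i j k l * E \<sigma> \<tau>)"
        by (simp add: M_def sum_distrib_left)
      also have "\<dots> = (\<Sum>k=1..n. \<Sum>\<sigma>\<in>?S. \<Sum>l=1..n. \<Sum>\<tau>\<in>{\<tau>\<in>perms n. \<tau> p = k \<and> \<tau> p' = l}. h i j k l * E \<sigma> \<tau>)"
        by (intro sum.cong refl sum.swap)
      also have "\<dots> = (\<Sum>\<sigma>\<in>?S. \<Sum>k=1..n. \<Sum>l=1..n. \<Sum>\<tau>\<in>{\<tau>\<in>perms n. \<tau> p = k \<and> \<tau> p' = l}. h i j k l * E \<sigma> \<tau>)"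
        by (rule sum.swap)
      finally show "(\<Sum>k=1..n. \<Sum>l=1..n. h i j k l * M p p' i j k l) =
          (\<Sum>\<sigma>\<in>?S. \<Sum>k=1..n. \<Sum>l=1..n. \<Sum>\<tau>\<in>{\<tau>\<in>perms n. \<tau> p = k \<and> \<tau> p' = l}. h i j k l * E \<sigma> \<tau>)" .
    qed
    also have "\<dots> = (\<Sum>\<sigma>\<in>perms n. \<Sum>\<tau>\<in>perms n. h (\<sigma> p) (\<sigma> p') (\<tau> p) (\<tau> p') * E \<sigma> \<tau>)"
      by (subst grp, intro sum.cong refl, rule grp)
    finally show ?thesis .
  qed
  have "exp (- 8 * \<theta>) * (real N / real n ^ 4 * (\<Sum>i=1..n. \<Sum>j=1..n. \<Sum>k=1..n. \<Sum>l=1..n. h i j k l)) * T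
      = (\<Sum>a<N. Z * T * (\<Sum>i=1..n. \<Sum>j=1..n. \<Sum>k=1..n. \<Sum>l=1..n. h i j k l))"
    by (simp add: Z_def)
  also have "\<dots> \<le> (\<Sum>a<N. \<Sum>\<sigma>\<in>perms n. \<Sum>\<tau>\<in>perms n.
      h (\<sigma> (2 * a + 1)) (\<sigma> (2 * a + 2)) (\<tau> (2 * a + 1)) (\<tau> (2 * a + 2)) * E \<sigma> \<tau>)"
    using N by (intro sum_mono per_pair) auto
  also have "\<dots> = (\<Sum>\<sigma>\<in>perms n. \<Sum>a<N. \<Sum>\<tau>\<in>perms n.
      h (\<sigma> (2 * a + 1)) (\<sigma> (2 * a + 2)) (\<tau> (2 * a + 1)) (\<tau> (2 * a + 2)) * E \<sigma> \<tau>)"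
    by (rule sum.swap)
  also have "\<dots> = (\<Sum>\<sigma>\<in>perms n. \<Sum>\<tau>\<in>perms n. pair_sum N h \<sigma> \<tau> * E \<sigma> \<tau>)"
    unfolding pair_sum_def sum_distrib_right by (intro sum.cong refl sum.swap)
  finally show ?thesis unfolding T_def .
qed

text \<open>By \<open>tilted_mean\<close> the Laplace transform times exp (c \<theta>) is
  nonincreasing. It is followed only up to \<theta> = 1/2, the parameter produced by
  \<open>abs_cos_le_exp\<close>, and there exp (- 8 \<theta>) is still at least exp (- 4).\<close>

lemma pair_sum_laplace:
  assumes h: "\<And>i j k l. 0 \<le> h i j k l" "\<And>i j k l. h i j k l \<le> 1"
    and diag: "\<And>i k l. h i i k l = 0" "\<And>i j k. h i j k k = 0"
    and N: "2 * N \<le> n" and n: "n \<ge> 1"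
  defines "\<mu> \<equiv> real N / real n ^ 4 * (\<Sum>i=1..n. \<Sum>j=1..n. \<Sum>k=1..n. \<Sum>l=1..n. h i j k l)"
  shows "(\<Sum>\<sigma>\<in>perms n. \<Sum>\<tau>\<in>perms n. exp (- (1/2) * pair_sum N h \<sigma> \<tau>)) \<le> (fact n)\<^sup>2 * exp (- (exp (- 4) / 2) * \<mu>)"
proof -
  define \<Phi> where "\<Phi> \<theta> = (\<Sum>\<sigma>\<in>perms n. \<Sum>\<tau>\<in>perms n. exp (- \<theta> * pair_sum N h \<sigma> \<tau>))" for \<theta>
  define \<Phi>' where "\<Phi>' \<theta> = - (\<Sum>\<sigma>\<in>perms n. \<Sum>\<tau>\<in>perms n. pair_sum N h \<sigma> \<tau> * exp (- \<theta> * pair_sum N h \<sigma> \<tau>))" for \<theta>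
  define c where "c = exp (- 4) * \<mu>"
  have mu: "\<mu> \<ge> 0" unfolding \<mu>_def using h(1) by (intro mult_nonneg_nonneg sum_nonneg) auto
  have der: "(\<Phi> has_real_derivative \<Phi>' \<theta>) (at \<theta>)" for \<theta>
    unfolding \<Phi>_def \<Phi>'_def sum_negf[symmetric]
    by (auto intro!: derivative_eq_intros DERIV_sum sum.cong simp: algebra_simps)
  have "\<Phi> (1/2) * exp (c * (1/2)) \<le> \<Phi> 0 * exp (c * 0)"
  proof (rule DERIV_nonpos_imp_nonincreasing[where f = "\<lambda>\<theta>. \<Phi> \<theta> * exp (c * \<theta>)"])
    fix \<theta> :: real assume \<theta>: "0 \<le> \<theta>" "\<theta> \<le> 1/2"
    have "((\<lambda>\<theta>. \<Phi> \<theta> * exp (c * \<theta>)) has_real_derivative (\<Phi>' \<theta> + c * \<Phi> \<theta>) * exp (c * \<theta>)) (at \<theta>)"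
      by (auto intro!: derivative_eq_intros der simp: algebra_simps)
    moreover have "(\<Phi>' \<theta> + c * \<Phi> \<theta>) * exp (c * \<theta>) \<le> 0"
    proof -
      have "exp (- 4) * \<mu> * \<Phi> \<theta> \<le> exp (- 8 * \<theta>) * \<mu> * \<Phi> \<theta>"
        using \<theta> mu unfolding \<Phi>_def by (intro mult_right_mono sum_nonneg) auto
      also have "\<dots> \<le> - \<Phi>' \<theta>"
        using tilted_mean[where h = h, OF h diag \<theta>(1) N n] unfolding \<Phi>_def \<Phi>'_def \<mu>_def by simp
      finally show ?thesis by (simp add: c_def mult_nonpos_nonneg)
    qed
    ultimately show "\<exists>y. ((\<lambda>\<theta>. \<Phi> \<theta> * exp (c * \<theta>)) has_real_derivative y) (at \<theta>) \<and> y \<le> 0" by blast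
  qed simp
  moreover have "\<Phi> 0 = (fact n)\<^sup>2"
    using card_permutations[of "{1..n}" n] by (simp add: \<Phi>_def power2_eq_square)
  ultimately have "\<Phi> (1/2) * exp (c * (1/2)) \<le> (fact n)\<^sup>2" by simp
  then have "\<Phi> (1/2) \<le> (fact n)\<^sup>2 * exp (- (c * (1/2)))"
    by (simp add: exp_minus field_simps)
  then show ?thesis by (simp add: \<Phi>_def c_def)
qed

section \<open>The characteristic function of a permuted sum\<close>

text \<open>Averaging over the transposition of the positions \<open>2 a + 1\<close> and \<open>2 a + 2\<close> turns the two
  summands of a pair into a symmetrised phase times a cosine; \<open>phase m\<close> is the exponent after
  the first \<open>m\<close> pairs have been averaged.\<close>
definition phase :: "nat \<Rightarrow> (nat \<Rightarrow> real) \<Rightarrow> (nat \<Rightarrow> real) \<Rightarrow> nat \<Rightarrow> (nat \<Rightarrow> nat) \<Rightarrow> real" where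
  "phase n A b m \<tau> =
     (\<Sum>a<m. (A (2 * a + 1) + A (2 * a + 2)) * (b (\<tau> (2 * a + 1)) + b (\<tau> (2 * a + 2))) / 2) +
     (\<Sum>j=2 * m + 1..n. A j * b (\<tau> j))"

definition pair_diff :: "(nat \<Rightarrow> real) \<Rightarrow> (nat \<Rightarrow> real) \<Rightarrow> nat \<Rightarrow> (nat \<Rightarrow> nat) \<Rightarrow> real" where
  "pair_diff A b a \<tau> = (A (2 * a + 1) - A (2 * a + 2)) * (b (\<tau> (2 * a + 1)) - b (\<tau> (2 * a + 2)))"

lemma e2pi_plus_minus: "e2pi (s + d / 2) + e2pi (s - d / 2) = 2 * (e2pi s * of_real (cos (pi * d)))"
proof -
  have "e2pi (d / 2) + e2pi (- (d / 2)) = of_real (2 * cos (pi * d))"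
    by (simp add: e2pi_def complex_eq_iff)
  moreover have "e2pi (s + d / 2) + e2pi (s - d / 2) = e2pi s * (e2pi (d / 2) + e2pi (- (d / 2)))"
    unfolding diff_conv_add_uminus e2pi_add by (simp only: distrib_left)
  ultimately show ?thesis by simp
qed

lemma sum_e2pi_phase:
  assumes "2 * m \<le> n"
  shows "(\<Sum>\<tau>\<in>perms n. e2pi (phase n A b 0 \<tau>)) =
    (\<Sum>\<tau>\<in>perms n. e2pi (phase n A b m \<tau>) * (\<Prod>a<m. of_real (cos (pi * pair_diff A b a \<tau>))))"
  using assms
proof (induction m)
  case (Suc m)
  define p q where "p = 2 * m + 1" and "q = 2 * m + 2"
  define t where "t = swapping p q"
  have pq: "p \<in> {1..n}" "q \<in> {1..n}" using Suc.prems by (auto simp: p_def q_def)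
  have tp: "t p = q" "t q = p" by (auto simp: t_def)
  have t_id: "t j = j" if "j \<noteq> p" "j \<noteq> q" for j using that by (simp add: t_def Transposition.transpose_def)
  define C where "C \<tau> = (\<Prod>a<m. complex_of_real (cos (pi * pair_diff A b a \<tau>)))" for \<tau>
  have Ct: "C (\<tau> \<circ> t) = C \<tau>" for \<tau>
    unfolding C_def pair_diff_def by (intro prod.cong refl) (simp add: t_id p_def q_def)
  define r where "r \<tau> = (\<Sum>a<m. (A (2 * a + 1) + A (2 * a + 2)) * (b (\<tau> (2 * a + 1)) + b (\<tau> (2 * a + 2))) / 2) +
     (\<Sum>j=2 * m + 3..n. A j * b (\<tau> j))" for \<tau>
  have rt: "r (\<tau> \<circ> t) = r \<tau>" for \<tau>
    unfolding r_def by (intro arg_cong2[where f = "(+)"] sum.cong refl) (simp_all add: t_id p_def q_def)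
  have ph: "phase n A b m \<tau> = r \<tau> + A p * b (\<tau> p) + A q * b (\<tau> q)" for \<tau>
  proof -
    have "(\<Sum>j=2 * m + 1..n. A j * b (\<tau> j)) = A p * b (\<tau> p) + (\<Sum>j=Suc p..n. A j * b (\<tau> j))"
      using Suc.prems by (subst sum.atLeast_Suc_atMost) (auto simp: p_def)
    also have "(\<Sum>j=Suc p..n. A j * b (\<tau> j)) = A q * b (\<tau> q) + (\<Sum>j=2 * m + 3..n. A j * b (\<tau> j))"
      using Suc.prems by (subst sum.atLeast_Suc_atMost) (auto simp: p_def q_def numeral_eq_Suc)
    finally show ?thesis unfolding phase_def r_def by simp
  qed
  have phS: "phase n A b (Suc m) \<tau> = r \<tau> + (A p + A q) * (b (\<tau> p) + b (\<tau> q)) / 2" for \<tau>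
    unfolding phase_def r_def p_def q_def by (simp add: numeral_eq_Suc)
  have avg: "e2pi (phase n A b m \<tau>) + e2pi (phase n A b m (\<tau> \<circ> t)) =
      2 * (e2pi (phase n A b (Suc m) \<tau>) * of_real (cos (pi * pair_diff A b m \<tau>)))" for \<tau>
  proof -
    have 1: "phase n A b m \<tau> = phase n A b (Suc m) \<tau> + pair_diff A b m \<tau> / 2"
      unfolding ph phS pair_diff_def p_def[symmetric] q_def[symmetric] by (simp add: algebra_simps) (simp add: field_simps)
    have 2: "phase n A b m (\<tau> \<circ> t) = phase n A b (Suc m) \<tau> - pair_diff A b m \<tau> / 2"
      unfolding ph phS pair_diff_def p_def[symmetric] q_def[symmetric]
      by (simp add: rt tp algebra_simps) (simp add: field_simps)
    show ?thesis unfolding 1 2 by (rule e2pi_plus_minus)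
  qed
  \<comment> \<open>Composition with \<open>t\<close> permutes the summation range, and
    \<open>t\<close> moves only the two positions of pair \<open>m\<close>, so the cosines of the
    earlier pairs are unaffected.\<close>
  have "2 * (\<Sum>\<tau>\<in>perms n. e2pi (phase n A b m \<tau>) * C \<tau>) =
      (\<Sum>\<tau>\<in>perms n. e2pi (phase n A b m \<tau>) * C \<tau>) + (\<Sum>\<tau>\<in>perms n. e2pi (phase n A b m (\<tau> \<circ> t)) * C (\<tau> \<circ> t))"
    using sum_permutations_compose_right[OF permutes_swap_id[OF pq], of "\<lambda>\<tau>. e2pi (phase n A b m \<tau>) * C \<tau>"]
    by (simp add: t_def)
  also have "\<dots> = (\<Sum>\<tau>\<in>perms n. (e2pi (phase n A b m \<tau>) + e2pi (phase n A b m (\<tau> \<circ> t))) * C \<tau>)"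
    unfolding Ct by (simp add: sum.distrib distrib_right)
  also have "\<dots> = 2 * (\<Sum>\<tau>\<in>perms n. e2pi (phase n A b (Suc m) \<tau>) * (C \<tau> * of_real (cos (pi * pair_diff A b m \<tau>))))"
    unfolding avg sum_distrib_left by (intro sum.cong refl) (simp add: mult_ac)
  finally have "(\<Sum>\<tau>\<in>perms n. e2pi (phase n A b m \<tau>) * C \<tau>) =
      (\<Sum>\<tau>\<in>perms n. e2pi (phase n A b (Suc m) \<tau>) * (C \<tau> * of_real (cos (pi * pair_diff A b m \<tau>))))" by simp
  then show ?case using Suc by (simp add: C_def)
qed simp

lemma abs_cos_le_exp: "\<bar>cos (x::real)\<bar> \<le> exp (- (1/2) * (sin x)\<^sup>2)"
proof (rule power2_le_imp_le)
  have "\<bar>cos x\<bar>\<^sup>2 = 1 - (sin x)\<^sup>2" by (simp add: cos_squared_eq)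
  also have "\<dots> \<le> exp (- (sin x)\<^sup>2)" using exp_ge_add_one_self[of "- (sin x)\<^sup>2"] by simp
  also have "\<dots> = (exp (- (1/2) * (sin x)\<^sup>2))\<^sup>2" by (simp add: power2_eq_square exp_add[symmetric])
  finally show "\<bar>cos x\<bar>\<^sup>2 \<le> (exp (- (1/2) * (sin x)\<^sup>2))\<^sup>2" .
qed simp

lemma norm_sum_e2pi_pairs:
  assumes "2 * N \<le> n"
  shows "norm (\<Sum>\<tau>\<in>perms n. e2pi (\<Sum>j=1..n. A j * b (\<tau> j))) \<le>
    (\<Sum>\<tau>\<in>perms n. exp (- (1/2) * (\<Sum>a<N. (sin (pi * pair_diff A b a \<tau>))\<^sup>2)))"
proof -
  have "(\<Sum>\<tau>\<in>perms n. e2pi (\<Sum>j=1..n. A j * b (\<tau> j))) = (\<Sum>\<tau>\<in>perms n. e2pi (phase n A b 0 \<tau>))"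
    by (simp add: phase_def)
  also have "norm \<dots> \<le> (\<Sum>\<tau>\<in>perms n. norm (e2pi (phase n A b N \<tau>) * (\<Prod>a<N. of_real (cos (pi * pair_diff A b a \<tau>)))))"
    unfolding sum_e2pi_phase[OF assms] by (rule norm_sum)
  also have "\<dots> = (\<Sum>\<tau>\<in>perms n. \<Prod>a<N. \<bar>cos (pi * pair_diff A b a \<tau>)\<bar>)"
    by (simp add: norm_mult norm_e2pi prod_norm[symmetric])
  also have "\<dots> \<le> (\<Sum>\<tau>\<in>perms n. \<Prod>a<N. exp (- (1/2) * (sin (pi * pair_diff A b a \<tau>))\<^sup>2))"
    by (intro sum_mono prod_mono conjI abs_cos_le_exp) auto
  also have "\<dots> = (\<Sum>\<tau>\<in>perms n. exp (- (1/2) * (\<Sum>a<N. (sin (pi * pair_diff A b a \<tau>))\<^sup>2)))"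
    by (simp add: exp_sum[symmetric] sum_distrib_left)
  finally show ?thesis .
qed

definition quad_energy :: "nat \<Rightarrow> (nat \<Rightarrow> real) \<Rightarrow> (nat \<Rightarrow> real) \<Rightarrow> real" where
  "quad_energy n a b = (\<Sum>i=1..n. \<Sum>j=1..n. \<Sum>k=1..n. \<Sum>l=1..n. (sin (pi * ((a i - a j) * (b k - b l))))\<^sup>2)"

text \<open>Relabelling the index by any permutation \<sigma> leaves the sum unchanged, so one may
  average over \<sigma> for free; this randomises the differences of \<open>a\<close> as well as
  those of \<open>b\<close>. In the constant, exp (- 4) / 2 comes from
  \<open>pair_sum_laplace\<close> and the further 1/3 from n div 2 \<ge> n / 3.\<close>

lemma perm_char_bound:
  assumes n: "n \<ge> 2"
  shows "norm (\<Sum>\<pi>\<in>perms n. e2pi (\<Sum>i=1..n. a i * b (\<pi> i))) \<le>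
    fact n * exp (- (exp (- 4) / 6) * (quad_energy n a b / real n ^ 3))"
proof -
  define S where "S = (\<Sum>\<pi>\<in>perms n. e2pi (\<Sum>i=1..n. a i * b (\<pi> i)))"
  define N where "N = n div 2"
  define h where "h i j k l = (sin (pi * ((a i - a j) * (b k - b l))))\<^sup>2" for i j k l
  have "n \<le> 3 * N" using n unfolding N_def by presburger
  then have N: "2 * N \<le> n" "real n \<le> 3 * real N" by (auto simp: N_def)
  have eq: "S = (\<Sum>\<tau>\<in>perms n. e2pi (\<Sum>j=1..n. a (\<sigma> j) * b (\<tau> j)))" if \<sigma>: "\<sigma> \<in> perms n" for \<sigma>
  proof -
    have \<sigma>': "\<sigma> permutes {1..n}" using \<sigma> by blast
    have "S = (\<Sum>\<tau>\<in>perms n. e2pi (\<Sum>i=1..n. a i * b ((\<tau> \<circ> inv \<sigma>) i)))"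
      unfolding S_def
      by (rule sum_permutations_compose_right[OF permutes_inv[OF \<sigma>']])
    also have "\<dots> = (\<Sum>\<tau>\<in>perms n. e2pi (\<Sum>j=1..n. a (\<sigma> j) * b (\<tau> j)))"
    proof (rule sum.cong[OF refl], rule arg_cong[where f = e2pi])
      fix \<tau>
      have "(\<Sum>i=1..n. a i * b ((\<tau> \<circ> inv \<sigma>) i)) = (\<Sum>j=1..n. a (\<sigma> j) * b ((\<tau> \<circ> inv \<sigma>) (\<sigma> j)))"
        using sum.permute[OF \<sigma>', of "\<lambda>i. a i * b ((\<tau> \<circ> inv \<sigma>) i)"] by (simp add: o_def)
      then show "(\<Sum>i=1..n. a i * b ((\<tau> \<circ> inv \<sigma>) i)) = (\<Sum>j=1..n. a (\<sigma> j) * b (\<tau> j))"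
        by (simp add: permutes_inverses(2)[OF \<sigma>'])
    qed
    finally show ?thesis .
  qed
  have "fact n * norm S = (\<Sum>\<sigma>\<in>perms n. norm S)" using card_permutations[of "{1..n}" n] by simp
  also have "\<dots> \<le> (\<Sum>\<sigma>\<in>perms n. \<Sum>\<tau>\<in>perms n. exp (- (1/2) * pair_sum N h \<sigma> \<tau>))"
  proof (rule sum_mono)
    fix \<sigma> assume \<sigma>: "\<sigma> \<in> perms n"
    have "norm S \<le> (\<Sum>\<tau>\<in>perms n. exp (- (1/2) * (\<Sum>c<N. (sin (pi * pair_diff (\<lambda>j. a (\<sigma> j)) b c \<tau>))\<^sup>2)))"
      unfolding eq[OF \<sigma>] by (rule norm_sum_e2pi_pairs[OF N(1)])
    then show "norm S \<le> (\<Sum>\<tau>\<in>perms n. exp (- (1/2) * pair_sum N h \<sigma> \<tau>))"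
      by (simp add: pair_sum_def h_def pair_diff_def)
  qed
  also have "\<dots> \<le> (fact n)\<^sup>2 * exp (- (exp (- 4) / 2) *
      (real N / real n ^ 4 * (\<Sum>i=1..n. \<Sum>j=1..n. \<Sum>k=1..n. \<Sum>l=1..n. h i j k l)))"
    by (rule pair_sum_laplace[where h = h]) (use N n in \<open>auto simp: h_def abs_square_le_1\<close>)
  also have "\<dots> = fact n * (fact n * exp (- (exp (- 4) / 2) * (real N / real n ^ 4 * quad_energy n a b)))"
    by (simp add: quad_energy_def h_def power2_eq_square)
  also have "\<dots> \<le> fact n * (fact n * exp (- (exp (- 4) / 6) * (quad_energy n a b / real n ^ 3)))"
  proof -
    have q0: "quad_energy n a b \<ge> 0" unfolding quad_energy_def by (intro sum_nonneg) simp
    have "real n * (quad_energy n a b / real n ^ 4) \<le> 3 * real N * (quad_energy n a b / real n ^ 4)"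
      using N(2) q0 by (intro mult_right_mono) auto
    moreover have "real n * (quad_energy n a b / real n ^ 4) = quad_energy n a b / real n ^ 3"
      using n by (simp add: power4_eq_xxxx power3_eq_cube)
    ultimately have "quad_energy n a b / real n ^ 3 / 3 \<le> real N / real n ^ 4 * quad_energy n a b" by simp
    then have "exp (- 4) / 2 * (quad_energy n a b / real n ^ 3 / 3) \<le>
        exp (- 4) / 2 * (real N / real n ^ 4 * quad_energy n a b)" by (intro mult_left_mono) auto
    then show ?thesis by simp
  qed
  finally show ?thesis unfolding S_def[symmetric] by simp
qed

section \<open>Fourier analysis on a level set\<close>

lemma abs_sin_add_le: "\<bar>sin (x + y)\<bar> \<le> \<bar>sin x\<bar> + \<bar>sin (y::real)\<bar>"
proof -
  have "\<bar>sin (x + y)\<bar> \<le> \<bar>sin x * cos y\<bar> + \<bar>cos x * sin y\<bar>"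
    unfolding sin_add by (rule abs_triangle_ineq)
  also have "\<dots> \<le> \<bar>sin x\<bar> * 1 + 1 * \<bar>sin y\<bar>"
    unfolding abs_mult by (intro add_mono mult_mono) auto
  finally show ?thesis by simp
qed

lemma abs_sin_nat_mult_le: "\<bar>sin (real n * x)\<bar> \<le> real n * \<bar>sin x\<bar>"
proof (induction n)
  case (Suc n)
  then show ?case using abs_sin_add_le[of "real n * x" x] by (simp add: algebra_simps)
qed simp

lemma abs_sin_int_mult_le: "\<bar>sin (of_int c * x)\<bar> \<le> of_int \<bar>c\<bar> * \<bar>sin (x::real)\<bar>"
proof (cases "c \<ge> 0")
  case True
  then show ?thesis using abs_sin_nat_mult_le[of "nat c" x] by simp
next
  case False
  then have "of_int c * x = - (real (nat (- c)) * x)" by simp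
  then have "\<bar>sin (of_int c * x)\<bar> = \<bar>sin (real (nat (- c)) * x)\<bar>" by (metis abs_minus_cancel sin_minus)
  then show ?thesis using abs_sin_nat_mult_le[of "nat (- c)" x] False by simp
qed

lemma abs_sin_sum_le: "\<bar>sin (\<Sum>x\<in>V. f x)\<bar> \<le> (\<Sum>x\<in>V. \<bar>sin (f x :: real)\<bar>)"
proof (induction V rule: infinite_finite_induct)
  case (insert x V)
  then show ?case using abs_sin_add_le[of "f x" "\<Sum>x\<in>V. f x"] by simp
qed auto

text \<open>\<open>\<Sum> sin\<^sup>2\<close> over a set of frequencies grows at most quadratically along sumsets, by
  subadditivity of \<open>\<bar>sin\<bar>\<close> and the Cauchy-Schwarz inequality.\<close>
lemma sum_sin_ksum:
  assumes V: "\<And>d. d \<in> V \<Longrightarrow> (\<Sum>\<xi>\<in>S. (sin (of_int d * \<theta> \<xi>))\<^sup>2) \<le> e" and c: "l1 V c \<le> int k" and e: "e \<ge> 0"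
  shows "(\<Sum>\<xi>\<in>S. (sin (of_int (ival V c) * \<theta> \<xi>))\<^sup>2) \<le> (real k)\<^sup>2 * e"
proof -
  have pt: "(sin (of_int (ival V c) * \<theta> \<xi>))\<^sup>2 \<le> real k * (\<Sum>d\<in>V. of_int \<bar>c d\<bar> * (sin (of_int d * \<theta> \<xi>))\<^sup>2)" for \<xi>
  proof -
    define s where "s d = \<bar>sin (of_int d * \<theta> \<xi>)\<bar>" for d :: int
    have "of_int (ival V c) * \<theta> \<xi> = (\<Sum>d\<in>V. of_int (c d) * (of_int d * \<theta> \<xi>))"
      by (simp add: ival_def sum_distrib_right mult.assoc)
    then have "\<bar>sin (of_int (ival V c) * \<theta> \<xi>)\<bar> \<le> (\<Sum>d\<in>V. \<bar>sin (of_int (c d) * (of_int d * \<theta> \<xi>))\<bar>)"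
      by (simp only: abs_sin_sum_le)
    also have "\<dots> \<le> (\<Sum>d\<in>V. of_int \<bar>c d\<bar> * s d)"
      unfolding s_def by (intro sum_mono abs_sin_int_mult_le)
    also have "\<dots> = (\<Sum>d\<in>V. sqrt (of_int \<bar>c d\<bar>) * (sqrt (of_int \<bar>c d\<bar>) * s d))"
      by (intro sum.cong refl) (simp flip: mult.assoc)
    finally have "(sin (of_int (ival V c) * \<theta> \<xi>))\<^sup>2 \<le> (\<Sum>d\<in>V. sqrt (of_int \<bar>c d\<bar>) * (sqrt (of_int \<bar>c d\<bar>) * s d))\<^sup>2"
      using power_mono[of "\<bar>sin (of_int (ival V c) * \<theta> \<xi>)\<bar>" _ 2] by simp
    also have "\<dots> \<le> (\<Sum>d\<in>V. (sqrt (of_int \<bar>c d\<bar>))\<^sup>2) * (\<Sum>d\<in>V. (sqrt (of_int \<bar>c d\<bar>) * s d)\<^sup>2)"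
      by (rule Cauchy_Schwarz_ineq_sum)
    also have "\<dots> = of_int (l1 V c) * (\<Sum>d\<in>V. of_int \<bar>c d\<bar> * (sin (of_int d * \<theta> \<xi>))\<^sup>2)"
      by (simp add: l1_def power_mult_distrib s_def)
    also have "\<dots> \<le> real k * (\<Sum>d\<in>V. of_int \<bar>c d\<bar> * (sin (of_int d * \<theta> \<xi>))\<^sup>2)"
      using c by (intro mult_right_mono sum_nonneg) auto
    finally show ?thesis .
  qed
  have "(\<Sum>\<xi>\<in>S. (sin (of_int (ival V c) * \<theta> \<xi>))\<^sup>2) \<le>
      (\<Sum>\<xi>\<in>S. real k * (\<Sum>d\<in>V. of_int \<bar>c d\<bar> * (sin (of_int d * \<theta> \<xi>))\<^sup>2))" by (intro sum_mono pt)
  also have "\<dots> = real k * (\<Sum>d\<in>V. of_int \<bar>c d\<bar> * (\<Sum>\<xi>\<in>S. (sin (of_int d * \<theta> \<xi>))\<^sup>2))"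
    unfolding sum_distrib_left[symmetric] by (subst sum.swap) (simp add: sum_distrib_left)
  also have "\<dots> \<le> real k * (\<Sum>d\<in>V. of_int \<bar>c d\<bar> * e)"
    using V by (intro mult_left_mono sum_mono) auto
  also have "\<dots> = real k * (of_int (l1 V c) * e)" by (simp add: l1_def sum_distrib_right)
  also have "\<dots> \<le> real k * (real k * e)" using c e by (intro mult_left_mono mult_right_mono) auto
  finally show ?thesis by (simp add: power2_eq_square)
qed

lemma parseval_residues:
  assumes M: "M > 0" and S: "S \<subseteq> {..<M}"
  shows "(\<Sum>y<M. (norm (\<Sum>\<xi>\<in>S. e2pi (real y * (real \<xi> / real M))))\<^sup>2) = real M * real (card S)"
proof -
  have fin: "finite S" using S finite_subset by blast
  have inner: "(\<Sum>y<M. e2pi (real y * ((real \<xi> - real \<zeta>) / real M))) = (if \<zeta> = \<xi> then of_nat M else 0)"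
    if "\<xi> \<in> S" "\<zeta> \<in> S" for \<xi> \<zeta>
  proof -
    have "(real \<xi> - real \<zeta>) / real M \<in> \<int> \<longleftrightarrow> \<zeta> = \<xi>"
    proof
      assume "(real \<xi> - real \<zeta>) / real M \<in> \<int>"
      moreover have "\<bar>(real \<xi> - real \<zeta>) / real M\<bar> < 1"
      proof -
        have "\<xi> < M" "\<zeta> < M" using S that by auto
        then have "\<bar>real \<xi> - real \<zeta>\<bar> < real M" by linarith
        then show ?thesis using M by simp
      qed
      ultimately have "(real \<xi> - real \<zeta>) / real M = 0" using Ints_nonzero_abs_less1 by blast
      then show "\<zeta> = \<xi>" using M by simp
    qed simp
    moreover have "real M * ((real \<xi> - real \<zeta>) / real M) \<in> \<int>" using M by simp
    ultimately show ?thesis by (simp only: sum_e2pi_period[OF M])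
  qed
  have "of_real (\<Sum>y<M. (norm (\<Sum>\<xi>\<in>S. e2pi (real y * (real \<xi> / real M))))\<^sup>2) =
      (\<Sum>y<M. (\<Sum>\<xi>\<in>S. e2pi (real y * (real \<xi> / real M))) * cnj (\<Sum>\<xi>\<in>S. e2pi (real y * (real \<xi> / real M))))"
    by (simp only: of_real_sum complex_norm_square)
  also have "\<dots> = (\<Sum>y<M. \<Sum>\<xi>\<in>S. \<Sum>\<zeta>\<in>S. e2pi (real y * ((real \<xi> - real \<zeta>) / real M)))"
    by (simp add: cnj_sum sum_product e2pi_diff[symmetric] algebra_simps diff_divide_distrib)
  also have "\<dots> = (\<Sum>\<xi>\<in>S. \<Sum>\<zeta>\<in>S. \<Sum>y<M. e2pi (real y * ((real \<xi> - real \<zeta>) / real M)))"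
    by (rule trans[OF sum.swap], rule sum.cong[OF refl], rule sum.swap)
  also have "\<dots> = (\<Sum>\<xi>\<in>S. \<Sum>\<zeta>\<in>S. if \<zeta> = \<xi> then of_nat M else 0)"
    by (intro sum.cong refl inner)
  also have "\<dots> = of_real (real M * real (card S))" using fin by simp
  finally show ?thesis by (simp only: of_real_eq_iff)
qed

text \<open>For z in the sumset the squares sin^2 over \<open>S\<close> add up to at most card S /
  4, so the exponential sum over \<open>S\<close> at z is at least card S / 2. By Parseval modulo
  \<open>M\<close> only 4 M / card S residues can be that large, and \<open>small\<close> makes
  distinct z distinct residues.\<close>

lemma dual_sumset_bound:
  assumes M: "M > 0" and S: "S \<subseteq> {..<M}" "S \<noteq> {}" and V: "finite V"
    and e: "\<And>d. d \<in> V \<Longrightarrow> (\<Sum>\<xi>\<in>S. (sin (of_int d * (pi * (real \<xi> / real M))))\<^sup>2) \<le> e * real (card S)"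
    and k: "(real k)\<^sup>2 * e \<le> 1 / 4" "e \<ge> 0"
    and small: "\<And>z. z \<in> ksum V k \<Longrightarrow> 2 * \<bar>z\<bar> < int M"
  shows "real (card (ksum V k)) * real (card S) \<le> 4 * real M"
proof -
  have finS: "finite S" using S finite_subset by blast
  then have S0: "real (card S) > 0" using S(2) by (simp add: card_gt_0_iff)
  define g where "g y = norm (\<Sum>\<xi>\<in>S. e2pi (real y * (real \<xi> / real M)))" for y :: nat
  define r where "r z = nat (z mod int M)" for z
  have r: "r z < M" "int (r z) = z mod int M" for z using M by (auto simp: r_def nat_less_iff)
  have inj: "inj_on r (ksum V k)"
  proof (rule inj_onI)
    fix z z' assume z: "z \<in> ksum V k" "z' \<in> ksum V k" "r z = r z'"
    then have "z mod int M = z' mod int M" using r(2) by metis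
    then have "int M dvd z - z'" by (simp add: mod_eq_dvd_iff)
    moreover have "\<bar>z - z'\<bar> < int M" using small[OF z(1)] small[OF z(2)] by linarith
    ultimately have "z - z' = 0" using zdvd_not_zless[of "\<bar>z - z'\<bar>" "int M"] by fastforce
    then show "z = z'" by simp
  qed
  have ge: "(real (card S) / 2)\<^sup>2 \<le> (g (r z))\<^sup>2" if z: "z \<in> ksum V k" for z
  proof -
    obtain c where c: "l1 V c \<le> int k" "z = ival V c" using z by (auto simp: ksum_def)
    have "(\<Sum>\<xi>\<in>S. (sin (of_int z * (pi * (real \<xi> / real M))))\<^sup>2) \<le> (real k)\<^sup>2 * (e * real (card S))"
      unfolding c(2) by (rule sum_sin_ksum[OF e c(1)]) (use k in auto)
    also have "\<dots> \<le> 1 / 4 * real (card S)" using mult_right_mono[OF k(1), of "real (card S)"] by (simp add: mult.assoc)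
    finally have s: "(\<Sum>\<xi>\<in>S. (sin (of_int z * (pi * (real \<xi> / real M))))\<^sup>2) \<le> real (card S) / 4" by simp
    have eq: "e2pi (real (r z) * (real \<xi> / real M)) = e2pi (of_int z * (real \<xi> / real M))" for \<xi>
    proof (rule e2pi_cong_Ints)
      have "real (r z) = of_int (z mod int M)" using r(2)[of z] by (metis of_int_of_nat_eq)
      also have "\<dots> = of_int z - real M * of_int (z div int M)"
        by (simp flip: minus_mult_div_eq_mod)
      finally have "(real (r z) - of_int z) * (real \<xi> / real M) = - (real M * of_int (z div int M)) * (real \<xi> / real M)"
        by simp
      also have "\<dots> = of_int (- (z div int M) * int \<xi>)" using M by simp
      finally have "real (r z) * (real \<xi> / real M) - of_int z * (real \<xi> / real M) = of_int (- (z div int M) * int \<xi>)"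
        by (simp only: left_diff_distrib)
      then show "real (r z) * (real \<xi> / real M) - of_int z * (real \<xi> / real M) \<in> \<int>" by (metis Ints_of_int)
    qed
    have "Re (e2pi x) = 1 - 2 * (sin (pi * x))\<^sup>2" for x
      using cos_double_sin[of "pi * x"] by (simp add: e2pi_def mult.assoc)
    then have "Re (\<Sum>\<xi>\<in>S. e2pi (of_int z * (real \<xi> / real M))) =
        (\<Sum>\<xi>\<in>S. 1 - 2 * (sin (of_int z * (pi * (real \<xi> / real M))))\<^sup>2)"
      by (simp add: mult_ac)
    also have "\<dots> = real (card S) - 2 * (\<Sum>\<xi>\<in>S. (sin (of_int z * (pi * (real \<xi> / real M))))\<^sup>2)"
      by (simp add: sum_subtractf sum_distrib_left)
    also have "\<dots> \<ge> real (card S) / 2" using s by simp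
    finally have "real (card S) / 2 \<le> g (r z)"
      unfolding g_def eq using complex_Re_le_cmod order_trans by blast
    then show ?thesis using S0 by (intro power_mono) auto
  qed
  have "real (card (ksum V k)) * (real (card S) / 2)\<^sup>2 = (\<Sum>z\<in>ksum V k. (real (card S) / 2)\<^sup>2)" by simp
  also have "\<dots> \<le> (\<Sum>z\<in>ksum V k. (g (r z))\<^sup>2)" by (rule sum_mono) (rule ge)
  also have "\<dots> = (\<Sum>y\<in>r ` ksum V k. (g y)\<^sup>2)" by (simp add: sum.reindex[OF inj])
  also have "\<dots> \<le> (\<Sum>y<M. (g y)\<^sup>2)" using r(1) by (intro sum_mono2) auto
  also have "\<dots> = real M * real (card S)" unfolding g_def by (rule parseval_residues[OF M S(1)])
  finally have "(real (card (ksum V k)) * real (card S)) * real (card S) \<le> (4 * real M) * real (card S)"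
    by (simp add: power2_eq_square field_simps)
  then show ?thesis using S0 by simp
qed

text \<open>Fourier inversion modulo \<open>M\<close>, followed by the triangle inequality. Asking
  for the value \<open>x\<close> only modulo \<open>M\<close> can but enlarge the count.\<close>

lemma concentration_fourier:
  fixes a b :: "nat \<Rightarrow> int"
  assumes n: "n \<ge> 2" and M: "M > 0"
  defines "\<psi> \<equiv> \<lambda>\<xi>. quad_energy n (\<lambda>i. real \<xi> / real M * of_int (a i)) (\<lambda>i. of_int (b i)) / real n ^ 3"
  shows "real (card {\<pi>\<in>perms n. (\<Sum>i=1..n. a i * b (\<pi> i)) = x}) / fact n * real M
    \<le> (\<Sum>\<xi><M. exp (- (exp (- 4) / 6) * \<psi> \<xi>))"
proof -
  define s where "s \<pi> = (\<Sum>i=1..n. a i * b (\<pi> i))" for \<pi>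
  let ?P = "{\<pi>\<in>perms n. s \<pi> = x}"
  have per: "(\<Sum>\<xi><M. e2pi (real \<xi> * (of_int (s \<pi> - x) / real M))) =
      (if of_int (s \<pi> - x) / real M \<in> \<int> then of_nat M else 0)" for \<pi>
    using M by (intro sum_e2pi_period) auto
  have fac: "e2pi (real \<xi> * (of_int (s \<pi> - x) / real M)) =
      e2pi (\<Sum>i=1..n. (real \<xi> / real M * of_int (a i)) * of_int (b (\<pi> i))) * cnj (e2pi (real \<xi> * of_int x / real M))" for \<pi> \<xi>
    unfolding e2pi_diff[symmetric]
    by (simp add: s_def sum_distrib_left sum_divide_distrib diff_divide_distrib right_diff_distrib mult_ac)
  have "real (card ?P) * real M = (\<Sum>\<pi>\<in>perms n. if s \<pi> = x then real M else 0)"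
    by (subst sum.inter_filter[OF finite_perms, symmetric]) simp
  also have "\<dots> \<le> (\<Sum>\<pi>\<in>perms n. if of_int (s \<pi> - x) / real M \<in> \<int> then real M else 0)"
    by (intro sum_mono) auto
  also have "\<dots> = norm (\<Sum>\<pi>\<in>perms n. \<Sum>\<xi><M. e2pi (real \<xi> * (of_int (s \<pi> - x) / real M)))"
  proof -
    have "(\<Sum>\<pi>\<in>perms n. \<Sum>\<xi><M. e2pi (real \<xi> * (of_int (s \<pi> - x) / real M))) =
        of_real (\<Sum>\<pi>\<in>perms n. if of_int (s \<pi> - x) / real M \<in> \<int> then real M else 0)"
      unfolding per of_real_sum by (intro sum.cong refl) simp
    moreover have "(\<Sum>\<pi>\<in>perms n. if of_int (s \<pi> - x) / real M \<in> \<int> then real M else 0) \<ge> 0"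
      by (intro sum_nonneg) auto
    ultimately show ?thesis by (simp only: norm_of_real abs_of_nonneg)
  qed
  also have "\<dots> = norm (\<Sum>\<xi><M. (\<Sum>\<pi>\<in>perms n. e2pi (\<Sum>i=1..n. (real \<xi> / real M * of_int (a i)) * of_int (b (\<pi> i))))
        * cnj (e2pi (real \<xi> * of_int x / real M)))"
    by (subst sum.swap) (simp only: fac sum_distrib_right)
  also have "\<dots> \<le> (\<Sum>\<xi><M. norm (\<Sum>\<pi>\<in>perms n. e2pi (\<Sum>i=1..n. (real \<xi> / real M * of_int (a i)) * of_int (b (\<pi> i)))))"
    by (rule order_trans[OF norm_sum]) (simp add: norm_mult norm_e2pi)
  also have "\<dots> \<le> (\<Sum>\<xi><M. fact n * exp (- (exp (- 4) / 6) * \<psi> \<xi>))"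
    unfolding \<psi>_def by (intro sum_mono perm_char_bound[OF n])
  finally have "real (card ?P) * real M \<le> fact n * (\<Sum>\<xi><M. exp (- (exp (- 4) / 6) * \<psi> \<xi>))"
    by (simp add: sum_distrib_left)
  then show ?thesis unfolding s_def by (simp add: field_simps)
qed

text \<open>If every level set were smaller, summing over levels with weights exp (- c (m - 1))
  would leave a geometric series in exp (- c / 2) with total below \<open>A\<close>. Only half of
  the exponential decay is spent on convergence; the other half is the surplus exp (c m / 2) in the
  conclusion.\<close>

lemma level_set_exists:
  fixes \<psi> :: "nat \<Rightarrow> real"
  assumes c: "c > 0" and psi: "\<And>\<xi>. 0 \<le> \<psi> \<xi>" and total: "A \<le> (\<Sum>\<xi><M. exp (- c * \<psi> \<xi>))" and A: "A > 0"
  shows "\<exists>m::nat. m \<ge> 1 \<and> exp (- c) * (1 - exp (- c / 2)) * A * exp (c * real m / 2) \<le> real (card {\<xi>. \<xi> < M \<and> \<psi> \<xi> \<le> real m})"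
proof (rule ccontr)
  assume none: "\<not> ?thesis"
  define q where "q = exp (- c / 2)"
  have q: "0 < q" "q < 1" using c by (auto simp: q_def)
  define S where "S m = {\<xi>. \<xi> < M \<and> \<psi> \<xi> \<le> real m}" for m :: nat
  have finS: "finite (S m)" for m unfolding S_def by simp
  have Sm: "real (card (S m)) < exp (- c) * (1 - q) * A * exp (c * real m / 2)" if "m \<ge> 1" for m
    using none that unfolding S_def q_def by (meson not_le)
  \<comment> \<open>Floor plus one instead of the ceiling, so that the level is at least 1 even
    where \<psi> vanishes.\<close>
  define lev where "lev \<xi> = nat \<lfloor>\<psi> \<xi>\<rfloor> + 1" for \<xi>
  have lev: "real (lev \<xi>) - 1 \<le> \<psi> \<xi>" "\<psi> \<xi> \<le> real (lev \<xi>)" "lev \<xi> \<ge> 1" for \<xi>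
  proof -
    have "real (nat \<lfloor>\<psi> \<xi>\<rfloor>) = of_int \<lfloor>\<psi> \<xi>\<rfloor>" using psi[of \<xi>] by simp
    then show "real (lev \<xi>) - 1 \<le> \<psi> \<xi>" "\<psi> \<xi> \<le> real (lev \<xi>)" "lev \<xi> \<ge> 1" unfolding lev_def by linarith+
  qed
  define J where "J = Max (lev ` {..<M})"
  have "A \<le> (\<Sum>\<xi><M. \<Sum>m\<in>{1..J}. if \<xi> \<in> S m then exp (- c * (real m - 1)) else 0)"
  proof (rule order_trans[OF total sum_mono])
    fix \<xi> assume \<xi>: "\<xi> \<in> {..<M}"
    have "lev \<xi> \<le> J" unfolding J_def using \<xi> by (intro Max_ge) auto
    then have J: "lev \<xi> \<in> {1..J}" using lev(3) by auto
    have "exp (- c * \<psi> \<xi>) \<le> exp (- c * (real (lev \<xi>) - 1))" using lev(1)[of \<xi>] c by simp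
    also have "\<dots> = (if \<xi> \<in> S (lev \<xi>) then exp (- c * (real (lev \<xi>) - 1)) else 0)"
      using lev(2)[of \<xi>] \<xi> by (simp add: S_def)
    also have "\<dots> \<le> (\<Sum>m\<in>{1..J}. if \<xi> \<in> S m then exp (- c * (real m - 1)) else 0)"
      by (rule member_le_sum[OF J, where f = "\<lambda>m. if \<xi> \<in> S m then exp (- c * (real m - 1)) else 0"]) auto
    finally show "exp (- c * \<psi> \<xi>) \<le> (\<Sum>m\<in>{1..J}. if \<xi> \<in> S m then exp (- c * (real m - 1)) else 0)" .
  qed
  also have "\<dots> = (\<Sum>m\<in>{1..J}. \<Sum>\<xi><M. if \<xi> \<in> S m then exp (- c * (real m - 1)) else 0)" by (rule sum.swap)
  also have "\<dots> = (\<Sum>m\<in>{1..J}. real (card (S m)) * exp (- c * (real m - 1)))"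
  proof (intro sum.cong refl)
    fix m
    have "{\<xi>\<in>{..<M}. \<xi> \<in> S m} = S m" by (auto simp: S_def)
    then show "(\<Sum>\<xi><M. if \<xi> \<in> S m then exp (- c * (real m - 1)) else 0) = real (card (S m)) * exp (- c * (real m - 1))"
      by (simp add: sum.inter_filter[symmetric])
  qed
  also have "\<dots> \<le> (\<Sum>m\<in>{1..J}. (1 - q) * A * q ^ m)"
  proof (rule sum_mono)
    fix m assume "m \<in> {1..J}"
    then have "real (card (S m)) * exp (- c * (real m - 1)) \<le>
        (exp (- c) * (1 - q) * A * exp (c * real m / 2)) * exp (- c * (real m - 1))"
      using less_imp_le[OF Sm[of m]] by (intro mult_right_mono) auto
    also have "\<dots> = (1 - q) * A * (exp (- c) * exp (c * real m / 2) * exp (- c * (real m - 1)))" by simp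
    also have "exp (- c) * exp (c * real m / 2) * exp (- c * (real m - 1)) = q ^ m"
      unfolding q_def exp_of_nat_mult[symmetric] exp_add[symmetric]
      by (rule arg_cong[where f = exp]) (simp add: field_simps)
    finally show "real (card (S m)) * exp (- c * (real m - 1)) \<le> (1 - q) * A * q ^ m" .
  qed
  also have "\<dots> = A * ((1 - q) * (\<Sum>m\<in>{1..J}. q ^ m))" by (simp add: sum_distrib_left mult_ac)
  also have "\<dots> < A * 1"
  proof (rule mult_strict_left_mono[OF _ A])
    have "(1 - q) * (\<Sum>m\<in>{1..J}. q ^ m) = q * ((1 - q) * (\<Sum>m<J. q ^ m))"
      unfolding sum_distrib_left by (rule sum.reindex_bij_witness[of _ Suc "\<lambda>m. m - 1"]) (auto simp: power_eq_if)
    also have "(1 - q) * (\<Sum>m<J. q ^ m) = 1 - q ^ J" using q(2) by (simp add: sum_gp_strict)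
    also have "q * (1 - q ^ J) \<le> q * 1" using q by (intro mult_left_mono) auto
    also have "\<dots> < 1" using q by simp
    finally show "(1 - q) * (\<Sum>m\<in>{1..J}. q ^ m) < 1" .
  qed
  finally show False by simp
qed

section \<open>Products of differences over quadruples of indices\<close>

abbreviation quads :: "nat \<Rightarrow> (nat \<times> nat \<times> nat \<times> nat) set" where
  "quads n \<equiv> {1..n} \<times> {1..n} \<times> {1..n} \<times> {1..n}"

definition quad_prod :: "(nat \<Rightarrow> int) \<Rightarrow> (nat \<Rightarrow> int) \<Rightarrow> nat \<times> nat \<times> nat \<times> nat \<Rightarrow> int" where
  "quad_prod a b = (\<lambda>(i, j, k, l). (a i - a j) * (b k - b l))"

lemma card_quads: "card (quads n) = n ^ 4"
  by (simp add: card_cartesian_product power4_eq_xxxx)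

lemma quad_energy_quads:
  "quad_energy n (\<lambda>i. t * of_int (a i)) (\<lambda>i. of_int (b i)) =
     (\<Sum>q\<in>quads n. (sin (of_int (quad_prod a b q) * (pi * t)))\<^sup>2)"
proof -
  have "quad_energy n (\<lambda>i. t * of_int (a i)) (\<lambda>i. of_int (b i)) =
     (\<Sum>i=1..n. \<Sum>j=1..n. \<Sum>k=1..n. \<Sum>l=1..n. (sin (of_int (quad_prod a b (i, j, k, l)) * (pi * t)))\<^sup>2)"
    unfolding quad_energy_def quad_prod_def
    by (intro sum.cong refl arg_cong[where f = "\<lambda>x. (sin x)\<^sup>2"]) (simp add: algebra_simps)
  then show ?thesis by (simp add: sum.cartesian_product split_def)
qed

lemma card_markov:
  fixes f :: "'a \<Rightarrow> real"
  assumes "finite A" "\<And>x. x \<in> A \<Longrightarrow> f x \<ge> 0" "(\<Sum>x\<in>A. f x) \<le> W" "T > 0"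
  shows "real (card {x\<in>A. f x \<le> T}) \<ge> real (card A) - W / T"
proof -
  define Z where "Z = {x\<in>A. f x > T}"
  have "real (card Z) * T = (\<Sum>x\<in>Z. T)" by simp
  also have "\<dots> \<le> (\<Sum>x\<in>Z. f x)" by (intro sum_mono) (auto simp: Z_def)
  also have "\<dots> \<le> (\<Sum>x\<in>A. f x)" using assms by (intro sum_mono2) (auto simp: Z_def)
  finally have "real (card Z) \<le> W / T" using assms(3,4) by (simp add: pos_le_divide_eq)
  moreover have "card A = card {x\<in>A. f x \<le> T} + card Z"
  proof -
    have "A = {x\<in>A. f x \<le> T} \<union> Z" by (auto simp: Z_def)
    moreover have "card ({x\<in>A. f x \<le> T} \<union> Z) = card {x\<in>A. f x \<le> T} + card Z"
      using assms(1) by (intro card_Un_disjoint) (auto simp: Z_def)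
    ultimately show ?thesis by metis
  qed
  ultimately show ?thesis by simp
qed

lemma power_le_fact_exp:
  assumes "x \<ge> (0::real)"
  shows "x ^ r \<le> fact r * exp x"
proof -
  have "(\<Sum>n\<in>{r}. x ^ n / fact n) \<le> (\<Sum>n. x ^ n / fact n)"
    using summable_exp[of x] assms by (intro sum_le_suminf) (auto simp: divide_inverse mult.commute)
  then have "x ^ r / fact r \<le> exp x" by (simp add: exp_def divide_inverse mult.commute)
  then show ?thesis by (simp add: field_simps)
qed

lemma ksum_abs_le:
  assumes "\<And>d. d \<in> V \<Longrightarrow> \<bar>d\<bar> \<le> D" "z \<in> ksum V k" "D \<ge> 0"
  shows "\<bar>z\<bar> \<le> int k * D"
proof -
  obtain c where c: "l1 V c \<le> int k" "z = ival V c" using assms(2) by (auto simp: ksum_def)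
  have "\<bar>z\<bar> \<le> (\<Sum>d\<in>V. \<bar>c d * d\<bar>)" unfolding c(2) ival_def by (rule sum_abs)
  also have "\<dots> \<le> (\<Sum>d\<in>V. \<bar>c d\<bar> * D)"
    using assms(1) by (intro sum_mono) (auto simp: abs_mult intro!: mult_left_mono)
  also have "\<dots> = l1 V c * D" by (simp add: l1_def sum_distrib_right)
  also have "\<dots> \<le> int k * D" using c(1) assms(3) by (rule mult_right_mono)
  finally show ?thesis .
qed

text \<open>The level set of the energy at level \<open>m\<close> is dual to the \<open>k\<close>-fold sumset of the products that are
  not exceptional on it, as long as \<open>k\<^sup>2 \<le> n' / (4 m)\<close>.\<close>
lemma concentrated_products:
  fixes a b :: "nat \<Rightarrow> int"
  defines "c \<equiv> exp (- 4) / (6::real)"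
  defines "c1 \<equiv> exp (- c) * (1 - exp (- c / 2))"
  assumes n: "n \<ge> 2" and \<rho>: "0 < \<rho>" "\<rho> \<le> real (card {\<pi>\<in>perms n. (\<Sum>i=1..n. a i * b (\<pi> i)) = x}) / fact n"
    and n': "0 < n'" "n' \<le> real n"
  shows "\<exists>m G. m \<ge> 1 \<and> c1 * \<rho> * exp (c * real m / 2) \<le> 1 \<and> G \<subseteq> quads n \<and>
     real (card G) \<ge> (1 - n' / real n) * real n ^ 4 \<and>
     (\<forall>k. (real k)\<^sup>2 * (real m / n') \<le> 1 / 4 \<longrightarrow> k \<le> n \<longrightarrow>
        c1 * \<rho> * exp (c * real m / 2) * real (card (ksum (quad_prod a b ` G) k)) \<le> 4)"
proof -
  define D where "D = (\<Sum>q\<in>quads n. \<bar>quad_prod a b q\<bar>)"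
  have D: "D \<ge> 0" "\<And>q. q \<in> quads n \<Longrightarrow> \<bar>quad_prod a b q\<bar> \<le> D"
    unfolding D_def by (auto intro!: sum_nonneg member_le_sum)
  \<comment> \<open>A modulus beyond \<open>2 * n * D\<close> excludes wrap-around for sums of at
    most \<open>n\<close> products.\<close>
  define M where "M = nat (2 * int n * D + 1)"
  have M: "M > 0" "int M = 2 * int n * D + 1" using D(1) by (auto simp: M_def)
  define \<psi> where "\<psi> \<xi> = quad_energy n (\<lambda>i. real \<xi> / real M * of_int (a i)) (\<lambda>i. of_int (b i)) / real n ^ 3" for \<xi>
  have psi0: "0 \<le> \<psi> \<xi>" for \<xi> unfolding \<psi>_def quad_energy_def by (intro divide_nonneg_nonneg sum_nonneg) auto
  have c: "c > 0" by (simp add: c_def)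
  have c1: "c1 > 0" using c by (simp add: c1_def)
  have tot: "\<rho> * real M \<le> (\<Sum>\<xi><M. exp (- c * \<psi> \<xi>))"
    using mult_right_mono[OF \<rho>(2), of "real M"] concentration_fourier[OF n M(1), of a b x]
    unfolding \<psi>_def c_def by linarith
  obtain m :: nat where m: "m \<ge> 1" "c1 * (\<rho> * real M) * exp (c * real m / 2) \<le> real (card {\<xi>. \<xi> < M \<and> \<psi> \<xi> \<le> real m})"
    using level_set_exists[OF c psi0 tot] \<rho>(1) M(1) unfolding c1_def by auto
  define S where "S = {\<xi>. \<xi> < M \<and> \<psi> \<xi> \<le> real m}"
  have S: "S \<subseteq> {..<M}" by (auto simp: S_def)
  define x1 where "x1 = c1 * \<rho> * exp (c * real m / 2)"
  have x1: "x1 > 0" using c1 \<rho>(1) by (simp add: x1_def)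
  have xS: "x1 * real M \<le> real (card S)" using m(2) by (simp add: x1_def S_def mult_ac)
  \<comment> \<open>The level set cannot exceed the whole range; with a polynomial lower bound on
    \<rho> the resulting inequality forces \<open>m\<close> to be O(log n).\<close>
  have "card S \<le> M" using card_mono[OF _ S] by simp
  then have "x1 * real M \<le> 1 * real M" using xS by linarith
  then have x1le: "x1 \<le> 1" using M(1) by simp
  have S0: "real (card S) > 0" using xS x1 M(1) by (metis less_le_trans mult_pos_pos of_nat_0_less_iff)
  then have Sne: "S \<noteq> {}" by auto
  define f where "f q = (\<Sum>\<xi>\<in>S. (sin (of_int (quad_prod a b q) * (pi * (real \<xi> / real M))))\<^sup>2)" for q
  have fsum: "(\<Sum>q\<in>quads n. f q) \<le> real n ^ 3 * real m * real (card S)"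
  proof -
    have "(\<Sum>q\<in>quads n. f q) = (\<Sum>\<xi>\<in>S. \<psi> \<xi> * real n ^ 3)"
      unfolding f_def \<psi>_def quad_energy_quads using n by (subst sum.swap) simp
    also have "\<dots> \<le> (\<Sum>\<xi>\<in>S. real m * real n ^ 3)" by (intro sum_mono mult_right_mono) (auto simp: S_def)
    finally show ?thesis by (simp add: mult_ac)
  qed
  \<comment> \<open>The threshold for Markov's inequality: the total of \<open>f\<close> is at most
    n^3 m card S, so at most n^3 n' quadruples are exceptional, the proportion n' / n.\<close>
  define e where "e = real m / n'"
  have e: "e > 0" using m(1) n'(1) by (simp add: e_def)
  define G where "G = {q\<in>quads n. f q \<le> e * real (card S)}"
  have cardG: "real (card G) \<ge> (1 - n' / real n) * real n ^ 4"
  proof -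
    have "real (card (quads n)) - real n ^ 3 * real m * real (card S) / (e * real (card S)) \<le> real (card G)"
      unfolding G_def by (rule card_markov[OF _ _ fsum]) (use e S0 in \<open>auto simp: f_def intro!: sum_nonneg\<close>)
    moreover have "real n ^ 3 * real m * real (card S) / (e * real (card S)) = real n ^ 3 * n'"
      using S0 m(1) n'(1) by (simp add: e_def)
    moreover have "(1 - n' / real n) * real n ^ 4 = real n ^ 4 - real n ^ 3 * n'"
      using n by (simp add: left_diff_distrib power4_eq_xxxx power3_eq_cube)
    ultimately show ?thesis by (simp only: card_quads of_nat_power)
  qed
  have final: "x1 * real (card (ksum (quad_prod a b ` G) k)) \<le> 4" if k: "(real k)\<^sup>2 * (real m / n') \<le> 1 / 4" "k \<le> n" for k
  proof -
    have "real (card (ksum (quad_prod a b ` G) k)) * real (card S) \<le> 4 * real M"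
    proof (rule dual_sumset_bound[OF M(1) S Sne])
      show "finite (quad_prod a b ` G)" unfolding G_def by simp
      show "(\<Sum>\<xi>\<in>S. (sin (of_int d * (pi * (real \<xi> / real M))))\<^sup>2) \<le> e * real (card S)"
        if "d \<in> quad_prod a b ` G" for d using that by (auto simp: G_def f_def)
      show "(real k)\<^sup>2 * e \<le> 1 / 4" "0 \<le> e" using k(1) e by (auto simp: e_def)
      fix z assume z: "z \<in> ksum (quad_prod a b ` G) k"
      have "\<bar>z\<bar> \<le> int k * D" by (rule ksum_abs_le[OF _ z D(1)]) (use D(2) in \<open>auto simp: G_def\<close>)
      also have "\<dots> \<le> int n * D" using k(2) D(1) by (intro mult_right_mono) auto
      finally show "2 * \<bar>z\<bar> < int M" using M(2) by linarith
    qed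
    then have "real (card (ksum (quad_prod a b ` G) k)) * (x1 * real M) \<le> 4 * real M"
      using mult_left_mono[OF xS, of "real (card (ksum (quad_prod a b ` G) k))"] by linarith
    then have "(x1 * real (card (ksum (quad_prod a b ` G) k))) * real M \<le> 4 * real M" by (simp add: mult_ac)
    then show ?thesis using M(1) by simp
  qed
  have "G \<subseteq> quads n" unfolding G_def by auto
  then show ?thesis using m(1) x1le cardG final unfolding x1_def by blast
qed

text \<open>The surplus of the level set absorbs the loss from k^2 \<ge> n' / (16 m), which is where
  the factor 16 comes from.\<close>

lemma level_power_bound:
  assumes c: "c > (0::real)"
  shows "\<exists>K>0. \<forall>d\<le>R. \<forall>m\<ge>1. (16 * real m) powr (real d / 2) * exp (- (c * real m / 2)) \<le> K"
proof -
  define K where "K = (16 * (2 / c)) ^ R * fact R"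
  show ?thesis
  proof (intro exI[of _ K] conjI allI impI)
    show "K > 0" using c by (simp add: K_def)
    fix d m :: nat assume d: "d \<le> R" and m: "m \<ge> 1"
    have "(16 * real m) powr (real d / 2) \<le> (16 * real m) powr (real R)"
      using m d by (intro powr_mono) auto
    also have "\<dots> = (16 * real m) ^ R" using m by (simp add: powr_realpow)
    also have "\<dots> = (16 * (2 / c)) ^ R * (c * real m / 2) ^ R"
    proof -
      have "16 * real m = (16 * (2 / c)) * (c * real m / 2)" using c by simp
      from arg_cong[OF this, of "\<lambda>x. x ^ R"] show ?thesis by (rule trans[OF _ power_mult_distrib])
    qed
    also have "\<dots> \<le> (16 * (2 / c)) ^ R * (fact R * exp (c * real m / 2))"
      using c by (intro mult_left_mono power_le_fact_exp) auto
    finally have "(16 * real m) powr (real d / 2) \<le> K * exp (c * real m / 2)" by (simp add: K_def mult.assoc)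
    then have "(16 * real m) powr (real d / 2) * exp (- (c * real m / 2)) \<le> K * exp (c * real m / 2) * exp (- (c * real m / 2))"
      by (intro mult_right_mono) auto
    also have "\<dots> = K" by (simp add: exp_minus)
    finally show "(16 * real m) powr (real d / 2) * exp (- (c * real m / 2)) \<le> K" .
  qed
qed

text \<open>To have k \<ge> n^(\<epsilon>/3) after rounding, n' must be at least 16 m
  n^(2\<epsilon>/3). As n' may be as small as n^\<epsilon>, the logarithmic \<open>m\<close> has to
  be beaten by the spare n^(\<epsilon>/3).\<close>

lemma eventually_log_level:
  fixes A B \<epsilon> :: real
  assumes "\<epsilon> > 0"
  shows "\<forall>\<^sub>F n in sequentially. 16 * real n powr (2 * \<epsilon> / 3) * (A * ln (real n) + B) \<le> real n powr \<epsilon>"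
proof -
  have "(\<lambda>n. ln (real n) / real n powr (\<epsilon> / 3)) \<longlonglongrightarrow> 0" "(\<lambda>n. 1 / real n powr (\<epsilon> / 3)) \<longlonglongrightarrow> 0"
    using assms by real_asymp+
  then have "(\<lambda>n. 16 * (A * (ln (real n) / real n powr (\<epsilon> / 3)) + B * (1 / real n powr (\<epsilon> / 3)))) \<longlonglongrightarrow>
      16 * (A * 0 + B * 0)" by (intro tendsto_intros)
  then have "\<forall>\<^sub>F n in sequentially. 16 * (A * (ln (real n) / real n powr (\<epsilon> / 3)) + B * (1 / real n powr (\<epsilon> / 3))) < 1"
    by (rule order_tendstoD) simp
  moreover have "\<forall>\<^sub>F n in sequentially. (1::nat) \<le> n" by (rule eventually_ge_at_top)
  ultimately show ?thesis
  proof eventually_elim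
    case (elim n)
    define p where "p = real n powr (\<epsilon> / 3)"
    have p: "p > 0" using elim(2) by (simp add: p_def)
    have p2: "real n powr (2 * \<epsilon> / 3) = p * p" "real n powr \<epsilon> = p * p * p"
      unfolding p_def powr_add[symmetric] by simp_all
    have "16 * (A * ln (real n) + B) / p \<le> 1" using elim(1) by (simp add: p_def add_divide_distrib algebra_simps)
    then have "16 * (A * ln (real n) + B) \<le> p" using p by (simp add: field_simps)
    then have "(p * p) * (16 * (A * ln (real n) + B)) \<le> (p * p) * p" using p by (intro mult_left_mono) auto
    then show ?case unfolding p2 by (simp add: mult_ac)
  qed
qed

lemma discrete_inverse:
  fixes C1 \<epsilon> :: real
  assumes C1: "C1 > 0" and \<epsilon>: "\<epsilon> > 0"
  shows "\<exists>n0 R K. 0 < K \<and> (\<forall>n\<ge>n0. \<forall>(a::nat \<Rightarrow> int) (b::nat \<Rightarrow> int) x \<rho> n' \<eta>.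
    0 < \<rho> \<longrightarrow> \<rho> \<le> real (card {\<pi>\<in>perms n. (\<Sum>i=1..n. a i * b (\<pi> i)) = x}) / fact n \<longrightarrow>
    real n powr (- C1) \<le> \<rho> \<longrightarrow> real n powr \<epsilon> \<le> n' \<longrightarrow> n' \<le> real n \<longrightarrow>
    (\<exists>d\<le>R. \<exists>Q. proper_symmetric_gap d Q \<and> real (card Q) \<le> K * inverse \<rho> * n' powr (- real d / 2) \<and>
       real (card {q\<in>quads n. \<eta> * of_int (quad_prod a b q) \<in> Q}) \<ge> (1 - n' / real n) * real n ^ 4))"
proof -
  define c where "c = exp (- 4) / (6::real)"
  define c1 where "c1 = exp (- c) * (1 - exp (- c / 2))"
  have c: "c > 0" by (simp add: c_def)
  have c1: "c1 > 0" using c by (simp add: c1_def)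
  \<comment> \<open>The sumset has at most n^(C1 + 1) elements and k is at least n^(\<epsilon>/3);
    this exponent turns the former into a power of the latter.\<close>
  define \<gamma> where "\<gamma> = nat \<lceil>3 * (C1 + 1) / \<epsilon>\<rceil>"
  have \<gamma>: "C1 + 1 \<le> \<epsilon> / 3 * real \<gamma>"
  proof -
    have "3 * (C1 + 1) / \<epsilon> \<le> real \<gamma>" unfolding \<gamma>_def by linarith
    then show ?thesis using \<epsilon> by (simp add: field_simps)
  qed
  obtain R CC k0 where CC: "0 < CC" and LR0: "\<forall>k\<ge>k0. \<forall>X \<eta>. finite X \<longrightarrow> card (ksum X k) \<le> k ^ \<gamma> \<longrightarrow>
     (\<exists>d\<le>R. \<exists>Q. proper_symmetric_gap d Q \<and> (\<forall>x\<in>X. \<eta> * real_of_int x \<in> Q) \<and>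
        real (card Q) * real k ^ d \<le> CC * real (card (ksum X k)))"
    using long_range_inverse[of \<gamma>] by (elim exE conjE) (rule that)
  note LR = LR0[rule_format]
  obtain K1 where K1: "K1 > 0"
    and K1_bound: "\<forall>d\<le>R. \<forall>m\<ge>1. (16 * real m) powr (real d / 2) * exp (- (c * real m / 2)) \<le> K1"
    using level_power_bound[OF c, of R] by (elim exE conjE) (rule that)
  have "\<forall>\<^sub>F n in sequentially. 16 * real n powr (2 * \<epsilon> / 3) * ((2 / c) * (C1 * ln (real n) - ln c1)) \<le> real n powr \<epsilon>"
    using eventually_log_level[OF \<epsilon>, of "2 / c * C1" "- (2 / c * ln c1)"] by (simp add: algebra_simps)
  moreover have "\<forall>\<^sub>F n in sequentially. real k0 \<le> real n powr (\<epsilon> / 3)" using \<epsilon> by real_asymp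
  moreover have "\<forall>\<^sub>F n in sequentially. 4 / c1 \<le> real n" by real_asymp
  moreover have "\<forall>\<^sub>F n in sequentially. (2::nat) \<le> n" by (rule eventually_ge_at_top)
  ultimately have "\<forall>\<^sub>F n in sequentially.
      16 * real n powr (2 * \<epsilon> / 3) * ((2 / c) * (C1 * ln (real n) - ln c1)) \<le> real n powr \<epsilon> \<and>
      real k0 \<le> real n powr (\<epsilon> / 3) \<and> 4 / c1 \<le> real n \<and> 2 \<le> n" by eventually_elim auto
  then obtain n0 where n0: "\<And>n. n \<ge> n0 \<Longrightarrow>
      16 * real n powr (2 * \<epsilon> / 3) * ((2 / c) * (C1 * ln (real n) - ln c1)) \<le> real n powr \<epsilon> \<and>
      real k0 \<le> real n powr (\<epsilon> / 3) \<and> 4 / c1 \<le> real n \<and> 2 \<le> n" by (auto simp: eventually_sequentially)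
  define K where "K = CC * (4 / c1) * K1"
  show ?thesis
  proof (rule exI[of _ n0], rule exI[of _ R], rule exI[of _ K], intro conjI allI impI)
    show "0 < K" using CC c1 K1 by (simp add: K_def)
    fix n and a b :: "nat \<Rightarrow> int" and x \<rho> n' \<eta>
    assume n: "n0 \<le> n" and \<rho>: "0 < \<rho>" "\<rho> \<le> real (card {\<pi>\<in>perms n. (\<Sum>i=1..n. a i * b (\<pi> i)) = x}) / fact n"
      and \<rho>C: "real n powr (- C1) \<le> \<rho>" and n': "real n powr \<epsilon> \<le> n'" "n' \<le> real n"
    have n2: "n \<ge> 2" and nk: "real k0 \<le> real n powr (\<epsilon> / 3)" and nc: "4 / c1 \<le> real n"
      and nl: "16 * real n powr (2 * \<epsilon> / 3) * ((2 / c) * (C1 * ln (real n) - ln c1)) \<le> real n powr \<epsilon>"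
      using n0[OF n] by auto
    have n'0: "n' > 0" using n2 by (intro less_le_trans[OF _ n'(1)]) simp
    obtain m G where m: "m \<ge> 1" "c1 * \<rho> * exp (c * real m / 2) \<le> 1" and G: "G \<subseteq> quads n"
      "real (card G) \<ge> (1 - n' / real n) * real n ^ 4"
      and dual: "\<And>k. (real k)\<^sup>2 * (real m / n') \<le> 1 / 4 \<Longrightarrow> k \<le> n \<Longrightarrow>
        c1 * \<rho> * exp (c * real m / 2) * real (card (ksum (quad_prod a b ` G) k)) \<le> 4"
      using concentrated_products[OF n2 \<rho> n'0 n'(2)] unfolding c_def c1_def by blast
    have lnm: "real m \<le> (2 / c) * (C1 * ln (real n) - ln c1)"
    proof -
      have "c1 * real n powr (- C1) * exp (c * real m / 2) \<le> c1 * \<rho> * exp (c * real m / 2)"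
        using \<rho>C c1 by (intro mult_right_mono mult_left_mono) auto
      then have "c1 * real n powr (- C1) * exp (c * real m / 2) \<le> 1" using m(2) by linarith
      then have "ln (c1 * real n powr (- C1) * exp (c * real m / 2)) \<le> 0"
        using c1 n2 by (subst ln_le_zero_iff) auto
      then have "ln c1 - C1 * ln (real n) + c * real m / 2 \<le> 0"
        using c1 n2 by (simp add: ln_mult ln_powr)
      then show ?thesis using c by (simp add: field_simps)
    qed
    \<comment> \<open>The largest dilation that duality permits. Since s \<ge> 2, taking the integer
      part costs at most a factor 2.\<close>
    define s where "s = sqrt (n' / (4 * real m))"
    define k where "k = nat \<lfloor>s\<rfloor>"
    have s2: "s\<^sup>2 = n' / (4 * real m)" unfolding s_def using n'0 by simp
    have s0: "s \<ge> 0" unfolding s_def using n'0 by simp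
    have s_ge: "s \<ge> 2 * real n powr (\<epsilon> / 3)"
      unfolding s_def
    proof (rule real_le_rsqrt)
      have "16 * real n powr (2 * \<epsilon> / 3) * real m \<le> n'"
        using mult_left_mono[OF lnm, of "16 * real n powr (2 * \<epsilon> / 3)"] nl n'(1) by simp
      moreover have "(2 * real n powr (\<epsilon> / 3))\<^sup>2 = 4 * real n powr (2 * \<epsilon> / 3)"
        by (simp add: power_mult_distrib power2_eq_square powr_add[symmetric])
      ultimately show "(2 * real n powr (\<epsilon> / 3))\<^sup>2 \<le> n' / (4 * real m)" using m(1) by (simp add: field_simps)
    qed
    have pw1: "real n powr (\<epsilon> / 3) \<ge> 1" using n2 \<epsilon> by (intro ge_one_powr_ge_zero) auto
    have ks: "real k \<le> s" "s \<le> 2 * real k"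
    proof -
      have s1: "s \<ge> 2" using s_ge pw1 by linarith
      then show "real k \<le> s" unfolding k_def by linarith
      show "s \<le> 2 * real k" using s1 unfolding k_def by linarith
    qed
    have kpw: "real n powr (\<epsilon> / 3) \<le> real k" using s_ge ks(2) by linarith
    have k2: "(real k)\<^sup>2 \<le> n' / (4 * real m)" unfolding s2[symmetric] using ks(1) by (intro power_mono) auto
    have kd: "(real k)\<^sup>2 * (real m / n') \<le> 1 / 4"
    proof -
      have "(real k)\<^sup>2 * (real m / n') \<le> n' / (4 * real m) * (real m / n')"
        using k2 n'0 by (intro mult_right_mono) auto
      also have "\<dots> = 1 / 4" using n'0 m(1) by simp
      finally show ?thesis .
    qed
    have k1: "k \<ge> 1" using kpw pw1 by linarith
    have kn: "k \<le> n"
    proof -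
      have "real k * 1 \<le> real k * real k" using k1 by (intro mult_left_mono) auto
      also have "\<dots> \<le> n' / (4 * real m)" using k2 by (simp add: power2_eq_square)
      also have "\<dots> \<le> n' / 1" using n'0 m(1) by (intro divide_left_mono) auto
      finally show ?thesis using n'(2) by linarith
    qed
    define X where "X = quad_prod a b ` G"
    have "finite G" by (rule finite_subset[OF G(1)]) simp
    then have finX: "finite X" unfolding X_def by (rule finite_imageI)
    have cardX: "real (card (ksum X k)) \<le> 4 / (c1 * \<rho>) * exp (- (c * real m / 2))"
    proof -
      have d4: "c1 * \<rho> * exp (c * real m / 2) * real (card (ksum X k)) \<le> 4"
        unfolding X_def by (rule dual[OF kd kn])
      have "c1 * \<rho> * exp (c * real m / 2) > 0" using c1 \<rho>(1) by simp
      then have "real (card (ksum X k)) \<le> 4 / (c1 * \<rho> * exp (c * real m / 2))"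
        by (rule mult_imp_le_div_pos) (rule ord_eq_le_trans[OF mult.commute d4])
      also have "\<dots> = 4 / (c1 * \<rho>) * exp (- (c * real m / 2))"
        unfolding exp_minus by (simp add: field_simps)
      finally show ?thesis .
    qed
    have "card (ksum X k) \<le> k ^ \<gamma>"
    proof -
      have "exp (- (c * real m / 2)) \<le> 1" using c by simp
      then have "4 / (c1 * \<rho>) * exp (- (c * real m / 2)) \<le> 4 / (c1 * \<rho>) * 1"
        using c1 \<rho>(1) by (intro mult_left_mono) auto
      also have "\<dots> = 4 / c1 * inverse \<rho>" by (simp add: field_simps)
      finally have "real (card (ksum X k)) \<le> 4 / c1 * inverse \<rho>" using cardX by (rule order_trans[rotated])
      also have "\<dots> \<le> real n * real n powr C1"
      proof (rule mult_mono[OF nc])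
        have "inverse \<rho> \<le> inverse (real n powr (- C1))" using \<rho>C n2 by (intro le_imp_inverse_le) auto
        then show "inverse \<rho> \<le> real n powr C1" by (simp add: powr_minus)
      qed (use \<rho> in auto)
      also have "\<dots> = real n powr (C1 + 1)" using n2 by (simp add: powr_add)
      also have "\<dots> \<le> real n powr (\<epsilon> / 3 * real \<gamma>)" using \<gamma> n2 by (intro powr_mono) auto
      also have "\<dots> = (real n powr (\<epsilon> / 3)) ^ \<gamma>" using n2 by (simp add: powr_power mult_ac)
      also have "\<dots> \<le> real k ^ \<gamma>" using kpw by (intro power_mono) auto
      finally show ?thesis by (simp flip: of_nat_power)
    qed
    moreover have "k \<ge> k0" using nk kpw by linarith
    ultimately obtain d Q where d: "d \<le> R" and Q: "proper_symmetric_gap d Q" "\<And>y. y \<in> X \<Longrightarrow> \<eta> * real_of_int y \<in> Q"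
      "real (card Q) * real k ^ d \<le> CC * real (card (ksum X k))"
      using LR[of k X \<eta>] finX by blast
    have "real (card Q) \<le> K * inverse \<rho> * n' powr (- real d / 2)"
    proof -
      have "n' / (16 * real m) \<le> (real k)\<^sup>2"
        using power_mono[OF ks(2) s0, of 2] unfolding s2 by (simp add: power_mult_distrib field_simps)
      then have "(n' / (16 * real m)) powr (real d / 2) \<le> ((real k)\<^sup>2) powr (real d / 2)"
        using n'0 by (intro powr_mono2) auto
      also have "((real k)\<^sup>2) powr (real d / 2) = real k ^ d"
        using k1 by (simp add: powr_realpow[symmetric] powr_powr flip: powr_numeral)
      finally have kpow: "n' powr (real d / 2) / (16 * real m) powr (real d / 2) \<le> real k ^ d"
        using n'0 by (simp add: powr_divide)
      have pos: "(16 * real m) powr (real d / 2) > 0" "n' powr (real d / 2) > 0" using m(1) n'0 by auto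
      have "real (card Q) * (n' powr (real d / 2) / (16 * real m) powr (real d / 2)) \<le> real (card Q) * real k ^ d"
        using kpow by (intro mult_left_mono) auto
      also have "\<dots> \<le> CC * (4 / (c1 * \<rho>) * exp (- (c * real m / 2)))"
        using Q(3) mult_left_mono[OF cardX, of CC] CC by linarith
      finally have "real (card Q) * n' powr (real d / 2) \<le>
          CC * (4 / (c1 * \<rho>) * exp (- (c * real m / 2))) * (16 * real m) powr (real d / 2)"
        using pos by (simp add: field_simps)
      also have "\<dots> = CC * (4 / c1) * inverse \<rho> * ((16 * real m) powr (real d / 2) * exp (- (c * real m / 2)))"
        by (simp add: field_simps)
      also have "\<dots> \<le> CC * (4 / c1) * inverse \<rho> * K1"
        using K1_bound[rule_format, OF d m(1)] CC c1 \<rho>(1) by (intro mult_left_mono) auto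
      also have "\<dots> = K * inverse \<rho>" by (simp add: K_def mult_ac)
      finally have "real (card Q) * n' powr (real d / 2) * n' powr (- (real d / 2)) \<le> K * inverse \<rho> * n' powr (- (real d / 2))"
        by (rule mult_right_mono) simp
      then show ?thesis using n'0 by (simp add: mult.assoc powr_add[symmetric])
    qed
    moreover have "(1 - n' / real n) * real n ^ 4 \<le> real (card {q\<in>quads n. \<eta> * of_int (quad_prod a b q) \<in> Q})"
    proof -
      have "G \<subseteq> {q\<in>quads n. \<eta> * of_int (quad_prod a b q) \<in> Q}" using G(1) Q(2) unfolding X_def by blast
      then have "card G \<le> card {q\<in>quads n. \<eta> * of_int (quad_prod a b q) \<in> Q}" by (intro card_mono) auto
      then show ?thesis using G(2) by linarith
    qed
    ultimately show "\<exists>d\<le>R. \<exists>Q. proper_symmetric_gap d Q \<and> real (card Q) \<le> K * inverse \<rho> * n' powr (- real d / 2) \<and>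
       real (card {q\<in>quads n. \<eta> * of_int (quad_prod a b q) \<in> Q}) \<ge> (1 - n' / real n) * real n ^ 4"
      using d Q(1) by blast
  qed
qed

section \<open>Discretisation\<close>

lemma unit_vec_abs_le:
  assumes "unit_vec n w" "i \<in> {1..n}"
  shows "\<bar>w i\<bar> \<le> 1"
proof -
  have "(\<Sum>i=1..n. (w i)\<^sup>2) = 1" using assms(1) by (simp add: unit_vec_def L2_set_def)
  moreover have "(w i)\<^sup>2 \<le> (\<Sum>i=1..n. (w i)\<^sup>2)" using assms(2) by (intro member_le_sum) auto
  ultimately show ?thesis by (simp add: abs_square_le_1)
qed

lemma prob_random_perm: "measure_pmf.prob (random_perm n) A = real (card (perms n \<inter> A)) / fact n"
proof -
  have "id \<in> perms n" by (simp add: permutes_id)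
  then have "perms n \<noteq> {}" by blast
  note prob = measure_pmf_of_set[OF this finite_perms, of A]
  have "card (perms n) = fact n" by (rule card_permutations) simp_all
  then have "real (card (perms n)) = fact n" by simp
  then show ?thesis unfolding random_perm_def prob by (simp only:)
qed

lemma popular_value:
  fixes f :: "'a \<Rightarrow> int"
  assumes E: "finite E" "E \<noteq> {}" and J: "finite J" "f ` E \<subseteq> J" "real (card J) \<le> N"
  shows "\<exists>z. real (card E) / N \<le> real (card {x\<in>E. f x = z})"
proof (rule ccontr)
  assume "\<not> ?thesis"
  then have lt: "real (card {x\<in>E. f x = z}) < real (card E) / N" for z by (simp add: not_le)
  have Jne: "J \<noteq> {}" using E(2) J(2) by auto
  have N: "N > 0" using J(1,3) Jne by (metis card_gt_0_iff less_le_trans of_nat_0_less_iff)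
  have "card E = (\<Sum>z\<in>J. card {x\<in>E. f x = z})"
    using sum.group[OF E(1) J(1,2), of "\<lambda>_. 1::nat"] by simp
  then have "real (card E) = (\<Sum>z\<in>J. real (card {x\<in>E. f x = z}))" by simp
  also have "\<dots> < (\<Sum>z\<in>J. real (card E) / N)" using lt J(1) Jne by (intro sum_strict_mono) auto
  also have "\<dots> = real (card J) * (real (card E) / N)" by simp
  also have "\<dots> \<le> N * (real (card E) / N)" using J(3) N by (intro mult_right_mono) auto
  also have "\<dots> = real (card E)" using N by simp
  finally show False by simp
qed

lemma int_interval_card:
  fixes h :: real
  assumes "h > 0" "T \<ge> 0"
  shows "finite {z::int. \<bar>h * of_int z - L\<bar> \<le> T}" "real (card {z::int. \<bar>h * of_int z - L\<bar> \<le> T}) \<le> 2 * T / h + 1"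
proof -
  have sub: "{z::int. \<bar>h * of_int z - L\<bar> \<le> T} \<subseteq> {\<lceil>(L - T) / h\<rceil>..\<lfloor>(L + T) / h\<rfloor>}"
  proof
    fix z :: int assume "z \<in> {z. \<bar>h * of_int z - L\<bar> \<le> T}"
    then have "L - T \<le> h * of_int z" "h * of_int z \<le> L + T" by auto
    then have "(L - T) / h \<le> of_int z" "of_int z \<le> (L + T) / h" using assms(1) by (simp_all add: field_simps)
    then show "z \<in> {\<lceil>(L - T) / h\<rceil>..\<lfloor>(L + T) / h\<rfloor>}" by (simp add: ceiling_le_iff le_floor_iff)
  qed
  then show "finite {z::int. \<bar>h * of_int z - L\<bar> \<le> T}" using finite_subset by blast
  have "card {z::int. \<bar>h * of_int z - L\<bar> \<le> T} \<le> card {\<lceil>(L - T) / h\<rceil>..\<lfloor>(L + T) / h\<rfloor>}"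
    using sub by (intro card_mono) auto
  then have "real (card {z::int. \<bar>h * of_int z - L\<bar> \<le> T}) \<le> real (nat (\<lfloor>(L + T) / h\<rfloor> - \<lceil>(L - T) / h\<rceil> + 1))" by simp
  also have "\<dots> \<le> 2 * T / h + 1"
  proof -
    have "(L + T) / h - (L - T) / h = 2 * T / h" using assms(1) by (simp add: field_simps)
    moreover have "of_int (\<lfloor>(L + T) / h\<rfloor> - \<lceil>(L - T) / h\<rceil>) \<le> (L + T) / h - (L - T) / h" by linarith
    moreover have "2 * T / h \<ge> 0" using assms by simp
    ultimately show ?thesis by linarith
  qed
  finally show "real (card {z::int. \<bar>h * of_int z - L\<bar> \<le> T}) \<le> 2 * T / h + 1" .
qed

lemma floor_rounding:
  fixes h :: real
  assumes "h > 0"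
  shows "0 \<le> u - h * of_int \<lfloor>u / h\<rfloor>" "u - h * of_int \<lfloor>u / h\<rfloor> < h"
proof -
  have "h * of_int \<lfloor>u / h\<rfloor> \<le> h * (u / h)" using assms by (intro mult_left_mono) auto
  then show "0 \<le> u - h * of_int \<lfloor>u / h\<rfloor>" using assms by simp
  have "h * (u / h) < h * (of_int \<lfloor>u / h\<rfloor> + 1)" using assms by (intro mult_strict_left_mono) linarith+
  then show "u - h * of_int \<lfloor>u / h\<rfloor> < h" using assms by (simp add: algebra_simps)
qed

lemma abs_prod_diff_le:
  fixes p q p' q' :: real
  assumes "\<bar>p - p'\<bar> \<le> e" "\<bar>q - q'\<bar> \<le> e" "\<bar>p\<bar> \<le> A" "\<bar>q'\<bar> \<le> B" "e \<ge> 0"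
  shows "\<bar>p * q - p' * q'\<bar> \<le> (A + B) * e"
proof -
  have "p * q - p' * q' = p * (q - q') + (p - p') * q'" by (simp add: algebra_simps)
  then have "\<bar>p * q - p' * q'\<bar> \<le> \<bar>p\<bar> * \<bar>q - q'\<bar> + \<bar>p - p'\<bar> * \<bar>q'\<bar>" by (metis abs_mult abs_triangle_ineq)
  also have "\<dots> \<le> A * e + e * B" using assms by (intro add_mono mult_mono) auto
  finally show ?thesis by (simp add: algebra_simps)
qed

definition approx_quads :: "nat \<Rightarrow> (nat \<Rightarrow> real) \<Rightarrow> (nat \<Rightarrow> real) \<Rightarrow> real \<Rightarrow> real set \<Rightarrow> (nat \<times> nat \<times> nat \<times> nat) set" where
  "approx_quads n w v \<alpha> Q = {(i, j, k, l). i \<in> {1..n} \<and> j \<in> {1..n} \<and> k \<in> {1..n} \<and> l \<in> {1..n} \<and>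
      (\<exists>q\<in>Q. \<bar>(w i - w j) * (v k - v l) - q\<bar> \<le> \<alpha>)}"

lemma finite_approx_quads: "finite (approx_quads n w v \<alpha> Q)"
  by (rule finite_subset[of _ "quads n"]) (auto simp: approx_quads_def)

text \<open>The coordinates of unit vectors are at most 1, so errors of products are proportional to
  the mesh: 5/2 h for a summand of the permuted sum and 9/2 h for a product of differences. Both are
  rounded up, the second to 8 h, which will be \<alpha>.\<close>

lemma rounding_approximates:
  assumes w: "unit_vec n w" and v: "unit_vec n v" and h: "0 < h" "h \<le> 1 / 2"
  defines "a \<equiv> \<lambda>i. \<lfloor>w i / h\<rfloor>" and "b \<equiv> \<lambda>i. \<lfloor>v i / h\<rfloor>"
  shows "\<pi> permutes {1..n} \<Longrightarrow> \<bar>perm_sum n w v \<pi> - h\<^sup>2 * of_int (\<Sum>i=1..n. a i * b (\<pi> i))\<bar> \<le> 3 * real n * h"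
    and "{q\<in>quads n. h\<^sup>2 * of_int (quad_prod a b q) \<in> Q} \<subseteq> approx_quads n w v (8 * h) Q"
proof -
  have wa: "\<bar>w i - h * of_int (a i)\<bar> \<le> h" "\<bar>v i - h * of_int (b i)\<bar> \<le> h" for i
    using floor_rounding[OF h(1), of "w i"] floor_rounding[OF h(1), of "v i"] by (auto simp: a_def b_def)
  have w1: "\<bar>w i\<bar> \<le> 1" "\<bar>v i\<bar> \<le> 1" if "i \<in> {1..n}" for i using unit_vec_abs_le w v that by blast+
  show "\<bar>perm_sum n w v \<pi> - h\<^sup>2 * of_int (\<Sum>i=1..n. a i * b (\<pi> i))\<bar> \<le> 3 * real n * h" if \<pi>: "\<pi> permutes {1..n}"
  proof -
    have "perm_sum n w v \<pi> - h\<^sup>2 * of_int (\<Sum>i=1..n. a i * b (\<pi> i)) =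
        (\<Sum>i=1..n. w i * v (\<pi> i) - (h * of_int (a i)) * (h * of_int (b (\<pi> i))))"
      by (simp add: perm_sum_def sum_subtractf sum_distrib_left power2_eq_square mult_ac)
    also have "\<bar>\<dots>\<bar> \<le> (\<Sum>i=1..n. \<bar>w i * v (\<pi> i) - (h * of_int (a i)) * (h * of_int (b (\<pi> i)))\<bar>)" by (rule sum_abs)
    also have "\<dots> \<le> (\<Sum>i=1..n. 3 * h)"
    proof (rule sum_mono)
      fix i assume i: "i \<in> {1..n}"
      then have pi: "\<pi> i \<in> {1..n}" using \<pi> permutes_in_image by fastforce
      have "\<bar>h * of_int (b (\<pi> i))\<bar> \<le> 3 / 2" using wa(2)[of "\<pi> i"] w1(2)[OF pi] h by linarith
      then have "\<bar>w i * v (\<pi> i) - (h * of_int (a i)) * (h * of_int (b (\<pi> i)))\<bar> \<le> (1 + 3 / 2) * h"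
        using wa w1(1)[OF i] h by (intro abs_prod_diff_le) auto
      then show "\<bar>w i * v (\<pi> i) - (h * of_int (a i)) * (h * of_int (b (\<pi> i)))\<bar> \<le> 3 * h" using h by simp
    qed
    finally show ?thesis by simp
  qed
  show "{q\<in>quads n. h\<^sup>2 * of_int (quad_prod a b q) \<in> Q} \<subseteq> approx_quads n w v (8 * h) Q"
  proof
    fix q assume q: "q \<in> {q\<in>quads n. h\<^sup>2 * of_int (quad_prod a b q) \<in> Q}"
    obtain i j k l where ijkl: "q = (i, j, k, l)" by (cases q)
    have I: "i \<in> {1..n}" "j \<in> {1..n}" "k \<in> {1..n}" "l \<in> {1..n}" using q ijkl by auto
    define p' q' where "p' = h * of_int (a i) - h * of_int (a j)" and "q' = h * of_int (b k) - h * of_int (b l)"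
    have "\<bar>(w i - w j) - p'\<bar> \<le> h" "\<bar>(v k - v l) - q'\<bar> \<le> h"
      using floor_rounding[OF h(1), of "w i"] floor_rounding[OF h(1), of "w j"]
        floor_rounding[OF h(1), of "v k"] floor_rounding[OF h(1), of "v l"]
      unfolding p'_def q'_def a_def b_def by linarith+
    moreover have "\<bar>w i - w j\<bar> \<le> 2" using w1(1)[OF I(1)] w1(1)[OF I(2)] by linarith
    moreover have "\<bar>q'\<bar> \<le> 5 / 2" using calculation(2) w1(2)[OF I(3)] w1(2)[OF I(4)] h by linarith
    ultimately have "\<bar>(w i - w j) * (v k - v l) - p' * q'\<bar> \<le> (2 + 5 / 2) * h" using h by (intro abs_prod_diff_le) auto
    then have "\<bar>(w i - w j) * (v k - v l) - p' * q'\<bar> \<le> 8 * h" using h by simp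
    moreover have "p' * q' = h\<^sup>2 * of_int (quad_prod a b q)"
      by (simp add: p'_def q'_def ijkl quad_prod_def power2_eq_square algebra_simps)
    ultimately show "q \<in> approx_quads n w v (8 * h) Q" using q I unfolding approx_quads_def ijkl by auto
  qed
qed

text \<open>Discretisation divides \<rho> by the number of mesh values in the window; that number
  must be polynomial in n for \<open>discrete_inverse\<close> to apply to the quotient.\<close>

lemma mesh_count_bound:
  fixes \<alpha> \<delta> C' :: real
  assumes n: "n \<ge> 1000" and \<alpha>: "real n powr (- C') \<le> \<alpha>" "\<alpha> < 4" and \<delta>: "0 \<le> \<delta>" "\<delta> \<le> 1"
    and m: "m = \<lceil>1 / \<alpha>\<^sup>2 * (2 * \<delta> + 3 * real n * \<alpha>)\<rceil>" and C': "C' > 0"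
  shows "65 * real_of_int m \<le> real n powr (2 * C' + 2)"
proof -
  have np: "real n powr (- C') > 0" using n by simp
  have "1 / \<alpha> \<le> 1 / real n powr (- C')" by (rule frac_le) (use \<alpha>(1) np in auto)
  then have "1 / \<alpha> \<le> real n powr C'" by (simp add: powr_minus_divide)
  moreover have "0 < 1 / \<alpha>" using less_le_trans[OF np \<alpha>(1)] by simp
  ultimately have "(1 / \<alpha>)\<^sup>2 \<le> (real n powr C')\<^sup>2" by (intro power_mono) auto
  then have a2: "1 / \<alpha>\<^sup>2 \<le> real n powr (2 * C')"
    by (simp add: power_divide power2_eq_square powr_add[symmetric])
  have one: "1 \<le> real n powr (2 * C')" using n C' by (intro ge_one_powr_ge_zero) auto
  have "3 * real n * \<alpha> \<le> 3 * real n * 4" using \<alpha>(2) by (intro mult_left_mono) auto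
  moreover have "real n \<ge> 1000" using n by simp
  ultimately have "2 * \<delta> + 3 * real n * \<alpha> \<le> 14 * real n" using \<delta> by linarith
  then have "1 / \<alpha>\<^sup>2 * (2 * \<delta> + 3 * real n * \<alpha>) \<le> real n powr (2 * C') * (14 * real n)"
    using a2 \<delta> less_le_trans[OF np \<alpha>(1)] by (intro mult_mono) auto
  then have "real_of_int m \<le> real n powr (2 * C') * (14 * real n) + 1" unfolding m by linarith
  also have "\<dots> \<le> real n powr (2 * C') * (14 * real n) + real n powr (2 * C') * real n"
    using mult_mono[OF one, of 1 "real n"] n by (simp add: mult.commute)
  \<comment> \<open>65 times 15 is 975, which explains the threshold 1000 for
    \<open>n\<close>.\<close>
  finally have "65 * real_of_int m \<le> real n powr (2 * C') * (975 * real n)" by simp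
  also have "\<dots> \<le> real n powr (2 * C') * (real n * real n)" using n by (intro mult_left_mono) auto
  also have "\<dots> = real n powr (2 * C' + 2)" using n by (simp add: powr_add power2_eq_square)
  finally show ?thesis .
qed

theorem theorem2p11:
  fixes C C' \<epsilon> :: real
  assumes "C > 0" and "C' > 0" and "0 < \<epsilon>" and "\<epsilon> < 1"
  shows "\<exists>(n\<^sub>0::nat) (R::nat) (K::real).
    \<forall>n\<ge>n\<^sub>0. \<forall>(w::nat \<Rightarrow> real) (v::nat \<Rightarrow> real) (L::real) (\<delta>::real) (\<rho>::real).
      unit_vec n w \<longrightarrow> unit_vec n v \<longrightarrow> 0 \<le> \<delta> \<longrightarrow> \<delta> \<le> 1 \<longrightarrow>
      \<rho> = measure_pmf.prob (random_perm n) {\<pi>. \<bar>perm_sum n w v \<pi> - L\<bar> \<le> \<delta>} \<longrightarrow>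
      \<rho> \<ge> real n powr (- C) \<longrightarrow>
      (\<forall>(\<alpha>::real) (n'::real) (m::int).
        \<alpha> \<ge> real n powr (- C') \<longrightarrow> real n powr \<epsilon> \<le> n' \<longrightarrow> n' \<le> real n \<longrightarrow>
        m = \<lceil>1 / \<alpha>\<^sup>2 * (2 * \<delta> + 3 * real n * \<alpha>)\<rceil> \<longrightarrow>
        (\<exists>(Q::real set) (r\<^sub>0::nat).
          proper_symmetric_gap r\<^sub>0 Q \<and> r\<^sub>0 \<le> R \<and>
          real (card Q) \<le> K * of_int m * inverse \<rho> * n' powr (- real r\<^sub>0 / 2) \<and>
          real (card {(i, j, k, l). i \<in> {1..n} \<and> j \<in> {1..n} \<and> k \<in> {1..n} \<and> l \<in> {1..n} \<and>
                        (\<exists>q\<in>Q. \<bar>(w i - w j) * (v k - v l) - q\<bar> \<le> \<alpha>)})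
            \<ge> (1 - n' / real n) * real n ^ 4))"
proof -
  \<comment> \<open>\<open>C\<close> bounds \<rho> itself; 2 C' + 2 is the exponent lost in
    \<open>mesh_count_bound\<close>.\<close>
  define C1 where "C1 = C + 2 * C' + 2"
  have C1: "C1 > 0" using assms by (simp add: C1_def)
  obtain n0 R K where K: "0 < K" and DI: "\<forall>n\<ge>n0. \<forall>(a::nat \<Rightarrow> int) (b::nat \<Rightarrow> int) x \<rho> n' \<eta>.
    0 < \<rho> \<longrightarrow> \<rho> \<le> real (card {\<pi>\<in>perms n. (\<Sum>i=1..n. a i * b (\<pi> i)) = x}) / fact n \<longrightarrow>
    real n powr (- C1) \<le> \<rho> \<longrightarrow> real n powr \<epsilon> \<le> n' \<longrightarrow> n' \<le> real n \<longrightarrow>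
    (\<exists>d\<le>R. \<exists>Q. proper_symmetric_gap d Q \<and> real (card Q) \<le> K * inverse \<rho> * n' powr (- real d / 2) \<and>
       real (card {q\<in>quads n. \<eta> * of_int (quad_prod a b q) \<in> Q}) \<ge> (1 - n' / real n) * real n ^ 4)"
    using discrete_inverse[OF C1 assms(3)] by (elim exE conjE) (rule that)
  \<comment> \<open>65 is the loss in the pigeonhole over mesh values; the summand 1 gives K' \<ge>
    1, as required when Q is {0}.\<close>
  define K' where "K' = 65 * K + 1"
  have main: "\<exists>Q r0. proper_symmetric_gap r0 Q \<and> r0 \<le> R \<and>
      real (card Q) \<le> K' * of_int m * inverse \<rho> * n' powr (- real r0 / 2) \<and>
      real (card (approx_quads n w v \<alpha> Q)) \<ge> (1 - n' / real n) * real n ^ 4"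
    if n: "max n0 1000 \<le> n" and w: "unit_vec n w" and v: "unit_vec n v" and \<delta>: "0 \<le> \<delta>" "\<delta> \<le> 1"
      and \<rho>: "\<rho> = measure_pmf.prob (random_perm n) {\<pi>. \<bar>perm_sum n w v \<pi> - L\<bar> \<le> \<delta>}"
      and \<rho>C: "real n powr (- C) \<le> \<rho>" and \<alpha>: "real n powr (- C') \<le> \<alpha>"
      and n': "real n powr \<epsilon> \<le> n'" "n' \<le> real n" and m: "m = \<lceil>1 / \<alpha>\<^sup>2 * (2 * \<delta> + 3 * real n * \<alpha>)\<rceil>"
    for n w v L \<delta> \<rho> \<alpha> n' and m :: int
  proof -
    have nb: "n \<ge> n0" "n \<ge> 1000" using n by auto
    have \<rho>0: "\<rho> > 0" using nb(2) by (intro less_le_trans[OF _ \<rho>C]) simp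
    have \<alpha>0: "\<alpha> > 0" using nb(2) by (intro less_le_trans[OF _ \<alpha>]) simp
    have n'0: "n' > 0" using nb(2) by (intro less_le_trans[OF _ n'(1)]) simp
    have \<rho>1: "\<rho> \<le> 1" unfolding \<rho> by simp
    have "1 / \<alpha>\<^sup>2 * (2 * \<delta> + 3 * real n * \<alpha>) > 0"
      using \<alpha>0 \<delta> nb(2) by (intro mult_pos_pos add_nonneg_pos) auto
    then have m1: "m \<ge> 1" and mge: "1 / \<alpha>\<^sup>2 * (2 * \<delta> + 3 * real n * \<alpha>) \<le> of_int m" unfolding m by linarith+
    show ?thesis
    proof (cases "\<alpha> \<ge> 4")
      \<comment> \<open>Every product of differences has modulus at most 4, so {0} of rank 0
        suffices. The other case has \<alpha> < 4, which the rounding needs for h \<le> 1/2.\<close>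
      case True
      have "quads n \<subseteq> approx_quads n w v \<alpha> {0}"
      proof
        fix q assume q: "q \<in> quads n"
        obtain i j k l where ijkl: "q = (i, j, k, l)" by (cases q)
        have I: "i \<in> {1..n}" "j \<in> {1..n}" "k \<in> {1..n}" "l \<in> {1..n}" using q ijkl by auto
        have "\<bar>w i - w j\<bar> \<le> 2" "\<bar>v k - v l\<bar> \<le> 2"
          using unit_vec_abs_le[OF w I(1)] unit_vec_abs_le[OF w I(2)]
            unit_vec_abs_le[OF v I(3)] unit_vec_abs_le[OF v I(4)] by linarith+
        then have "\<bar>(w i - w j) * (v k - v l)\<bar> \<le> 2 * 2" unfolding abs_mult by (intro mult_mono) auto
        then show "q \<in> approx_quads n w v \<alpha> {0}" using True I by (simp add: approx_quads_def ijkl)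
      qed
      then have "n ^ 4 \<le> card (approx_quads n w v \<alpha> {0})"
        unfolding card_quads[symmetric] by (intro card_mono finite_approx_quads)
      then have "real n ^ 4 \<le> real (card (approx_quads n w v \<alpha> {0}))" by (simp flip: of_nat_power)
      moreover have "(1 - n' / real n) * real n ^ 4 \<le> 1 * real n ^ 4"
        using n'0 by (intro mult_right_mono) auto
      ultimately have cnt: "(1 - n' / real n) * real n ^ 4 \<le> real (card (approx_quads n w v \<alpha> {0}))" by linarith
      have "1 * 1 * 1 \<le> K' * of_int m * inverse \<rho>"
        using K m1 \<rho>0 \<rho>1 by (intro mult_mono) (auto simp: K'_def one_le_inverse)
      then have "real (card {0::real}) \<le> K' * of_int m * inverse \<rho> * n' powr (- real 0 / 2)" using n'0 by simp
      then show ?thesis using cnt proper_symmetric_gap_zero by blast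
    next
      case False
      define h where "h = \<alpha> / 8"
      have h: "0 < h" "h \<le> 1 / 2" "8 * h = \<alpha>" using \<alpha>0 False by (auto simp: h_def)
      define a b where "a = (\<lambda>i. \<lfloor>w i / h\<rfloor>)" and "b = (\<lambda>i. \<lfloor>v i / h\<rfloor>)"
      define s where "s \<pi> = (\<Sum>i=1..n. a i * b (\<pi> i))" for \<pi>
      define E where "E = perms n \<inter> {\<pi>. \<bar>perm_sum n w v \<pi> - L\<bar> \<le> \<delta>}"
      have \<rho>E: "\<rho> = real (card E) / fact n" unfolding \<rho> E_def by (rule prob_random_perm)
      have E: "finite E" "E \<noteq> {}" using finite_perms \<rho>0 \<rho>E by (auto simp: E_def)
      define T where "T = \<delta> + 3 * real n * h"
      define J where "J = {z::int. \<bar>h\<^sup>2 * of_int z - L\<bar> \<le> T}"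
      have T: "T \<ge> 0" using \<delta> h by (simp add: T_def)
      have J: "finite J" "real (card J) \<le> 2 * T / h\<^sup>2 + 1"
        unfolding J_def using int_interval_card[of "h\<^sup>2" T L] h(1) T by auto
      have sJ: "s ` E \<subseteq> J"
      proof
        fix z assume "z \<in> s ` E"
        then obtain \<pi> where \<pi>: "\<pi> permutes {1..n}" "\<bar>perm_sum n w v \<pi> - L\<bar> \<le> \<delta>" "z = s \<pi>" by (auto simp: E_def)
        have "\<bar>perm_sum n w v \<pi> - h\<^sup>2 * of_int (s \<pi>)\<bar> \<le> 3 * real n * h"
          unfolding s_def a_def b_def by (rule rounding_approximates(1)[OF w v h(1,2) \<pi>(1)])
        then show "z \<in> J" using \<pi>(2,3) unfolding J_def T_def by simp
      qed
      have cJ: "real (card J) \<le> 65 * of_int m"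
      proof -
        \<comment> \<open>The mesh \<alpha> / 8 is responsible for the factor 64; the additional 1
          for the number of integers in an interval is absorbed by m \<ge> 1, giving 65.\<close>
        have "2 * T / h\<^sup>2 = 64 * (1 / \<alpha>\<^sup>2 * (2 * \<delta> + 3 / 4 * real n * \<alpha>))"
          using \<alpha>0 by (simp add: T_def h_def power2_eq_square field_simps)
        also have "\<dots> \<le> 64 * (1 / \<alpha>\<^sup>2 * (2 * \<delta> + 3 * real n * \<alpha>))"
          using \<alpha>0 by (intro mult_left_mono add_left_mono mult_right_mono) auto
        also have "\<dots> \<le> 64 * of_int m" using mge by (intro mult_left_mono) auto
        finally show ?thesis using J(2) m1 by linarith
      qed
      obtain z where z: "real (card E) / (65 * of_int m) \<le> real (card {\<pi>\<in>E. s \<pi> = z})"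
        using popular_value[OF E J(1) sJ cJ] by blast
      define \<rho>' where "\<rho>' = \<rho> / (65 * of_int m)"
      have r0: "0 < \<rho>'" using \<rho>0 m1 by (simp add: \<rho>'_def)
      have r1: "\<rho>' \<le> real (card {\<pi>\<in>perms n. (\<Sum>i=1..n. a i * b (\<pi> i)) = z}) / fact n"
      proof -
        have "card {\<pi>\<in>E. s \<pi> = z} \<le> card {\<pi>\<in>perms n. s \<pi> = z}"
          using finite_perms[of n] by (intro card_mono) (auto simp: E_def)
        then have "real (card E) / (65 * of_int m) \<le> real (card {\<pi>\<in>perms n. s \<pi> = z})" using z by linarith
        then have "real (card E) / (65 * of_int m) / fact n \<le> real (card {\<pi>\<in>perms n. s \<pi> = z}) / fact n"
          by (intro divide_right_mono) auto
        then show ?thesis by (simp add: \<rho>'_def \<rho>E s_def mult.commute)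
      qed
      have r2: "real n powr (- C1) \<le> \<rho>'"
      proof -
        have "real n powr (- C1) = real n powr (- C) / real n powr (2 * C' + 2)"
          unfolding powr_diff[symmetric] by (rule arg_cong[where f = "\<lambda>x. real n powr x"]) (simp add: C1_def)
        also have "\<dots> \<le> \<rho> / (65 * of_int m)"
          using \<rho>C \<rho>0 m1 mesh_count_bound[OF nb(2) \<alpha> _ \<delta> m assms(2)] False nb(2) by (intro frac_le) auto
        finally show ?thesis by (simp add: \<rho>'_def)
      qed
      obtain d Q where d: "d \<le> R" and Q: "proper_symmetric_gap d Q"
        "real (card Q) \<le> K * inverse \<rho>' * n' powr (- real d / 2)"
        "(1 - n' / real n) * real n ^ 4 \<le> real (card {q\<in>quads n. h\<^sup>2 * of_int (quad_prod a b q) \<in> Q})"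
        using DI[rule_format, OF nb(1) r0 r1 r2 n', of "h\<^sup>2"] by blast
      have "card {q\<in>quads n. h\<^sup>2 * of_int (quad_prod a b q) \<in> Q} \<le> card (approx_quads n w v \<alpha> Q)"
        using rounding_approximates(2)[OF w v h(1,2), of Q] finite_approx_quads
        unfolding a_def b_def h(3) by (intro card_mono) auto
      then have cnt: "(1 - n' / real n) * real n ^ 4 \<le> real (card (approx_quads n w v \<alpha> Q))"
        using Q(3) by linarith
      have "K * inverse \<rho>' * n' powr (- real d / 2) = 65 * K * of_int m * inverse \<rho> * n' powr (- real d / 2)"
        using m1 \<rho>0 by (simp add: \<rho>'_def field_simps)
      also have "\<dots> \<le> K' * of_int m * inverse \<rho> * n' powr (- real d / 2)"
        using m1 \<rho>0 by (intro mult_right_mono) (auto simp: K'_def)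
      finally have "real (card Q) \<le> K' * of_int m * inverse \<rho> * n' powr (- real d / 2)" using Q(2) by linarith
      then show ?thesis using d Q(1) cnt by blast
    qed
  qed
  show ?thesis
  proof (rule exI[of _ "max n0 1000"], rule exI[of _ R], rule exI[of _ K'], intro allI impI, goal_cases)
    case (1 n w v L \<delta> \<rho> \<alpha> n' m)
    show ?case using main[OF 1] unfolding approx_quads_def .
  qed
qed

end
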